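(* Let $T>0$. For each $n\ge 0$ let $\lambda^n,\nu^n\ge 0$, let $f^n\in\mathcal C^1(\mathbb R_+,\mathbb R_+)$ be non-decreasing with $f^n(0)=0$ and with derivative of at most linear growth, let $K^n\in L^1_{loc}(\mathbb R_+,\mathbb R_+)$, let $G_0^n:\mathbb R_+\to\mathbb R_+$ be non-decreasing with $G^n_0(0)=0$, and let $(W^n,X^n)$ be a weak solution on $[0,T]$ to $$X^n_t=G^n_0(t)+\int_0^tK^n(t-s)\,\bigl(-\lambda^n X^n_s+\nu^n W^n_{f^n(X^n_s)}\bigr)\,ds$$ for the input $(G_0^n,K^n,f^n,\lambda^n,\nu^n)$. Suppose that: - $K^n(t)\,dt\Rightarrow\delta_0(dt)$ weakly on $[0,T]$; - $G_0^n\to G_0$ pointwise on $[0,T]$, where $G_0$ is continuous; - $f^n\to f$ locally uniformly on $\mathbb R_+$ in the sense that, for every $x\in\mathbb R_+$, $\limsup_{n\to\infty}\sup\{|f^n(s)-f(r)|: s,r\in[x-\delta,x+\delta]\cap\mathbb R_+\}\to 0$ as $\delta\to 0$; and $\sup_{n\ge 0}\sup_{x\ge 0}f^n(x)/(1+x^2)<+\infty$; - $\lambda^n\to\lambda$ and $\nu^n\to\nu$. Then we have the weak convergence of processes $(W^n,X^n)\Rightarrow(W^*,X^* )$ on $D^\circ[0,T]$ as $n\to\infty$, where $W^*$ is a standard Brownian motion and $$X^*_t=\inf\{s\ge 0: (1+\lambda)s-\nu W^*_{f(s)}>G_0(t)\},\qquad t\le T.$$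
   Context: Weak solution: $(W,X)$ is a weak solution on $[0,T]$ for the input $(G_0,K,f,\lambda,\nu)$ if there is a filtered probability space $(\Omega,\mathcal F,(\mathcal G_t)_{t\ge 0},\mathbb P)$ supporting a $(\mathcal G_t)_{t\ge 0}$-Brownian motion $W$ and a non-decreasing continuous process $(X_t)_{t\le T}$ starting from $0$ such that: (i) for every $t\in[0,T]$, $f(X_t)$ is a $(\mathcal G_s)_{s\ge 0}$-stopping time; (ii) $(W_{f(X_t)})_{t\le T}$ is a martingale with respect to its own filtration; (iii) $X_t=G_0(t)+\int_0^tK(t-s)(-\lambda X_s+\nu W_{f(X_s)})\,ds$ holds $\mathbb P$-almost surely on $[0,T]$. (The solutions for different $n$ may live on different probability spaces.) Weak convergence $K^n(t)\,dt\Rightarrow\delta_0(dt)$ on $[0,T]$ means weak convergence of the measures $K^n(t)\,dt$ restricted to $[0,T]$ to the Dirac mass at $0$. $C[0,\infty)$ denotes the continuous paths $[0,\infty)\to\mathbb R$ with uniform convergence on compacts. $D[0,T]$ denotes the càdlàg paths $[0,T]\to\mathbb R$ and $D^\uparrow[0,T]\subset D[0,T]$ the non-negative non-decreasing ones, equipped with Skorokhod's $M_1$ topology (for $\tau^n,\tau\in D^\uparrow[0,T]$, $\tau^n\to\tau$ in $M_1$ if and only if $\tau^n(t)\to\tau(t)$ for all $t$ in a dense subset of $[0,T]$ containing $0$ and $T$). $D^\circ[0,T]:=\{(\phi,\tau):\phi\in C[0,\infty),\ \tau\in D^\uparrow[0,T]\}$ carries the product topology, and is Polish. *)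

theory Defs
  imports "HOL-Probability.Probability"
begin

section \<open>Path spaces\<close>

text \<open>
  Paths are functions \<^typ>\<open>real \<Rightarrow> real\<close> that are extensional on their time domain, so that two paths
  are equal iff they agree on that domain.
\<close>

definition C_paths :: "(real \<Rightarrow> real) set" where
  "C_paths = {\<phi> \<in> extensional {0..}. continuous_on {0..} \<phi>}"

text \<open>Uniform convergence on compacts, given by its basic neighbourhoods.\<close>

definition C_topology :: "(real \<Rightarrow> real) topology" where
  "C_topology = topology (\<lambda>U. U \<subseteq> C_paths \<and>
     (\<forall>\<phi>\<in>U. \<exists>b. \<exists>e>0. \<forall>\<psi>\<in>C_paths. (\<forall>t\<in>{0..b}. \<bar>\<psi> t - \<phi> t\<bar> < e) \<longrightarrow> \<psi> \<in> U))"

lemma openin_C_topology: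
  "openin C_topology U \<longleftrightarrow> U \<subseteq> C_paths \<and>
     (\<forall>\<phi>\<in>U. \<exists>b. \<exists>e>0. \<forall>\<psi>\<in>C_paths. (\<forall>t\<in>{0..b}. \<bar>\<psi> t - \<phi> t\<bar> < e) \<longrightarrow> \<psi> \<in> U)"
proof -
  have "istopology (\<lambda>U. U \<subseteq> C_paths \<and>
     (\<forall>\<phi>\<in>U. \<exists>b. \<exists>e>0. \<forall>\<psi>\<in>C_paths. (\<forall>t\<in>{0..b}. \<bar>\<psi> t - \<phi> t\<bar> < e) \<longrightarrow> \<psi> \<in> U))"
    (is "istopology ?P")
    unfolding istopology_def
  proof (intro conjI allI impI)
    fix S V assume S: "?P S" and V: "?P V"
    show "S \<inter> V \<subseteq> C_paths" using S by blast
    show "\<forall>\<phi>\<in>S \<inter> V. \<exists>b. \<exists>e>0. \<forall>\<psi>\<in>C_paths. (\<forall>t\<in>{0..b}. \<bar>\<psi> t - \<phi> t\<bar> < e) \<longrightarrow> \<psi> \<in> S \<inter> V"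
    proof
      fix \<phi> assume "\<phi> \<in> S \<inter> V"
      then obtain b1 e1 b2 e2 where
        1: "e1 > 0" "\<forall>\<psi>\<in>C_paths. (\<forall>t\<in>{0..b1}. \<bar>\<psi> t - \<phi> t\<bar> < e1) \<longrightarrow> \<psi> \<in> S" and
        2: "e2 > 0" "\<forall>\<psi>\<in>C_paths. (\<forall>t\<in>{0..b2}. \<bar>\<psi> t - \<phi> t\<bar> < e2) \<longrightarrow> \<psi> \<in> V"
        using S V by (metis IntE)
      have sub: "{0..b1} \<subseteq> {0..max b1 b2}" "{0..b2} \<subseteq> {0..max b1 b2}"
        by auto
      have "min e1 e2 > 0" "\<forall>\<psi>\<in>C_paths. (\<forall>t\<in>{0..max b1 b2}. \<bar>\<psi> t - \<phi> t\<bar> < min e1 e2) \<longrightarrow> \<psi> \<in> S \<inter> V"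
        using 1 2 sub by (simp, metis IntI min_less_iff_conj subsetD)
      then show "\<exists>b. \<exists>e>0. \<forall>\<psi>\<in>C_paths. (\<forall>t\<in>{0..b}. \<bar>\<psi> t - \<phi> t\<bar> < e) \<longrightarrow> \<psi> \<in> S \<inter> V"
        by blast
    qed
  next
    fix \<K> assume K: "\<forall>S\<in>\<K>. ?P S"
    show "\<Union>\<K> \<subseteq> C_paths" using K by blast
    show "\<forall>\<phi>\<in>\<Union>\<K>. \<exists>b. \<exists>e>0. \<forall>\<psi>\<in>C_paths. (\<forall>t\<in>{0..b}. \<bar>\<psi> t - \<phi> t\<bar> < e) \<longrightarrow> \<psi> \<in> \<Union>\<K>"
    proof
      fix \<phi> assume "\<phi> \<in> \<Union>\<K>"
      then obtain S where S: "S \<in> \<K>" "\<phi> \<in> S" by blast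
      then obtain b e where "e > 0" "\<forall>\<psi>\<in>C_paths. (\<forall>t\<in>{0..b}. \<bar>\<psi> t - \<phi> t\<bar> < e) \<longrightarrow> \<psi> \<in> S"
        using K by meson
      then show "\<exists>b. \<exists>e>0. \<forall>\<psi>\<in>C_paths. (\<forall>t\<in>{0..b}. \<bar>\<psi> t - \<phi> t\<bar> < e) \<longrightarrow> \<psi> \<in> \<Union>\<K>"
        using S by blast
    qed
  qed
  then show ?thesis
    unfolding C_topology_def by (simp add: topology_inverse')
qed

definition D_paths :: "real \<Rightarrow> (real \<Rightarrow> real) set" where
  "D_paths T = {x \<in> extensional {0..T}.
     (\<forall>t\<in>{0..<T}. continuous (at_right t) x) \<and> (\<forall>t\<in>{0<..T}. \<exists>l. (x \<longlongrightarrow> l) (at_left t))}"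

definition D_up_paths :: "real \<Rightarrow> (real \<Rightarrow> real) set" where
  "D_up_paths T = {x \<in> D_paths T. mono_on {0..T} x \<and> (\<forall>t\<in>{0..T}. 0 \<le> x t)}"

subsection \<open>Skorokhod's M1 topology\<close>

text \<open>The usual convention \<open>x(0-) = x(0)\<close>: there is no jump at time \<open>0\<close>.\<close>

definition left_value :: "(real \<Rightarrow> real) \<Rightarrow> real \<Rightarrow> real" where
  "left_value x t = (if t \<le> 0 then x t else Lim (at_left t) x)"

text \<open>Points are written (value, time), as in the literature on M1.\<close>

definition completed_graph :: "real \<Rightarrow> (real \<Rightarrow> real) \<Rightarrow> (real \<times> real) set" where
  "completed_graph T x = {(z, t). t \<in> {0..T} \<and> z \<in> closed_segment (left_value x t) (x t)}"

definition graph_le :: "(real \<Rightarrow> real) \<Rightarrow> real \<times> real \<Rightarrow> real \<times> real \<Rightarrow> bool" where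
  "graph_le x p q \<longleftrightarrow> snd p < snd q \<or>
     (snd p = snd q \<and> \<bar>left_value x (snd p) - fst p\<bar> \<le> \<bar>left_value x (snd q) - fst q\<bar>)"

definition parametric_rep :: "real \<Rightarrow> (real \<Rightarrow> real) \<Rightarrow> (real \<Rightarrow> real \<times> real) \<Rightarrow> bool" where
  "parametric_rep T x g \<longleftrightarrow>
     continuous_on {0..1} g \<and> g ` {0..1} = completed_graph T x \<and>
     (\<forall>a\<in>{0..1}. \<forall>b\<in>{0..1}. a \<le> b \<longrightarrow> graph_le x (g a) (g b))"

definition M1_dist :: "real \<Rightarrow> (real \<Rightarrow> real) \<Rightarrow> (real \<Rightarrow> real) \<Rightarrow> real" where
  "M1_dist T x y = Inf {max (SUP s\<in>{0..1}. \<bar>fst (g s) - fst (h s)\<bar>) (SUP s\<in>{0..1}. \<bar>snd (g s) - snd (h s)\<bar>)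
     | g h. parametric_rep T x g \<and> parametric_rep T y h}"

text \<open>The topology of the metric \<open>M1_dist\<close>; defining it does not require the triangle inequality.\<close>

definition M1_topology :: "real \<Rightarrow> (real \<Rightarrow> real) topology" where
  "M1_topology T = topology (\<lambda>U. U \<subseteq> D_paths T \<and>
     (\<forall>x\<in>U. \<exists>e>0. \<forall>y\<in>D_paths T. M1_dist T x y < e \<longrightarrow> y \<in> U))"

lemma openin_M1_topology:
  "openin (M1_topology T) U \<longleftrightarrow> U \<subseteq> D_paths T \<and>
     (\<forall>x\<in>U. \<exists>e>0. \<forall>y\<in>D_paths T. M1_dist T x y < e \<longrightarrow> y \<in> U)"
proof -
  have "istopology (\<lambda>U. U \<subseteq> D_paths T \<and>
     (\<forall>x\<in>U. \<exists>e>0. \<forall>y\<in>D_paths T. M1_dist T x y < e \<longrightarrow> y \<in> U))"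
    (is "istopology ?P")
    unfolding istopology_def
  proof (intro conjI allI impI)
    fix S V assume S: "?P S" and V: "?P V"
    show "S \<inter> V \<subseteq> D_paths T" using S by blast
    show "\<forall>x\<in>S \<inter> V. \<exists>e>0. \<forall>y\<in>D_paths T. M1_dist T x y < e \<longrightarrow> y \<in> S \<inter> V"
    proof
      fix x assume "x \<in> S \<inter> V"
      then obtain e1 e2 where
        1: "e1 > 0" "\<forall>y\<in>D_paths T. M1_dist T x y < e1 \<longrightarrow> y \<in> S" and
        2: "e2 > 0" "\<forall>y\<in>D_paths T. M1_dist T x y < e2 \<longrightarrow> y \<in> V"
        using S V by (metis IntE)
      show "\<exists>e>0. \<forall>y\<in>D_paths T. M1_dist T x y < e \<longrightarrow> y \<in> S \<inter> V"
        by (rule exI[of _ "min e1 e2"]) (use 1 2 in auto)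
    qed
  next
    fix \<K> assume K: "\<forall>S\<in>\<K>. ?P S"
    show "\<Union>\<K> \<subseteq> D_paths T" using K by blast
    show "\<forall>x\<in>\<Union>\<K>. \<exists>e>0. \<forall>y\<in>D_paths T. M1_dist T x y < e \<longrightarrow> y \<in> \<Union>\<K>"
      using K by (meson UnionE UnionI)
  qed
  then show ?thesis
    unfolding M1_topology_def by (simp add: topology_inverse')
qed

definition D_circ_topology :: "real \<Rightarrow> ((real \<Rightarrow> real) \<times> (real \<Rightarrow> real)) topology" where
  "D_circ_topology T = prod_topology C_topology (subtopology (M1_topology T) (D_up_paths T))"


section \<open>Weak convergence\<close>

definition borel_of :: "'a topology \<Rightarrow> 'a measure" where
  "borel_of X = sigma (topspace X) {U. openin X U}"

lemma sets_borel_of_top_of_set: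
  assumes "S \<in> sets borel"
  shows "sets (borel_of (top_of_set S)) = sets (restrict_space borel S)"
proof -
  have "sets (restrict_space borel S) = (\<lambda>A. S \<inter> A) ` sigma_sets UNIV {U. open U}"
    by (simp add: sets_restrict_space borel_def)
  also have "\<dots> = sigma_sets S ((\<lambda>A. S \<inter> A) ` {U. open U})"
    using assms by (intro sigma_sets_Int) (auto simp: borel_def)
  also have "(\<lambda>A. S \<inter> A) ` {U. open U} = {U. openin (top_of_set S) U}"
    by (auto simp: openin_open)
  finally show ?thesis
    unfolding borel_of_def by (subst sets_measure_of) (auto dest: openin_imp_subset)
qed

definition weak_convergence :: "'a topology \<Rightarrow> (nat \<Rightarrow> 'a measure) \<Rightarrow> 'a measure \<Rightarrow> bool" where
  "weak_convergence X \<mu>n \<mu> \<longleftrightarrow>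
     (\<forall>n. finite_measure (\<mu>n n) \<and> sets (\<mu>n n) = sets (borel_of X)) \<and>
     finite_measure \<mu> \<and> sets \<mu> = sets (borel_of X) \<and>
     (\<forall>F :: 'a \<Rightarrow> real. continuous_map X euclideanreal F \<and> bounded (F ` topspace X) \<longrightarrow>
        (\<lambda>n. \<integral>x. F x \<partial>\<mu>n n) \<longlonglongrightarrow> (\<integral>x. F x \<partial>\<mu>))"

text \<open>The laws are meaningful only for measurable maps, so measurability is part of the notion.\<close>

definition converges_in_law ::
  "'b topology \<Rightarrow> (nat \<Rightarrow> 'a measure) \<Rightarrow> (nat \<Rightarrow> 'a \<Rightarrow> 'b) \<Rightarrow> 'c measure \<Rightarrow> ('c \<Rightarrow> 'b) \<Rightarrow> bool" where
  "converges_in_law X M Z M' Z' \<longleftrightarrow>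
     (\<forall>n. Z n \<in> M n \<rightarrow>\<^sub>M borel_of X) \<and> Z' \<in> M' \<rightarrow>\<^sub>M borel_of X \<and>
     weak_convergence X (\<lambda>n. distr (M n) (borel_of X) (Z n)) (distr M' (borel_of X) Z')"


section \<open>Stochastic processes\<close>

text \<open>
  Processes are written \<open>W t \<omega>\<close>, with time set the real numbers; only times \<open>t \<ge> 0\<close> (or
  \<open>t \<in> {0..T}\<close>) matter. A filtration over \<open>t \<ge> 0\<close> is extended to negative times, for instance by
  \<open>G t = G 0\<close>; no condition below depends on the extension.
\<close>

locale filtered_prob_space = prob_space M + filtration "space M" G
  for M :: "'a measure" and G :: "real \<Rightarrow> 'a measure" +
  assumes subalgebra_filtration: "subalgebra M (G t)"

definition brownian_motion ::
  "'a measure \<Rightarrow> (real \<Rightarrow> 'a measure) \<Rightarrow> (real \<Rightarrow> 'a \<Rightarrow> real) \<Rightarrow> bool" where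
  "brownian_motion M G W \<longleftrightarrow> filtered_prob_space M G \<and>
     (\<forall>t\<ge>0. W t \<in> borel_measurable (G t)) \<and>
     (AE \<omega> in M. W 0 \<omega> = 0) \<and>
     (\<forall>\<omega>\<in>space M. continuous_on {0..} (\<lambda>t. W t \<omega>)) \<and>
     (\<forall>s t. 0 \<le> s \<and> s < t \<longrightarrow>
        distributed M lborel (\<lambda>\<omega>. W t \<omega> - W s \<omega>) (normal_density 0 (sqrt (t - s))) \<and>
        prob_space.indep_set M (sets (G s))
          (sets (vimage_algebra (space M) (\<lambda>\<omega>. W t \<omega> - W s \<omega>) borel)))"

definition natural_filtration ::
  "'a measure \<Rightarrow> real set \<Rightarrow> (real \<Rightarrow> 'a \<Rightarrow> real) \<Rightarrow> real \<Rightarrow> 'a measure" where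
  "natural_filtration M I Y t =
     sigma (space M) (\<Union>s\<in>{s \<in> I. s \<le> t}. {Y s -` A \<inter> space M | A. A \<in> sets borel})"

definition standard_brownian_motion :: "'a measure \<Rightarrow> (real \<Rightarrow> 'a \<Rightarrow> real) \<Rightarrow> bool" where
  "standard_brownian_motion M W \<longleftrightarrow> brownian_motion M (natural_filtration M {0..} W) W"

definition martingale_on ::
  "'a measure \<Rightarrow> (real \<Rightarrow> 'a measure) \<Rightarrow> real set \<Rightarrow> (real \<Rightarrow> 'a \<Rightarrow> real) \<Rightarrow> bool" where
  "martingale_on M F I Y \<longleftrightarrow>
     (\<forall>t\<in>I. Y t \<in> borel_measurable (F t) \<and> integrable M (Y t)) \<and>
     (\<forall>s\<in>I. \<forall>t\<in>I. s \<le> t \<longrightarrow> (AE \<omega> in M. real_cond_exp M (F s) (Y t) \<omega> = Y s \<omega>))"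

definition weak_solution ::
  "real \<Rightarrow> (real \<Rightarrow> real) \<Rightarrow> (real \<Rightarrow> real) \<Rightarrow> (real \<Rightarrow> real) \<Rightarrow> real \<Rightarrow> real \<Rightarrow>
   'a measure \<Rightarrow> (real \<Rightarrow> 'a \<Rightarrow> real) \<Rightarrow> (real \<Rightarrow> 'a \<Rightarrow> real) \<Rightarrow> bool" where
  "weak_solution T G0 K f lam nu M W X \<longleftrightarrow>
     (\<exists>G. brownian_motion M G W \<and>
       (\<forall>t\<in>{0..T}. X t \<in> borel_measurable M) \<and>
       (\<forall>\<omega>\<in>space M. X 0 \<omega> = 0 \<and> mono_on {0..T} (\<lambda>t. X t \<omega>) \<and> continuous_on {0..T} (\<lambda>t. X t \<omega>)) \<and>
       (\<forall>t\<in>{0..T}. stopping_time G (\<lambda>\<omega>. f (X t \<omega>))) \<and>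
       (let Y = (\<lambda>t \<omega>. W (f (X t \<omega>)) \<omega>)
        in martingale_on M (natural_filtration M {0..T} Y) {0..T} Y) \<and>
       (AE \<omega> in M. \<forall>t\<in>{0..T}.
          X t \<omega> = G0 t + (LINT s:{0..t}|lborel. K (t - s) * (- lam * X s \<omega> + nu * W (f (X s \<omega>)) \<omega>))))"

text \<open>The pair \<open>(W, X)\<close> as a random path in \<open>C[0,\<infinity>) \<times> D[0,T]\<close>.\<close>

definition path_pair ::
  "real \<Rightarrow> (real \<Rightarrow> 'a \<Rightarrow> real) \<Rightarrow> (real \<Rightarrow> 'a \<Rightarrow> real) \<Rightarrow> 'a \<Rightarrow> (real \<Rightarrow> real) \<times> (real \<Rightarrow> real)" where
  "path_pair T W X \<omega> = (restrict (\<lambda>t. W t \<omega>) {0..}, restrict (\<lambda>t. X t \<omega>) {0..T})"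


section \<open>Coefficients and kernels\<close>

text \<open>
  Elements of \<open>L^1_loc\<close> are given by Borel representatives.
  Functions on \<open>[0,\<infinity>)\<close> are total functions whose values at negative arguments are irrelevant;
  the derivative at \<open>0\<close> is one-sided.
\<close>

definition admissible_time_change :: "(real \<Rightarrow> real) \<Rightarrow> bool" where
  "admissible_time_change f \<longleftrightarrow>
     (\<forall>x\<ge>0. 0 \<le> f x) \<and> mono_on {0..} f \<and> f 0 = 0 \<and>
     (\<exists>f'. (\<forall>x\<ge>0. (f has_real_derivative f' x) (at x within {0..})) \<and> continuous_on {0..} f' \<and>
        (\<exists>C. \<forall>x\<ge>0. \<bar>f' x\<bar> \<le> C * (1 + x)))"

definition L1_loc_nonneg :: "(real \<Rightarrow> real) \<Rightarrow> bool" where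
  "L1_loc_nonneg K \<longleftrightarrow> (\<forall>t\<ge>0. 0 \<le> K t) \<and> (\<forall>b\<ge>0. set_integrable lborel {0..b} K)"

definition kernel_measure :: "real \<Rightarrow> (real \<Rightarrow> real) \<Rightarrow> real measure" where
  "kernel_measure T K = density (restrict_space lborel {0..T}) (\<lambda>t. ennreal (K t))"

definition dirac_zero :: "real \<Rightarrow> real measure" where
  "dirac_zero T = return (restrict_space borel {0..T}) 0"

definition locally_uniform_limit :: "(nat \<Rightarrow> real \<Rightarrow> real) \<Rightarrow> (real \<Rightarrow> real) \<Rightarrow> bool" where
  "locally_uniform_limit fn f \<longleftrightarrow>
     (\<forall>x\<ge>0. ((\<lambda>\<delta>. limsup (\<lambda>n. SUP (s, r) \<in> ({x - \<delta>..x + \<delta>} \<inter> {0..}) \<times> ({x - \<delta>..x + \<delta>} \<inter> {0..}).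
        ereal \<bar>fn n s - f r\<bar>)) \<longlongrightarrow> 0) (at_right 0))"

end

theory Submission
  imports Defs
begin

text \<open>
Write \<open>c = 1 + \<lambda>\<close> and \<open>h(s) = c s - \<nu> W(f(s))\<close>, so that the limit is the first passage
\<open>\<sigma>(g) = inf {s \<ge> 0. h(s) > g}\<close> of \<open>h\<close> above the level \<open>g = G0(t)\<close>. The limit is thus a fixed
measurable functional \<open>\<Phi>\<close> of the Brownian path. All \<open>W n\<close> have the law of \<open>W_lim\<close>, hence
\<open>(W n, \<Phi>(W n))\<close> has the law of the limit for every \<open>n\<close>, and it is enough to show that \<open>X n\<close> is close to
\<open>\<Phi>(W n)\<close> in probability. No compactness of laws and no change of probability space is involved.

The comparison at a fixed time \<open>t\<close> with \<open>g = G0(t) > 0\<close> combines three facts.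

 \<^item> Means. Since \<open>W(f(X))\<close> is a centred martingale, the mean \<open>m(t)\<close> of \<open>X t\<close> solves
   \<open>m(t) = G0(t) - \<lambda> \<integral> K(t - s) m(s) ds\<close>. As \<open>m\<close> is monotone and \<open>K\<close> concentrates at \<open>0\<close>, this forces
   \<open>m(t) \<longlonglongrightarrow> G0(t) / c\<close> (\<open>mean_tendsto\<close>).
 \<^item> Wald's identity. \<open>\<sigma>(g)\<close> has mean exactly \<open>g / c\<close> for every \<open>g \<ge> 0\<close> (\<open>wald_identity\<close>). This is where
   the quadratic growth of \<open>f\<close> enters; it is optional stopping along finite grids, together with
   \<open>E (W(f(\<sigma> \<and> R)))\<^sup>2 = O(R)\<close> and \<open>P (\<sigma> \<ge> R) = o(1/R)\<close> to control the paths that have not passed by \<open>R\<close>.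
 \<^item> A one-sided bound. \<open>X n t \<ge> \<sigma>(g - \<eta>)\<close> with probability tending to one
   (\<open>early_probability\<close>). Otherwise \<open>h \<le> g - \<eta>\<close> on all values taken up to time \<open>t\<close>. Since \<open>G0\<close> is above
   \<open>g - \<eta>/4\<close> just before \<open>t\<close>, the equation then makes \<open>X n\<close> gain a fixed amount on each
   of arbitrarily many short time steps, which contradicts the boundedness of \<open>X n T\<close> in probability.

A random variable that is asymptotically above \<open>\<sigma>(g - \<eta>)\<close> and whose mean tends to \<open>g / c\<close> is, up to an
error of order \<open>\<eta>\<close>, equal to \<open>\<sigma>(g)\<close> in \<open>L\<^sup>1\<close>: the means of \<open>\<sigma>(g - \<eta>)\<close> and \<open>\<sigma>(g)\<close> differ by \<open>\<eta> / c\<close> only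
(\<open>L1_convergence\<close>). For \<open>g = 0\<close> both means tend to \<open>0\<close>. The same comparison of means gives the convergence at the two endpoints \<open>0\<close> and \<open>T\<close>,
with no separate study of the times at which \<open>\<sigma>\<close> jumps.

The passage from single times to paths uses that, for monotone paths, closeness on a fine grid of times that
contains \<open>0\<close> and \<open>T\<close> gives closeness in a Levy-type sense, and that this controls the M1 distance
(\<open>levy_close_grid\<close>, \<open>M1_dist_le_levy_close\<close>). A continuous functional need not be uniformly continuous,
but the set of pairs around which it oscillates on the scale \<open>\<delta>\<close> shrinks to the empty set, so it has small
probability under the one law shared by all \<open>(W n, \<Phi>(W n))\<close> (\<open>law_convergence_of_close_paths\<close>).
\<close>

section \<open>Paths close in the sense of Levy are close in M1\<close>

text \<open>
For monotone paths this is a Levy distance at most \<open>e\<close>: the graphs agree up to a shift by \<open>e\<close> in time and in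
value. Truncation of the shifted time at \<open>T\<close> makes the inequality at \<open>t = T\<close> compare the two end values.
\<close>

definition levy_close :: "real \<Rightarrow> real \<Rightarrow> (real \<Rightarrow> real) \<Rightarrow> (real \<Rightarrow> real) \<Rightarrow> bool" where
  "levy_close T e x y \<longleftrightarrow> 0 \<le> e \<and> \<bar>x 0 - y 0\<bar> \<le> e \<and>
     (\<forall>t\<in>{0..T}. y t \<le> x (min T (t + e)) + e \<and> x t \<le> y (min T (t + e)) + e)"

text \<open>
Along the completed graph of a monotone path the sum \<open>u\<close> of value and time is strictly increasing, so it
parametrizes the graph. This is the time coordinate of the point with parameter \<open>u\<close>, that is, the generalized
inverse of \<open>t \<mapsto> x t + t\<close>; it makes sense for all real \<open>u\<close>, also outside the range of the parameter.
\<close>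

definition graph_time :: "real \<Rightarrow> (real \<Rightarrow> real) \<Rightarrow> real \<Rightarrow> real" where
  "graph_time T x u = Sup (insert 0 {t\<in>{0..T}. x t + t \<le> u})"

lemma D_up_pathsD:
  assumes "x \<in> D_up_paths T"
  shows "x \<in> D_paths T" and "mono_on {0..T} x"
    and "\<And>t. t \<in> {0..T} \<Longrightarrow> 0 \<le> x t"
    and "\<And>t. 0 \<le> t \<Longrightarrow> t < T \<Longrightarrow> (x \<longlongrightarrow> x t) (at_right t)"
    and "\<And>s t. 0 \<le> s \<Longrightarrow> s \<le> t \<Longrightarrow> t \<le> T \<Longrightarrow> x s \<le> x t"
  using assms unfolding D_up_paths_def D_paths_def
  by (auto simp: continuous_within mono_on_def)

lemma bdd_above_graph_time: "bdd_above (insert (0::real) {t\<in>{0..T}. x t + t \<le> u})"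
  by (rule bdd_aboveI[of _ "max 0 T"]) auto

lemma graph_time_ge0: "0 \<le> graph_time T x u"
  unfolding graph_time_def by (rule cSup_upper[OF _ bdd_above_graph_time]) simp

lemma graph_time_ge: "t \<in> {0..T} \<Longrightarrow> x t + t \<le> u \<Longrightarrow> t \<le> graph_time T x u"
  unfolding graph_time_def by (rule cSup_upper[OF _ bdd_above_graph_time]) simp

lemma graph_time_leI:
  assumes "0 \<le> b" "\<And>t. t \<in> {0..T} \<Longrightarrow> x t + t \<le> u \<Longrightarrow> t \<le> b"
  shows "graph_time T x u \<le> b"
  unfolding graph_time_def by (rule cSup_least) (use assms in auto)

lemma graph_time_le: "0 \<le> T \<Longrightarrow> graph_time T x u \<le> T"
  by (rule graph_time_leI) auto

lemma graph_time_mono: "u \<le> v \<Longrightarrow> graph_time T x u \<le> graph_time T x v"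
  by (rule graph_time_leI[OF graph_time_ge0]) (auto intro: graph_time_ge)

text \<open>
If \<open>t\<close> has parameter at most \<open>v\<close>, then by monotonicity \<open>t - (v - u)\<close> has parameter at most \<open>u\<close>.
\<close>

lemma graph_time_increment:
  assumes "mono_on {0..T} x" "u \<le> v"
  shows "graph_time T x v \<le> graph_time T x u + (v - u)"
proof (rule graph_time_leI)
  show "0 \<le> graph_time T x u + (v - u)" using graph_time_ge0[of T x u] assms(2) by linarith
next
  fix t assume t: "t \<in> {0..T}" "x t + t \<le> v"
  show "t \<le> graph_time T x u + (v - u)"
  proof (cases "t - (v - u) < 0")
    case True then show ?thesis using graph_time_ge0[of T x u] by linarith
  next
    case False
    then have "x (t - (v - u)) \<le> x t" using assms t by (auto simp: mono_on_def)
    with False t assms(2) have "t - (v - u) \<le> graph_time T x u" by (intro graph_time_ge) auto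
    then show ?thesis by linarith
  qed
qed

lemma graph_time_lipschitz:
  assumes "mono_on {0..T} x"
  shows "\<bar>graph_time T x v - graph_time T x u\<bar> \<le> \<bar>v - u\<bar>"
  using graph_time_increment[OF assms, of u v] graph_time_increment[OF assms, of v u]
    graph_time_mono[of u v T x] graph_time_mono[of v u T x]
  by (cases "u \<le> v") linarith+

text \<open>
The shift by \<open>e\<close> in time and the shift by \<open>e\<close> in value cancel in the sum of value and time.
\<close>

lemma graph_time_levy_le:
  assumes "levy_close T e x y"
  shows "graph_time T x u \<le> graph_time T y u + e"
proof (rule graph_time_leI)
  show "0 \<le> graph_time T y u + e" using graph_time_ge0[of T y u] assms by (simp add: levy_close_def)
next
  fix t assume t: "t \<in> {0..T}" "x t + t \<le> u"
  have e: "0 \<le> e" using assms by (simp add: levy_close_def)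
  show "t \<le> graph_time T y u + e"
  proof (cases "t < e")
    case True then show ?thesis using graph_time_ge0[of T y u] by linarith
  next
    case False
    then have "t - e \<in> {0..T}" using t e by auto
    moreover from this have "y (t - e) \<le> x (min T ((t - e) + e)) + e"
      using assms unfolding levy_close_def by blast
    moreover have "min T ((t - e) + e) = t" using t by simp
    ultimately have "t - e \<le> graph_time T y u" using t by (intro graph_time_ge) auto
    then show ?thesis by linarith
  qed
qed

lemma levy_close_sym: "levy_close T e x y \<Longrightarrow> levy_close T e y x"
  by (auto simp: levy_close_def abs_minus_commute)

lemma left_value_D_up:
  assumes x: "x \<in> D_up_paths T" and t: "t \<in> {0..T}"
  shows left_value_le: "left_value x t \<le> x t"
    and left_value_ge: "\<And>s. 0 \<le> s \<Longrightarrow> s < t \<Longrightarrow> x s \<le> left_value x t"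
    and left_value_leI: "\<And>b. 0 < t \<Longrightarrow> (\<And>s. 0 \<le> s \<Longrightarrow> s < t \<Longrightarrow> x s + s \<le> b) \<Longrightarrow> left_value x t + t \<le> b"
proof -
  have lim: "(x \<longlongrightarrow> left_value x t) (at_left t)" if "0 < t"
  proof -
    have "\<forall>t\<in>{0<..T}. \<exists>l. (x \<longlongrightarrow> l) (at_left t)"
      using D_up_pathsD(1)[OF x] by (simp add: D_paths_def)
    moreover have "t \<in> {0<..T}" using t that by simp
    ultimately obtain l where "(x \<longlongrightarrow> l) (at_left t)" by blast
    then have "Lim (at_left t) x = l" by (intro tendsto_Lim) auto
    with \<open>(x \<longlongrightarrow> l) (at_left t)\<close> that show ?thesis by (simp add: left_value_def)
  qed
  have ev: "eventually (\<lambda>s. s0 < s \<and> s < t) (at_left t)" if "s0 < t" for s0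
    using that eventually_at_left_real[of s0 t] by simp
  show "left_value x t \<le> x t"
  proof (cases "0 < t")
    case True
    show ?thesis
      by (rule tendsto_upperbound[OF lim[OF True]], rule eventually_mono[OF ev[OF True]])
        (use t D_up_pathsD(5)[OF x] in auto)
  qed (simp add: left_value_def)
  show "x s \<le> left_value x t" if "0 \<le> s" "s < t" for s
    by (rule tendsto_lowerbound[OF lim], use that in simp, rule eventually_mono[OF ev[OF that(2)]])
        (use t that D_up_pathsD(5)[OF x] in auto)
  show "left_value x t + t \<le> b" if "0 < t" "\<And>s. 0 \<le> s \<Longrightarrow> s < t \<Longrightarrow> x s + s \<le> b" for b
  proof (rule tendsto_upperbound)
    show "((\<lambda>s. x s + s) \<longlongrightarrow> left_value x t + t) (at_left t)"
      by (intro tendsto_add lim that tendsto_ident_at)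
    show "eventually (\<lambda>s. x s + s \<le> b) (at_left t)"
      by (rule eventually_mono[OF ev[OF that(1)]]) (use that in auto)
  qed simp
qed

lemma completed_graph_D_up:
  assumes x: "x \<in> D_up_paths T"
  shows "(z, t) \<in> completed_graph T x \<longleftrightarrow> t \<in> {0..T} \<and> left_value x t \<le> z \<and> z \<le> x t"
  using left_value_le[OF x, of t] unfolding completed_graph_def
  by (auto simp: closed_segment_eq_real_ivl)

lemma graph_time_on_graph:
  assumes T: "0 \<le> T" and x: "x \<in> D_up_paths T" and u: "x 0 \<le> u" "u \<le> x T + T"
  shows "(u - graph_time T x u, graph_time T x u) \<in> completed_graph T x"
proof -
  define t where "t = graph_time T x u"
  have t: "t \<in> {0..T}" using graph_time_ge0 graph_time_le[OF T] by (auto simp: t_def)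
  have below: "x s + s \<le> u" if "0 \<le> s" "s < t" for s
  proof (rule ccontr)
    assume *: "\<not> x s + s \<le> u"
    have "t \<le> s" unfolding t_def
    proof (rule graph_time_leI)
      fix r assume r: "r \<in> {0..T}" "x r + r \<le> u"
      then show "r \<le> s" using * that D_up_pathsD(5)[OF x, of s r] by force
    qed (use that in auto)
    then show False using that by simp
  qed
  have above: "x s + s > u" if "t < s" "s \<le> T" for s
    using graph_time_ge[of s T x u] that t by (force simp: t_def)
  have "left_value x t + t \<le> u"
  proof (cases "0 < t")
    case True then show ?thesis using left_value_leI[OF x t] below by blast
  next
    case False then have "t = 0" using t by auto then show ?thesis using u by (simp add: left_value_def)
  qed
  moreover have "u \<le> x t + t"
  proof (cases "t < T")
    case True
    have "((\<lambda>s. x s + s) \<longlongrightarrow> x t + t) (at_right t)"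
      by (intro tendsto_add tendsto_ident_at D_up_pathsD(4)[OF x]) (use t True in auto)
    then show ?thesis
    proof (rule tendsto_lowerbound)
      show "eventually (\<lambda>s. u \<le> x s + s) (at_right t)"
        using eventually_at_right_real[OF True] by (rule eventually_mono) (use above in force)
    qed simp
  next
    case False then have "t = T" using t by auto then show ?thesis using u by simp
  qed
  ultimately show ?thesis using t by (simp add: completed_graph_D_up[OF x] flip: t_def)
qed

lemma graph_time_of_graph_point:
  assumes x: "x \<in> D_up_paths T" and g: "(z, t) \<in> completed_graph T x"
  shows "graph_time T x (z + t) = t" "x 0 \<le> z + t" "z + t \<le> x T + T"
proof -
  have t: "0 \<le> t" "t \<le> T" and z: "left_value x t \<le> z" "z \<le> x t"
    using g by (auto simp: completed_graph_D_up[OF x])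
  have *: "x s + s \<le> z + t" if "0 \<le> s" "s < t" for s
    using left_value_ge[OF x, of t s] t z that by auto
  show "graph_time T x (z + t) = t"
  proof (rule antisym)
    show "graph_time T x (z + t) \<le> t"
    proof (rule graph_time_leI[OF t(1)], rule ccontr)
      fix s assume s: "s \<in> {0..T}" "x s + s \<le> z + t" "\<not> s \<le> t"
      then show False using D_up_pathsD(5)[OF x, of t s] t z by auto
    qed
    show "t \<le> graph_time T x (z + t)"
    proof (rule field_le_epsilon)
      fix e :: real assume "0 < e"
      show "t \<le> graph_time T x (z + t) + e"
      proof (cases "t - e < 0")
        case True then show ?thesis using graph_time_ge0[of T x "z + t"] by linarith
      next
        case False
        then have "t - e \<le> graph_time T x (z + t)"
          using t \<open>0 < e\<close> *[of "t - e"] by (intro graph_time_ge) auto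
        then show ?thesis by simp
      qed
    qed
  qed
  show "x 0 \<le> z + t"
  proof (cases "t = 0")
    case True then show ?thesis using z by (simp add: left_value_def)
  next
    case False then show ?thesis using *[of 0] t by simp
  qed
  show "z + t \<le> x T + T" using z t D_up_pathsD(5)[OF x, of t T] by simp
qed

text \<open>
The parameter by the sum of value and time, rescaled to \<open>[0, 1]\<close>.
\<close>

definition graph_param :: "real \<Rightarrow> (real \<Rightarrow> real) \<Rightarrow> real \<Rightarrow> real \<times> real" where
  "graph_param T x a = (let u = x 0 + a * (x T + T - x 0) in (u - graph_time T x u, graph_time T x u))"

lemma parametric_rep_graph_param:
  assumes T: "0 \<le> T" and x: "x \<in> D_up_paths T"
  shows "parametric_rep T x (graph_param T x)"
  unfolding parametric_rep_def
proof (intro conjI ballI impI)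
  let ?u = "\<lambda>a. x 0 + a * (x T + T - x 0)"
  have le: "x 0 \<le> x T + T" using D_up_pathsD(5)[OF x, of 0 T] T by simp
  have urange: "x 0 \<le> ?u a" "?u a \<le> x T + T" if "a \<in> {0..1}" for a
    using that le mult_right_mono[of a 1 "x T + T - x 0"] by auto
  have cont: "continuous_on UNIV (graph_time T x)"
    unfolding continuous_on_iff
    by (metis dist_commute dist_real_def graph_time_lipschitz[OF D_up_pathsD(2)[OF x]] order_le_less_trans)
  have cont': "continuous_on {0..1} (\<lambda>a. graph_time T x (?u a))"
    by (rule continuous_on_compose2[OF cont]) (auto intro!: continuous_intros)
  show "continuous_on {0..1} (graph_param T x)"
    unfolding graph_param_def Let_def by (intro continuous_intros cont')
  show "graph_param T x ` {0..1} = completed_graph T x"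
  proof (intro equalityI subsetI)
    fix p assume "p \<in> graph_param T x ` {0..1}"
    then show "p \<in> completed_graph T x"
      using graph_time_on_graph[OF T x] urange by (auto simp: graph_param_def Let_def)
  next
    fix p assume p: "p \<in> completed_graph T x"
    obtain z t where zt: "p = (z, t)" by (cases p)
    note gt = graph_time_of_graph_point[OF x p[unfolded zt]]
    have "z + t \<in> ?u ` {0..1}"
    proof (cases "x T + T - x 0 = 0")
      case True then show ?thesis using gt by (auto intro!: image_eqI[of _ _ 0])
    next
      case False
      then show ?thesis using gt le
        by (intro image_eqI[of _ _ "(z + t - x 0) / (x T + T - x 0)"]) (auto simp: field_simps)
    qed
    then obtain a where a: "a \<in> {0..1}" "?u a = z + t" by auto
    have "graph_param T x a = p"
      unfolding graph_param_def Let_def a(2) gt(1) zt by simp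
    then show "p \<in> graph_param T x ` {0..1}" using a(1) by blast
  qed
  fix a b :: real assume ab: "a \<in> {0..1}" "b \<in> {0..1}" "a \<le> b"
  have uab: "?u a \<le> ?u b" using ab le by (simp add: mult_right_mono)
  have "left_value x (graph_time T x (?u a)) \<le> ?u a - graph_time T x (?u a)"
    using graph_time_on_graph[OF T x urange[OF ab(1)]] by (simp add: completed_graph_D_up[OF x])
  then show "graph_le x (graph_param T x a) (graph_param T x b)"
    using graph_time_mono[OF uab, of T x] uab
    unfolding graph_le_def graph_param_def Let_def by auto
qed

lemma M1_dist_le:
  assumes "parametric_rep T x g" "parametric_rep T y h"
    and "\<And>s. s \<in> {0..1} \<Longrightarrow> \<bar>fst (g s) - fst (h s)\<bar> \<le> b"
    and "\<And>s. s \<in> {0..1} \<Longrightarrow> \<bar>snd (g s) - snd (h s)\<bar> \<le> b"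
  shows "M1_dist T x y \<le> b"
proof -
  let ?m = "\<lambda>g h. max (SUP s\<in>{0..1}. \<bar>fst (g s) - fst (h s)\<bar>) (SUP s\<in>{0..1::real}. \<bar>snd (g s) -
      snd (h s)\<bar>) :: real"
  have "0 \<le> ?m g h" if "parametric_rep T x g" "parametric_rep T y h" for g h
  proof -
    have "continuous_on {0..1} g" "continuous_on {0..1} h"
      using that by (auto simp: parametric_rep_def)
    then have "continuous_on {0..1} (\<lambda>s. \<bar>fst (g s) - fst (h s)\<bar>)"
      by (intro continuous_intros)
    then have "bdd_above ((\<lambda>s. \<bar>fst (g s) - fst (h s)\<bar>) ` {0..1})"
      by (intro bounded_imp_bdd_above compact_imp_bounded compact_continuous_image) auto
    then have "\<bar>fst (g 0) - fst (h 0)\<bar> \<le> (SUP s\<in>{0..1}. \<bar>fst (g s) - fst (h s)\<bar>)"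
      by (intro cSUP_upper) auto
    then show ?thesis by linarith
  qed
  then have "M1_dist T x y \<le> ?m g h"
    unfolding M1_dist_def using assms(1,2) by (intro cInf_lower bdd_belowI[of _ 0]) auto
  also have "\<dots> \<le> b"
    using assms(3,4) by (auto intro!: cSUP_least)
  finally show ?thesis .
qed

text \<open>
Compare the two parametrizations at the same \<open>a\<close>. The rescaled parameters differ by at most \<open>e\<close>, since the
end values do; moving the parameter by \<open>e\<close> moves the time by at most \<open>e\<close>, and exchanging the path for the same
parameter costs another \<open>e\<close>. The value is parameter minus time, which gives \<open>3 e\<close>.
\<close>

lemma M1_dist_le_levy_close:
  assumes T: "0 \<le> T" and x: "x \<in> D_up_paths T" and y: "y \<in> D_up_paths T"
    and close: "levy_close T e x y"
  shows "M1_dist T x y \<le> 3 * e"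
proof (rule M1_dist_le[OF parametric_rep_graph_param[OF T x] parametric_rep_graph_param[OF T y]])
  fix a :: real assume a: "a \<in> {0..1}"
  let ?u = "x 0 + a * (x T + T - x 0)" and ?v = "y 0 + a * (y T + T - y 0)"
  have e: "0 \<le> e" and e0: "\<bar>x 0 - y 0\<bar> \<le> e" and eT: "\<bar>x T - y T\<bar> \<le> e"
    using close T by (auto simp: levy_close_def abs_le_iff dest!: bspec[of _ _ T])
  have "?u - ?v = (1 - a) * (x 0 - y 0) + a * (x T - y T)" by (simp add: algebra_simps)
  also have "\<bar>\<dots>\<bar> \<le> (1 - a) * \<bar>x 0 - y 0\<bar> + a * \<bar>x T - y T\<bar>"
    using a abs_triangle_ineq[of "(1 - a) * (x 0 - y 0)" "a * (x T - y T)"] by (simp add: abs_mult)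
  also have "\<dots> \<le> (1 - a) * e + a * e" using a e0 eT by (intro add_mono mult_left_mono) auto
  finally have uv: "\<bar>?u - ?v\<bar> \<le> e" by (simp add: algebra_simps)
  have "\<bar>graph_time T x ?u - graph_time T x ?v\<bar> \<le> e"
    using graph_time_lipschitz[OF D_up_pathsD(2)[OF x], of ?u ?v] uv by linarith
  moreover have "\<bar>graph_time T x ?v - graph_time T y ?v\<bar> \<le> e"
    using graph_time_levy_le[OF close, of ?v] graph_time_levy_le[OF levy_close_sym[OF close], of ?v]
        by linarith
  ultimately have *: "\<bar>graph_time T x ?u - graph_time T y ?v\<bar> \<le> 2 * e" by linarith
  then show "\<bar>snd (graph_param T x a) - snd (graph_param T y a)\<bar> \<le> 3 * e"
    using e by (simp add: graph_param_def Let_def)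
  show "\<bar>fst (graph_param T x a) - fst (graph_param T y a)\<bar> \<le> 3 * e"
    using * uv unfolding graph_param_def Let_def fst_conv by linarith
qed

section \<open>The law of Brownian motion on path space\<close>

abbreviation path_of :: "(real \<Rightarrow> 'a \<Rightarrow> real) \<Rightarrow> 'a \<Rightarrow> real \<Rightarrow> real" where
  "path_of W \<omega> \<equiv> restrict (\<lambda>t. W t \<omega>) {0..}"

text \<open>
The sigma-algebra of the evaluations on continuous paths. Functionals of a Brownian path are studied on this
space, so that they have the same distribution for every Brownian motion.
\<close>

definition path_space :: "(real \<Rightarrow> real) measure" where
  "path_space = restrict_space (PiM {0..} (\<lambda>_. borel)) C_paths"

lemma space_path_space: "space path_space = C_paths"
  unfolding path_space_def space_restrict_space
  by (auto simp: C_paths_def space_PiM PiE_def)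

lemma measurable_path_eval [measurable (raw)]: "0 \<le> t \<Longrightarrow> (\<lambda>w. w t) \<in> borel_measurable path_space"
  unfolding path_space_def by (intro measurable_restrict_space1 measurable_component_singleton) simp

lemma brownian_motionD:
  assumes "brownian_motion M G W"
  shows "prob_space M"
    and "\<And>t. subalgebra M (G t)"
    and "\<And>s t. s \<le> t \<Longrightarrow> sets (G s) \<subseteq> sets (G t)"
    and "\<And>t. 0 \<le> t \<Longrightarrow> W t \<in> borel_measurable (G t)"
    and "\<And>t. 0 \<le> t \<Longrightarrow> W t \<in> borel_measurable M"
    and "AE \<omega> in M. W 0 \<omega> = 0"
    and "\<And>\<omega>. \<omega> \<in> space M \<Longrightarrow> continuous_on {0..} (\<lambda>t. W t \<omega>)"
    and "\<And>s t. 0 \<le> s \<Longrightarrow> s < t \<Longrightarrow>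
        distributed M lborel (\<lambda>\<omega>. W t \<omega> - W s \<omega>) (normal_density 0 (sqrt (t - s)))"
    and "\<And>s t. 0 \<le> s \<Longrightarrow> s < t \<Longrightarrow> prob_space.indep_set M (sets (G s))
          (sets (vimage_algebra (space M) (\<lambda>\<omega>. W t \<omega> - W s \<omega>) borel))"
    and "\<And>t. space (G t) = space M"
proof -
  note d = assms[unfolded brownian_motion_def filtered_prob_space_def filtered_prob_space_axioms_def]
  show "prob_space M" and sub: "\<And>t. subalgebra M (G t)" using d by auto
  show "\<And>s t. s \<le> t \<Longrightarrow> sets (G s) \<subseteq> sets (G t)" using d filtration.sets_F_mono by blast
  show *: "\<And>t. 0 \<le> t \<Longrightarrow> W t \<in> borel_measurable (G t)" using d by auto
  show "\<And>t. 0 \<le> t \<Longrightarrow> W t \<in> borel_measurable M"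
    using measurable_from_subalg[OF sub *] .
  show "\<And>t. space (G t) = space M" using sub by (simp add: subalgebra_def)
qed (use assms in \<open>auto simp: brownian_motion_def\<close>)

lemma measurable_filtration_mono:
  assumes "brownian_motion M G W" "s \<le> t" "U \<in> measurable (G s) N"
  shows "U \<in> measurable (G t) N"
  using assms(3) brownian_motionD(3)[OF assms(1,2)] brownian_motionD(10)[OF assms(1)]
  by (auto simp: measurable_def)

lemma path_of_measurable:
  assumes "brownian_motion M G W"
  shows "path_of W \<in> measurable M path_space"
  unfolding path_space_def
proof (rule measurable_restrict_space2)
  have "continuous_on {0..} (path_of W \<omega>) \<longleftrightarrow> continuous_on {0..} (\<lambda>t. W t \<omega>)" for \<omega>
    by (rule continuous_on_cong) auto
  then show "path_of W \<in> space M \<rightarrow> C_paths"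
    using brownian_motionD(7)[OF assms] by (auto simp: C_paths_def)
  show "path_of W \<in> M \<rightarrow>\<^sub>M Pi\<^sub>M {0..} (\<lambda>_. borel)"
    using brownian_motionD(5)[OF assms] by (intro measurable_restrict) auto
qed

lemma brownian_increment_indep:
  assumes bm: "brownian_motion M G W" and st: "0 \<le> s" "s < t" and U: "U \<in> measurable (G s) N"
  shows "prob_space.indep_var M N U borel (\<lambda>\<omega>. W t \<omega> - W s \<omega>)"
proof -
  interpret prob_space M by (rule brownian_motionD(1)[OF bm])
  note [measurable] = brownian_motionD(5)[OF bm]
  have sub: "subalgebra M (G s)" by (rule brownian_motionD(2)[OF bm])
  have [measurable]: "U \<in> measurable M N" by (rule measurable_from_subalg[OF sub U])
  have A: "sigma_sets (space M) {U -` A \<inter> space M |A. A \<in> sets N} \<subseteq> sets (G s)"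
    using measurable_sets[OF U] brownian_motionD(10)[OF bm, of s]
    by (auto intro!: sets.sigma_sets_subset[of _ "G s", unfolded brownian_motionD(10)[OF bm]])
  have B: "sigma_sets (space M) {(\<lambda>\<omega>. W t \<omega> - W s \<omega>) -` A \<inter> space M |A. A \<in> sets borel}
     = sets (vimage_algebra (space M) (\<lambda>\<omega>. W t \<omega> - W s \<omega>) borel)"
    by (simp add: sets_vimage_algebra)
  have "indep_set (sigma_sets (space M) {U -` A \<inter> space M |A. A \<in> sets N})
     (sigma_sets (space M) {(\<lambda>\<omega>. W t \<omega> - W s \<omega>) -` A \<inter> space M |A. A \<in> sets borel})"
    unfolding B indep_set_def
    by (rule indep_sets_mono_sets[OF brownian_motionD(9)[OF bm st, unfolded indep_set_def]])
      (use A in \<open>auto split: bool.split\<close>)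
  then show ?thesis unfolding indep_var_eq using st by simp
qed

text \<open>
The increment is independent of the past, so the law of the pair is a product and Fubini's theorem integrates
the increment first.
\<close>

lemma brownian_markov:
  assumes bm: "brownian_motion M G W" and st: "0 \<le> s" "s < t"
    and U: "U \<in> borel_measurable (G s)" and g: "g \<in> borel_measurable borel"
  shows "(\<integral>\<^sup>+ \<omega>. U \<omega> * g (W t \<omega>) \<partial>M) =
    (\<integral>\<^sup>+ \<omega>. U \<omega> * (\<integral>\<^sup>+ y. g (W s \<omega> + y) \<partial>density lborel (normal_density 0 (sqrt (t - s)))) \<partial>M)"
proof -
  interpret prob_space M by (rule brownian_motionD(1)[OF bm])
  let ?D = "\<lambda>\<omega>. W t \<omega> - W s \<omega>"
  let ?N = "density lborel (normal_density 0 (sqrt (t - s)))"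
  have sub: "subalgebra M (G s)" by (rule brownian_motionD(2)[OF bm])
  have id: "(\<lambda>\<omega>. \<omega>) \<in> measurable M (G s)"
    by (rule measurable_from_subalg[OF sub]) simp
  have W[measurable]: "W s \<in> borel_measurable (G s)" "W t \<in> borel_measurable M" "W s \<in> borel_measurable M"
    using brownian_motionD(4,5)[OF bm] st by auto
  note U[measurable] g[measurable]
  have N: "distr M borel ?D = ?N"
    using brownian_motionD(8)[OF bm st] unfolding distributed_def
    by (metis distr_cong sets_lborel)
  interpret N: prob_space ?N unfolding N[symmetric] by (rule prob_space_distr) simp
  have setsN[measurable_cong]: "sets ?N = sets borel" by simp
  have D[measurable]: "?D \<in> borel_measurable M" by measurable
  have pm: "(\<lambda>\<omega>. (\<omega>, ?D \<omega>)) \<in> M \<rightarrow>\<^sub>M G s \<Otimes>\<^sub>M borel" by (intro measurable_Pair id D)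
  interpret id: prob_space "distr M (G s) (\<lambda>\<omega>. \<omega>)" by (rule prob_space_distr[OF id])
  have joint: "distr M (G s) (\<lambda>\<omega>. \<omega>) \<Otimes>\<^sub>M ?N = distr M (G s \<Otimes>\<^sub>M borel) (\<lambda>\<omega>. (\<omega>, ?D \<omega>))"
  proof (rule pair_measure_eqI)
    fix A B assume A: "A \<in> sets (distr M (G s) (\<lambda>\<omega>. \<omega>))" and B: "B \<in> sets ?N"
    have A': "A \<in> sets (G s)" and B': "B \<in> sets borel" using A B by auto
    have sp: "A \<subseteq> space M" using sets.sets_into_space[OF A'] brownian_motionD(10)[OF bm] by simp
    have DB: "?D -` B \<inter> space M \<in> sets (vimage_algebra (space M) ?D borel)"
      using B' by (auto simp: sets_vimage_algebra)
    have e1: "emeasure (distr M (G s) (\<lambda>\<omega>. \<omega>)) A = prob A"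
      using A' sp by (simp add: emeasure_distr[OF id] emeasure_eq_measure Int_absorb2 vimage_ident)
    have e2: "emeasure ?N B = prob (?D -` B \<inter> space M)"
      unfolding N[symmetric] using B' by (simp add: emeasure_distr emeasure_eq_measure)
    have "(\<lambda>\<omega>. (\<omega>, ?D \<omega>)) -` (A \<times> B) \<inter> space M = A \<inter> (?D -` B \<inter> space M)"
      using sp by auto
    then have e3: "emeasure (distr M (G s \<Otimes>\<^sub>M borel) (\<lambda>\<omega>. (\<omega>, ?D \<omega>))) (A \<times> B) =
        prob (A \<inter> (?D -` B \<inter> space M))"
      using A' B' by (simp add: emeasure_distr[OF pm] emeasure_eq_measure)
    show "emeasure (distr M (G s) (\<lambda>\<omega>. \<omega>)) A * emeasure ?N B =
        emeasure (distr M (G s \<Otimes>\<^sub>M borel) (\<lambda>\<omega>. (\<omega>, ?D \<omega>))) (A \<times> B)"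
      unfolding e1 e2 e3 indep_setD[OF brownian_motionD(9)[OF bm st] A' DB]
      by (simp add: ennreal_mult)
  qed (auto intro: id.sigma_finite_measure_axioms N.sigma_finite_measure_axioms)
  have "(\<integral>\<^sup>+ \<omega>. U \<omega> * g (W t \<omega>) \<partial>M) =
      (\<integral>\<^sup>+ p. U (fst p) * g (W s (fst p) + snd p) \<partial>distr M (G s \<Otimes>\<^sub>M borel) (\<lambda>\<omega>. (\<omega>, ?D \<omega>)))"
    by (subst nn_integral_distr[OF pm]) auto
  also have "\<dots> = (\<integral>\<^sup>+ p. U (fst p) * g (W s (fst p) + snd p) \<partial>(distr M (G s) (\<lambda>\<omega>. \<omega>) \<Otimes>\<^sub>M ?N))"
    unfolding joint ..
  also have "\<dots> = (\<integral>\<^sup>+ \<omega>. \<integral>\<^sup>+ y. U \<omega> * g (W s \<omega> + y) \<partial>?N \<partial>distr M (G s) (\<lambda>\<omega>. \<omega>))"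
    by (subst N.nn_integral_fst[symmetric]) auto
  also have "\<dots> = (\<integral>\<^sup>+ \<omega>. \<integral>\<^sup>+ y. U \<omega> * g (W s \<omega> + y) \<partial>?N \<partial>M)"
    by (subst nn_integral_distr[OF id]) auto
  also have "\<dots> = (\<integral>\<^sup>+ \<omega>. U \<omega> * (\<integral>\<^sup>+ y. g (W s \<omega> + y) \<partial>?N) \<partial>M)"
    by (subst nn_integral_cmult) auto
  finally show ?thesis .
qed

text \<open>
Induction on the largest time: the Markov property absorbs the last factor into the function \<open>g\<close> of the
remaining largest time. For this reason the statement carries a function \<open>g\<close> at a time \<open>s\<close> beyond \<open>A\<close>.
\<close>

lemma brownian_fdd_unique:
  fixes A :: "real set"
  assumes bm: "brownian_motion M1 G1 W1" "brownian_motion M2 G2 W2"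
    and "finite A" "A \<subseteq> {0..s}" "\<And>t. t \<in> A \<Longrightarrow> B t \<in> sets borel"
    and "g \<in> borel_measurable borel" "0 \<le> s"
  shows "(\<integral>\<^sup>+ \<omega>. (\<Prod>t\<in>A. indicator (B t) (W1 t \<omega>)) * g (W1 s \<omega>) \<partial>M1) =
    (\<integral>\<^sup>+ \<omega>. (\<Prod>t\<in>A. indicator (B t) (W2 t \<omega>)) * (g (W2 s \<omega>) :: ennreal) \<partial>M2)"
  using assms(3-)
proof (induction A arbitrary: s g rule: finite_linorder_max_induct)
  case (empty s g)
  interpret M1: prob_space M1 by (rule brownian_motionD(1)[OF bm(1)])
  interpret M2: prob_space M2 by (rule brownian_motionD(1)[OF bm(2)])
  have zero: "(\<integral>\<^sup>+ \<omega>. q (W1 0 \<omega>) \<partial>M1) = q 0" "(\<integral>\<^sup>+ \<omega>. q (W2 0 \<omega>) \<partial>M2) = q 0" for q :: "real \<Rightarrow> ennreal"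
  proof -
    have "(\<integral>\<^sup>+ \<omega>. q (W1 0 \<omega>) \<partial>M1) = (\<integral>\<^sup>+ \<omega>. q 0 \<partial>M1)"
      by (rule nn_integral_cong_AE) (use brownian_motionD(6)[OF bm(1)] in auto)
    then show "(\<integral>\<^sup>+ \<omega>. q (W1 0 \<omega>) \<partial>M1) = q 0" by (simp add: M1.emeasure_space_1)
    have "(\<integral>\<^sup>+ \<omega>. q (W2 0 \<omega>) \<partial>M2) = (\<integral>\<^sup>+ \<omega>. q 0 \<partial>M2)"
      by (rule nn_integral_cong_AE) (use brownian_motionD(6)[OF bm(2)] in auto)
    then show "(\<integral>\<^sup>+ \<omega>. q (W2 0 \<omega>) \<partial>M2) = q 0" by (simp add: M2.emeasure_space_1)
  qed
  show ?case
  proof (cases "s = 0")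
    case True then show ?thesis by (simp add: zero)
  next
    case False
    then show ?thesis
      using brownian_markov[OF bm(1), of 0 s "\<lambda>_. 1" g] brownian_markov[OF bm(2), of 0 s "\<lambda>_. 1" g] empty
        zero[of "\<lambda>x. \<integral>\<^sup>+ y. g (x + y) \<partial>density lborel (\<lambda>x. ennreal (normal_density 0 (sqrt s) x))"]
      by simp
  qed
next
  case (insert b A s g)
  have b: "0 \<le> b" "b \<le> s" "b \<notin> A" using insert by auto
  have B: "B b \<in> sets borel" and A: "A \<subseteq> {0..b}" using insert by (auto simp: less_imp_le)
  note [measurable] = B
  have at_b: "(\<integral>\<^sup>+ \<omega>. (\<Prod>t\<in>insert b A. indicator (B t) (W1 t \<omega>)) * q (W1 b \<omega>) \<partial>M1) =
    (\<integral>\<^sup>+ \<omega>. (\<Prod>t\<in>insert b A. indicator (B t) (W2 t \<omega>)) * q (W2 b \<omega>) \<partial>M2)"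
    if [measurable]: "q \<in> borel_measurable borel" for q :: "real \<Rightarrow> ennreal"
    using insert.IH[of b "\<lambda>x. indicator (B b) x * q x"] A insert b by (simp add: mult_ac)
  show ?case
  proof (cases "b = s")
    case True then show ?thesis using at_b insert by simp
  next
    case False
    then have bs: "b < s" using b by simp
    let ?P = "\<lambda>x. \<integral>\<^sup>+ y. g (x + y) \<partial>density lborel (normal_density 0 (sqrt (s - b)))"
    interpret N: prob_space "density lborel (normal_density 0 (sqrt (s - b)))"
      using bs by (intro prob_space_normal_density) simp
    have [measurable]: "g \<in> borel_measurable borel" using insert by simp
    have setsN[measurable_cong]: "sets (density lborel (normal_density 0 (sqrt (s - b)))) = sets borel"
        by simp
    have P[measurable]: "?P \<in> borel_measurable borel" by measurable
    have U: "(\<lambda>\<omega>. \<Prod>t\<in>insert b A. indicator (B t) (W t \<omega>) :: ennreal) \<in> borel_measurable (G b)"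
      if "brownian_motion M G W" for M :: "'d measure" and G W
    proof (rule borel_measurable_prod_ennreal)
      fix t assume t: "t \<in> insert b A"
      then have [measurable]: "W t \<in> borel_measurable (G b)"
        using A b by (intro measurable_filtration_mono[OF that, of t b] brownian_motionD(4)[OF that]) auto
      have [measurable]: "B t \<in> sets borel" using insert t by auto
      show "(\<lambda>\<omega>. indicator (B t) (W t \<omega>) :: ennreal) \<in> borel_measurable (G b)" by measurable
    qed
    show ?thesis
      unfolding brownian_markov[OF bm(1) b(1) bs U[OF bm(1)] \<open>g \<in> borel_measurable borel\<close>]
        brownian_markov[OF bm(2) b(1) bs U[OF bm(2)] \<open>g \<in> borel_measurable borel\<close>]
      by (rule at_b[OF P])
  qed
qed

text \<open>
A measure on a product space is determined by its finite-dimensional distributions.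
\<close>

lemma brownian_law_unique:
  assumes bm: "brownian_motion M1 G1 W1" "brownian_motion M2 G2 W2"
  shows "distr M1 path_space (path_of W1) = distr M2 path_space (path_of W2)"
proof -
  let ?P = "PiM {0..} (\<lambda>_. borel) :: (real \<Rightarrow> real) measure"
  have m: "path_of W \<in> M \<rightarrow>\<^sub>M ?P" if "brownian_motion M G W" for M :: "'d measure" and G W
    using brownian_motionD(5)[OF that] by (intro measurable_restrict) auto
  interpret M1: prob_space M1 by (rule brownian_motionD(1)[OF bm(1)])
  have eq: "distr M1 ?P (path_of W1) = distr M2 ?P (path_of W2)"
  proof (rule measure_eqI_PiM_infinite)
    fix A J assume J: "finite J" "J \<subseteq> {0::real..}" "\<And>i. i \<in> J \<Longrightarrow> A i \<in> sets (borel :: real measure)"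
    define s where "s = (if J = {} then 0 else Max J)"
    have s: "J \<subseteq> {0..s}" "0 \<le> s" using J by (auto simp: s_def intro: order_trans[OF _ Max_ge])
    have *: "emeasure (distr M ?P (path_of W)) (prod_emb {0..} (\<lambda>_. borel) J (Pi\<^sub>E J A)) =
       (\<integral>\<^sup>+ \<omega>. (\<Prod>t\<in>J. indicator (A t) (W t \<omega>)) * 1 \<partial>M)"
      if "brownian_motion M G W" for M :: "'d measure" and G W
    proof -
      note [measurable] = brownian_motionD(5)[OF that]
      have S: "prod_emb {0..} (\<lambda>_. borel) J (Pi\<^sub>E J A) \<in> sets ?P"
        using J by (intro sets_PiM_I) auto
      let ?S = "path_of W -` prod_emb {0..} (\<lambda>_. borel) J (Pi\<^sub>E J A) \<inter> space M"
      have S': "?S \<in> sets M" using measurable_sets[OF m[OF that] S] .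
      have "emeasure (distr M ?P (path_of W)) (prod_emb {0..} (\<lambda>_. borel) J (Pi\<^sub>E J A)) = emeasure M ?S"
        by (rule emeasure_distr[OF m[OF that] S])
      also have "\<dots> = (\<integral>\<^sup>+ \<omega>. indicator ?S \<omega> \<partial>M)" using S' by simp
      also have "\<dots> = (\<integral>\<^sup>+ \<omega>. (\<Prod>t\<in>J. indicator (A t) (W t \<omega>)) * 1 \<partial>M)"
      proof (rule nn_integral_cong)
        fix \<omega> assume "\<omega> \<in> space M"
        then have "\<omega> \<in> ?S \<longleftrightarrow> (\<forall>t\<in>J. W t \<omega> \<in> A t)"
          using J(2) by (auto simp: prod_emb_def PiE_iff space_PiM)
        then show "indicator ?S \<omega> = (\<Prod>t\<in>J. indicator (A t) (W t \<omega>)) * (1::ennreal)"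
          using J(1) by (auto simp: indicator_def prod_zero_iff)
      qed
      finally show ?thesis .
    qed
    show "emeasure (distr M1 ?P (path_of W1)) (prod_emb {0..} (\<lambda>_. borel) J (Pi\<^sub>E J A)) =
      emeasure (distr M2 ?P (path_of W2)) (prod_emb {0..} (\<lambda>_. borel) J (Pi\<^sub>E J A))"
      unfolding *[OF bm(1)] *[OF bm(2)]
      using brownian_fdd_unique[OF bm J(1) s(1), of A "\<lambda>_. 1"] J(3) s(2) by simp
  next
    interpret D: prob_space "distr M1 ?P (path_of W1)" by (rule M1.prob_space_distr[OF m[OF bm(1)]])
    show "finite_measure (distr M1 ?P (path_of W1))" by unfold_locales
  qed auto
  show ?thesis
  proof (rule measure_eqI)
    fix S assume "S \<in> sets (distr M1 path_space (path_of W1))"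
    then have S: "S \<in> sets path_space" by simp
    then obtain A where A: "A \<in> sets ?P" "S = C_paths \<inter> A"
      by (auto simp: path_space_def sets_restrict_space)
    have *: "emeasure (distr M path_space (path_of W)) S = emeasure (distr M ?P (path_of W)) A"
      if "brownian_motion M G W" for M :: "'d measure" and G W
    proof -
      have "path_of W -` S \<inter> space M = path_of W -` A \<inter> space M"
        using measurable_space[OF path_of_measurable[OF that]] A(2) by (auto simp: space_path_space)
      then show ?thesis
        by (simp add: emeasure_distr[OF path_of_measurable[OF that] S] emeasure_distr[OF m[OF that] A(1)])
    qed
    show "emeasure (distr M1 path_space (path_of W1)) S = emeasure (distr M2 path_space (path_of W2)) S"
      unfolding *[OF bm(1)] *[OF bm(2)] eq ..
  qed simp
qed

section \<open>First passage of a continuous path\<close>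

text \<open>
The value \<open>0\<close> for a path that never passes the level makes the functional measurable and real-valued
everywhere; this case has probability zero below.
\<close>

definition first_passage :: "(real \<Rightarrow> real) \<Rightarrow> real \<Rightarrow> real" where
  "first_passage h g = (if \<exists>s\<ge>0. g < h s then Inf {s. 0 \<le> s \<and> g < h s} else 0)"

text \<open>
The minimum of the first passage and \<open>R\<close>, which needs no convention for paths that never pass.
\<close>

definition capped_passage :: "real \<Rightarrow> (real \<Rightarrow> real) \<Rightarrow> real \<Rightarrow> real" where
  "capped_passage R h g = Inf (insert R {s. 0 \<le> s \<and> g < h s})"

definition barrier :: "real \<Rightarrow> real \<Rightarrow> (real \<Rightarrow> real) \<Rightarrow> (real \<Rightarrow> real) \<Rightarrow> real \<Rightarrow> real" where
  "barrier c nu f w s = c * s - nu * w (f s)"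

lemma bdd_below_passage: "bdd_below (insert (R::real) {s. 0 \<le> s \<and> g < h s})"
  by (rule bdd_belowI[of _ "min 0 R"]) auto

lemma bdd_below_passage': "bdd_below {s::real. 0 \<le> s \<and> g < h s}"
  by (rule bdd_belowI[of _ 0]) auto

lemma capped_passage_le: "capped_passage R h g \<le> R"
  unfolding capped_passage_def by (rule cInf_lower[OF _ bdd_below_passage]) simp

lemma capped_passage_le': "0 \<le> s \<Longrightarrow> g < h s \<Longrightarrow> capped_passage R h g \<le> s"
  unfolding capped_passage_def by (rule cInf_lower[OF _ bdd_below_passage]) simp

lemma capped_passage_ge0: "0 \<le> R \<Longrightarrow> 0 \<le> capped_passage R h g"
  unfolding capped_passage_def by (rule cInf_greatest) auto

lemma capped_passage_less_iff:
  "capped_passage R h g < a \<longleftrightarrow> R < a \<or> (\<exists>s\<ge>0. s < a \<and> g < h s)"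
  unfolding capped_passage_def by (subst cInf_less_iff[OF _ bdd_below_passage]) auto

lemma first_passage_ge0: "0 \<le> first_passage h g"
  unfolding first_passage_def by (auto intro!: cInf_greatest)

lemma first_passage_le: "0 \<le> s \<Longrightarrow> g < h s \<Longrightarrow> first_passage h g \<le> s"
  unfolding first_passage_def by (auto intro!: cInf_lower bdd_below_passage')

lemma first_passage_less_iff:
  "(\<exists>s\<ge>0. g < h s) \<Longrightarrow> first_passage h g < a \<longleftrightarrow> (\<exists>s\<ge>0. s < a \<and> g < h s)"
  unfolding first_passage_def by (subst if_P, assumption, subst cInf_less_iff[OF _ bdd_below_passage']) auto

lemma capped_eq_min_first:
  assumes "\<exists>s\<ge>0. g < h s"
  shows "capped_passage R h g = min R (first_passage h g)"
  unfolding capped_passage_def first_passage_def if_P[OF assms]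
  using assms by (subst cInf_insert_If[OF bdd_below_passage']) (auto simp: inf_min)

lemma capped_eq_cap: "\<not> (\<exists>s\<ge>0. g < h s) \<Longrightarrow> capped_passage R h g = R"
proof -
  assume "\<not> (\<exists>s\<ge>0. g < h s)"
  then have e: "{s. 0 \<le> s \<and> g < h s} = {}" by auto
  show ?thesis unfolding capped_passage_def e by simp
qed

lemma barrier_at_capped_passage:
  assumes cont: "continuous_on {0..} h" and h0: "h 0 \<le> g" and R: "0 \<le> R"
  shows "h (capped_passage R h g) \<le> g"
proof (cases "capped_passage R h g = 0")
  case False
  let ?s = "capped_passage R h g"
  have s: "0 < ?s" using False capped_passage_ge0[OF R, of h g] by simp
  have "(h \<longlongrightarrow> h ?s) (at ?s within {0..})" using cont s by (simp add: continuous_on_def)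
  then have "(h \<longlongrightarrow> h ?s) (at ?s within {0..?s})" by (rule tendsto_within_subset) auto
  then have "(h \<longlongrightarrow> h ?s) (at_left ?s)" by (simp add: at_within_Icc_at_left[OF s])
  then show ?thesis
  proof (rule tendsto_upperbound)
    show "eventually (\<lambda>s. h s \<le> g) (at_left ?s)"
      using eventually_at_left_real[OF s]
    proof eventually_elim
      case (elim s) then show ?case using capped_passage_le'[of s g h R] by force
    qed
  qed simp
qed (use h0 in simp)

text \<open>
A continuous path stays above the level on a small interval after each passage. Hence rational times see all
passages, which gives measurability, and so do the points of a sufficiently fine grid.
\<close>

lemma passage_persists:
  fixes h :: "real \<Rightarrow> real"
  assumes cont: "continuous_on {0..} h" and s: "0 \<le> s" "s < a" "g < h s"
  shows "\<exists>d>0. s + d \<le> a \<and> (\<forall>r. s \<le> r \<longrightarrow> r < s + d \<longrightarrow> g < h r)"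
proof -
  have "(h \<longlongrightarrow> h s) (at s within {0..})" using cont s by (simp add: continuous_on_def)
  then have "eventually (\<lambda>r. g < h r) (at s within {0..})" using s(3) by (rule order_tendstoD(1))
  then obtain d where d: "d > 0" "\<And>r. 0 \<le> r \<Longrightarrow> r \<noteq> s \<Longrightarrow> dist r s < d \<Longrightarrow> g < h r"
    unfolding eventually_at by auto
  show ?thesis
  proof (rule exI[of _ "min d (a - s)"], intro conjI allI impI)
    fix r assume "s \<le> r" "r < s + min d (a - s)"
    then show "g < h r" using d(2)[of r] s by (cases "r = s") (auto simp: dist_real_def)
  qed (use d s in auto)
qed

lemma passage_before_iff_rat:
  fixes h :: "real \<Rightarrow> real"
  assumes cont: "continuous_on {0..} h"
  shows "(\<exists>s\<ge>0. s < a \<and> g < h s) \<longleftrightarrow> (\<exists>q. 0 \<le> real_of_rat q \<and> real_of_rat q < a \<and> g < h (real_of_rat q))"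
proof
  assume "\<exists>s\<ge>0. s < a \<and> g < h s"
  then obtain s where s: "0 \<le> s" "s < a" "g < h s" by auto
  obtain d where d: "d > 0" "s + d \<le> a" "\<And>r. s \<le> r \<Longrightarrow> r < s + d \<Longrightarrow> g < h r"
    using passage_persists[OF cont s] by auto
  obtain q where "s < real_of_rat q" "real_of_rat q < s + d"
    using of_rat_dense[of s "s + d"] d by auto
  then show "\<exists>q. 0 \<le> real_of_rat q \<and> real_of_rat q < a \<and> g < h (real_of_rat q)"
    using d(2) d(3)[of "real_of_rat q"] s(1) by (intro exI[of _ q] conjI) linarith+
qed blast

lemma passage_iff_rat:
  fixes h :: "real \<Rightarrow> real"
  assumes cont: "continuous_on {0..} h"
  shows "(\<exists>s\<ge>0. g < h s) \<longleftrightarrow> (\<exists>q. 0 \<le> real_of_rat q \<and> g < h (real_of_rat q))"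
proof
  assume "\<exists>s\<ge>0. g < h s"
  then obtain s where "0 \<le> s" "g < h s" by auto
  then have "\<exists>s'\<ge>0. s' < s + 1 \<and> g < h s'" by (intro exI[of _ s]) auto
  then show "\<exists>q. 0 \<le> real_of_rat q \<and> g < h (real_of_rat q)"
    unfolding passage_before_iff_rat[OF cont] by blast
qed blast

lemma capped_passage_measurable:
  fixes h :: "'a \<Rightarrow> real \<Rightarrow> real"
  assumes cont: "\<And>\<omega>. \<omega> \<in> space M \<Longrightarrow> continuous_on {0..} (h \<omega>)"
    and [measurable]: "\<And>s. 0 \<le> s \<Longrightarrow> (\<lambda>\<omega>. h \<omega> s) \<in> borel_measurable M"
  shows "(\<lambda>\<omega>. capped_passage R (h \<omega>) g) \<in> borel_measurable M"
  unfolding borel_measurable_iff_less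
proof
  fix a
  have "{\<omega>\<in>space M. capped_passage R (h \<omega>) g < a} =
    {\<omega>\<in>space M. R < a \<or> (\<exists>q. 0 \<le> real_of_rat q \<and> real_of_rat q < a \<and> g < h \<omega> (real_of_rat q))}"
    unfolding capped_passage_less_iff using passage_before_iff_rat[OF cont] by blast
  also have "\<dots> = {\<omega>\<in>space M. R < a \<or> (\<exists>q\<in>{q. 0 \<le> real_of_rat q \<and> real_of_rat q < a}. g <
      h \<omega> (real_of_rat q))}"
    by auto
  also have "\<dots> \<in> sets M" by measurable
  finally show "{\<omega>\<in>space M. capped_passage R (h \<omega>) g < a} \<in> sets M" .
qed

lemma passage_exists_measurable:
  fixes h :: "'a \<Rightarrow> real \<Rightarrow> real"
  assumes cont: "\<And>\<omega>. \<omega> \<in> space M \<Longrightarrow> continuous_on {0..} (h \<omega>)"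
    and [measurable]: "\<And>s. 0 \<le> s \<Longrightarrow> (\<lambda>\<omega>. h \<omega> s) \<in> borel_measurable M"
  shows "{\<omega>\<in>space M. \<exists>s\<ge>0. g < h \<omega> s} \<in> sets M"
proof -
  have "{\<omega>\<in>space M. \<exists>s\<ge>0. g < h \<omega> s} = {\<omega>\<in>space M. \<exists>q\<in>{q. 0 \<le> real_of_rat q}. g < h \<omega> (real_of_rat q)}"
    using passage_iff_rat[OF cont] by auto
  also have "\<dots> \<in> sets M" by measurable
  finally show ?thesis .
qed

lemma capped_passage_tendsto:
  assumes "\<exists>s\<ge>0. g < h s"
  shows "eventually (\<lambda>n. capped_passage (real n) h g = first_passage h g) sequentially"
  unfolding capped_eq_min_first[OF assms] eventually_sequentially
  by (rule exI[of _ "nat \<lceil>first_passage h g\<rceil>"]) (auto intro!: min.absorb2 simp: nat_le_iff ceiling_le_iff)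

lemma first_passage_measurable:
  fixes h :: "'a \<Rightarrow> real \<Rightarrow> real"
  assumes cont: "\<And>\<omega>. \<omega> \<in> space M \<Longrightarrow> continuous_on {0..} (h \<omega>)"
    and h: "\<And>s. 0 \<le> s \<Longrightarrow> (\<lambda>\<omega>. h \<omega> s) \<in> borel_measurable M"
  shows "(\<lambda>\<omega>. first_passage (h \<omega>) g) \<in> borel_measurable M"
proof -
  have E: "{\<omega>\<in>space M. \<exists>s\<ge>0. g < h \<omega> s} \<in> sets M" by (rule passage_exists_measurable[OF cont h])
  show ?thesis
  proof (rule borel_measurable_LIMSEQ_metric)
    show "(\<lambda>\<omega>. if \<exists>s\<ge>0. g < h \<omega> s then capped_passage (real n) (h \<omega>) g else 0) \<in> borel_measurable M" for n
      by (rule measurable_If[OF capped_passage_measurable[OF cont h] _ E]) auto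
    show "(\<lambda>n. if \<exists>s\<ge>0. g < h \<omega> s then capped_passage (real n) (h \<omega>) g else 0) \<longlonglongrightarrow> first_passage (h \<omega>) g"
      if "\<omega> \<in> space M" for \<omega>
    proof (cases "\<exists>s\<ge>0. g < h \<omega> s")
      case True
      then show ?thesis using tendsto_eventually[OF capped_passage_tendsto[OF True]]
          by (simp only: if_True simp_thms)
    next
      case False
      then show ?thesis unfolding first_passage_def by (simp only: if_False) simp
    qed
  qed
qed

lemma brownian_increment_moments:
  assumes bm: "brownian_motion M G W" and st: "0 \<le> s" "s \<le> t"
    and U: "U \<in> borel_measurable (G s)" "integrable M U"
  shows "integrable M (\<lambda>\<omega>. U \<omega> * (W t \<omega> - W s \<omega>))" "(\<integral>\<omega>. U \<omega> * (W t \<omega> - W s \<omega>) \<partial>M) = 0"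
    "integrable M (\<lambda>\<omega>. U \<omega> * (W t \<omega> - W s \<omega>)\<^sup>2)"
    "(\<integral>\<omega>. U \<omega> * (W t \<omega> - W s \<omega>)\<^sup>2 \<partial>M) = (\<integral>\<omega>. U \<omega> \<partial>M) * (t - s)"
proof -
  interpret prob_space M by (rule brownian_motionD(1)[OF bm])
  let ?D = "\<lambda>\<omega>. W t \<omega> - W s \<omega>"
  have "integrable M (\<lambda>\<omega>. U \<omega> * ?D \<omega>) \<and> (\<integral>\<omega>. U \<omega> * ?D \<omega> \<partial>M) = 0 \<and>
    integrable M (\<lambda>\<omega>. U \<omega> * (?D \<omega>)\<^sup>2) \<and> (\<integral>\<omega>. U \<omega> * (?D \<omega>)\<^sup>2 \<partial>M) = (\<integral>\<omega>. U \<omega> \<partial>M) * (t - s)"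
  proof (cases "s = t")
    case False
    then have st': "s < t" using st by simp
    have pos: "0 < sqrt (t - s)" using st' by simp
    note d = brownian_motionD(8)[OF bm st(1) st']
    have id: "(\<lambda>x. x) \<in> borel_measurable lborel" "(\<lambda>x::real. x\<^sup>2) \<in> borel_measurable lborel" by auto
    have 1: "integrable M ?D" "(\<integral>\<omega>. ?D \<omega> \<partial>M) = 0"
      using distributed_integrable[OF d id(1)] distributed_integral[OF d id(1)]
        integrable_normal_moment_nz_1[OF pos, of 0] integral_normal_moment_nz_1[OF pos, of 0] by auto
    have 2: "integrable M (\<lambda>\<omega>. (?D \<omega>)\<^sup>2)" "(\<integral>\<omega>. (?D \<omega>)\<^sup>2 \<partial>M) = t - s"
      using distributed_integrable[OF d id(2)] distributed_integral[OF d id(2)]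
        integrable_normal_moment[OF pos, of 0 2] integral_normal_moment_even[OF pos, of 0 1] st' by auto
    note ind = brownian_increment_indep[OF bm st(1) st' U(1)]
    have "indep_var borel ((\<lambda>x. x) \<circ> U) borel ((\<lambda>x. x\<^sup>2) \<circ> ?D)"
      by (rule indep_var_compose[OF ind]) auto
    then have ind2: "indep_var borel U borel (\<lambda>\<omega>. (?D \<omega>)\<^sup>2)" by (simp add: o_def)
    show ?thesis
      using indep_var_lebesgue_integral[OF ind U(2) 1(1)] indep_var_integrable[OF ind U(2) 1(1)]
        indep_var_lebesgue_integral[OF ind2 U(2) 2(1)] indep_var_integrable[OF ind2 U(2) 2(1)] 1 2 by simp
  qed simp
  then show "integrable M (\<lambda>\<omega>. U \<omega> * (W t \<omega> - W s \<omega>))" "(\<integral>\<omega>. U \<omega> * (W t \<omega> - W s \<omega>) \<partial>M) = 0"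
    "integrable M (\<lambda>\<omega>. U \<omega> * (W t \<omega> - W s \<omega>)\<^sup>2)"
    "(\<integral>\<omega>. U \<omega> * (W t \<omega> - W s \<omega>)\<^sup>2 \<partial>M) = (\<integral>\<omega>. U \<omega> \<partial>M) * (t - s)" by auto
qed

section \<open>Wald's identity for a time-changed Brownian motion with drift\<close>

text \<open>
The process \<open>c s - \<nu> W(f(s))\<close> for a deterministic time change \<open>f\<close> of at most quadratic growth.
\<close>

locale brownian_passage =
  fixes M :: "'a measure" and G :: "real \<Rightarrow> 'a measure" and W :: "real \<Rightarrow> 'a \<Rightarrow> real"
    and f :: "real \<Rightarrow> real" and C c nu g :: real
  assumes bm: "brownian_motion M G W"
    and f_mono: "mono_on {0..} f" and f_cont: "continuous_on {0..} f" and f_0: "f 0 = 0"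
    and f_growth: "\<And>x. 0 \<le> x \<Longrightarrow> f x \<le> C * (1 + x\<^sup>2)"
    and c_pos: "0 < c" and nu_nonneg: "0 \<le> nu" and g_nonneg: "0 \<le> g"
begin

sublocale prob_space M by (rule brownian_motionD(1)[OF bm])

lemma f_nonneg: "0 \<le> x \<Longrightarrow> 0 \<le> f x"
  using f_mono f_0 unfolding mono_on_def by (metis atLeast_iff order_refl)

lemma f_le: "0 \<le> x \<Longrightarrow> x \<le> y \<Longrightarrow> f x \<le> f y"
  using f_mono by (auto simp: mono_on_def)

lemma C_nonneg: "0 \<le> C"
  using f_growth[of 0] f_0 by simp

lemma W_measurable [measurable]: "0 \<le> t \<Longrightarrow> W t \<in> borel_measurable M"
  by (rule brownian_motionD(5)[OF bm])

lemma W_measurable_at: "0 \<le> s \<Longrightarrow> s \<le> t \<Longrightarrow> W s \<in> borel_measurable (G t)"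
  by (rule measurable_filtration_mono[OF bm _ brownian_motionD(4)[OF bm]])

definition h :: "'a \<Rightarrow> real \<Rightarrow> real" where "h \<omega> s = c * s - nu * W (f s) \<omega>"

lemma h_cont: "\<omega> \<in> space M \<Longrightarrow> continuous_on {0..} (h \<omega>)"
  unfolding h_def
  by (intro continuous_intros continuous_on_compose2[OF brownian_motionD(7)[OF bm] f_cont]) (auto intro:
      f_nonneg)

lemma h_measurable [measurable]: "0 \<le> s \<Longrightarrow> (\<lambda>\<omega>. h \<omega> s) \<in> borel_measurable M"
  unfolding h_def using f_nonneg[of s] by measurable

definition grid :: "real \<Rightarrow> nat \<Rightarrow> nat \<Rightarrow> real" where "grid R m i = R * real i / real m"

text \<open>
The indicator that no grid point up to the index \<open>i\<close> is above the level. It is known at time \<open>f (grid R m i)\<close>.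
\<close>

definition alive :: "real \<Rightarrow> nat \<Rightarrow> nat \<Rightarrow> 'a \<Rightarrow> real" where
  "alive R m i \<omega> = (if \<forall>j\<le>i. h \<omega> (grid R m j) \<le> g then 1 else 0)"

text \<open>
The sum of the increments of \<open>Y\<close> up to the first grid point above the level, that is, the stopped
process minus its initial value. The same functional applied to \<open>s\<close>, \<open>f(s)\<close> and \<open>W(f(s))\<close> gives the stopped
time, its clock and the stopped martingale.
\<close>

definition stopped_sum :: "(real \<Rightarrow> 'a \<Rightarrow> real) \<Rightarrow> real \<Rightarrow> nat \<Rightarrow> nat \<Rightarrow> 'a \<Rightarrow> real" where
  "stopped_sum Y R m k \<omega> = (\<Sum>i<k. alive R m i \<omega> * (Y (grid R m (Suc i)) \<omega> - Y (grid R m i) \<omega>))"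

text \<open>
The stopping index \<open>l\<close> is the same for all \<open>Y\<close>; before it the path is below the level, and it is above the
level at \<open>l\<close> unless the grid is exhausted.
\<close>

lemma stopped_sum_eq:
  "\<exists>l\<le>k. (\<forall>Y. stopped_sum Y R m k \<omega> = Y (grid R m l) \<omega> - Y (grid R m 0) \<omega>) \<and>
     (\<forall>j<l. h \<omega> (grid R m j) \<le> g) \<and> (l < k \<longrightarrow> g < h \<omega> (grid R m l))"
proof (induction k)
  case 0 show ?case by (simp add: stopped_sum_def)
next
  case (Suc k)
  then obtain l where l: "l \<le> k" "\<And>Y. stopped_sum Y R m k \<omega> = Y (grid R m l) \<omega> - Y (grid R m 0) \<omega>"
     "\<And>j. j < l \<Longrightarrow> h \<omega> (grid R m j) \<le> g" "l < k \<Longrightarrow> g < h \<omega> (grid R m l)" by blast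
  have S: "stopped_sum Y R m (Suc k) \<omega> = Y (grid R m l) \<omega> - Y (grid R m 0) \<omega> +
     alive R m k \<omega> * (Y (grid R m (Suc k)) \<omega> - Y (grid R m k) \<omega>)" for Y
    using l(2)[of Y] by (simp add: stopped_sum_def)
  show ?case
  proof (cases "l = k \<and> h \<omega> (grid R m k) \<le> g")
    case True
    then have "\<forall>j<Suc k. h \<omega> (grid R m j) \<le> g" using l(3) by (auto simp: less_Suc_eq)
    then show ?thesis using True S by (intro exI[of _ "Suc k"]) (auto simp: alive_def less_Suc_eq_le)
  next
    case False
    then have *: "g < h \<omega> (grid R m l)" using l(1,4) by (cases "l = k") auto
    then have "alive R m k \<omega> = 0" using l(1) by (force simp: alive_def not_le)
    then show ?thesis using * l S by (intro exI[of _ l]) auto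
  qed
qed

lemma grid_nonneg: "0 \<le> R \<Longrightarrow> 0 \<le> grid R m i"
  by (simp add: grid_def)

lemma grid_mono: "0 \<le> R \<Longrightarrow> i \<le> j \<Longrightarrow> grid R m i \<le> grid R m j"
  unfolding grid_def by (intro divide_right_mono mult_left_mono) auto

lemma grid_le: "0 \<le> R \<Longrightarrow> i \<le> m \<Longrightarrow> grid R m i \<le> R"
  unfolding grid_def by (cases "m = 0") (simp_all add: divide_le_eq mult_left_mono)

lemma alive_measurable_at:
  assumes "0 \<le> R" shows "alive R m i \<in> borel_measurable (G (f (grid R m i)))"
proof -
  have "alive R m i = (\<lambda>\<omega>. \<Prod>j\<in>{..i}. indicator {..g} (h \<omega> (grid R m j)))"
    by (rule ext) (auto simp: alive_def indicator_def prod_zero_iff)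
  also have "\<dots> \<in> borel_measurable (G (f (grid R m i)))"
  proof (rule borel_measurable_prod)
    fix j assume "j \<in> {..i}"
    then have "W (f (grid R m j)) \<in> borel_measurable (G (f (grid R m i)))"
      using assms by (intro W_measurable_at f_nonneg f_le grid_nonneg grid_mono) auto
    then have "(\<lambda>\<omega>. h \<omega> (grid R m j)) \<in> borel_measurable (G (f (grid R m i)))"
      unfolding h_def by simp
    then show "(\<lambda>\<omega>. indicator {..g} (h \<omega> (grid R m j)) :: real) \<in> borel_measurable (G (f (grid R m i)))"
      by (rule measurable_compose[where g="indicator {..g}"]) simp
  qed
  finally show ?thesis .
qed

lemma stopped_W_measurable_at:
  assumes R: "0 \<le> R"
  shows "stopped_sum (\<lambda>s. W (f s)) R m k \<in> borel_measurable (G (f (grid R m k)))"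
  unfolding stopped_sum_def[abs_def]
proof (rule borel_measurable_sum)
  fix i assume "i \<in> {..<k}"
  then have i: "f (grid R m i) \<le> f (grid R m k)" "f (grid R m (Suc i)) \<le> f (grid R m k)"
    using R by (auto intro!: f_le grid_nonneg grid_mono)
  note m = measurable_filtration_mono[OF bm i(1) alive_measurable_at[OF R]]
    W_measurable_at[OF f_nonneg[OF grid_nonneg[OF R]] i(1)]
    W_measurable_at[OF f_nonneg[OF grid_nonneg[OF R]] i(2)]
  show "(\<lambda>\<omega>. alive R m i \<omega> * (W (f (grid R m (Suc i))) \<omega> -
      W (f (grid R m i)) \<omega>)) \<in> borel_measurable (G (f (grid R m k)))"
    by (intro borel_measurable_times borel_measurable_diff m)
qed

lemma measurable_from_G: "U \<in> measurable (G t) N \<Longrightarrow> U \<in> measurable M N"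
  by (rule measurable_from_subalg[OF brownian_motionD(2)[OF bm]])

lemma alive_integrable: "0 \<le> R \<Longrightarrow> integrable M (alive R m i)"
  using measurable_from_G[OF alive_measurable_at]
  by (intro integrable_const_bound[of _ 1]) (auto simp: alive_def)

text \<open>
Optional stopping for a finite grid: the next increment is centred, has variance the increment of the clock, and
is independent of what is known before, in particular of whether the process is still running.
\<close>

lemma stopped_W_moments:
  assumes R: "0 \<le> R"
  shows "integrable M (stopped_sum (\<lambda>s. W (f s)) R m k)"
    "(\<integral>\<omega>. stopped_sum (\<lambda>s. W (f s)) R m k \<omega> \<partial>M) = 0"
    "integrable M (\<lambda>\<omega>. (stopped_sum (\<lambda>s. W (f s)) R m k \<omega>)\<^sup>2)"
    "(\<integral>\<omega>. (stopped_sum (\<lambda>s. W (f s)) R m k \<omega>)\<^sup>2 \<partial>M) = (\<integral>\<omega>. stopped_sum (\<lambda>s _. f s) R m k \<omega> \<partial>M)"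
    "integrable M (stopped_sum (\<lambda>s _. f s) R m k)"
proof (induction k)
  case 0
  { case 1 show ?case by (simp add: stopped_sum_def[abs_def]) }
  { case 2 show ?case by (simp add: stopped_sum_def[abs_def]) }
  { case 3 show ?case by (simp add: stopped_sum_def[abs_def]) }
  { case 4 show ?case by (simp add: stopped_sum_def[abs_def]) }
  { case 5 show ?case by (simp add: stopped_sum_def[abs_def]) }
next
  case (Suc k)
  let ?V = "stopped_sum (\<lambda>s. W (f s)) R m k"
  let ?a = "alive R m k" and ?u = "f (grid R m k)" and ?v = "f (grid R m (Suc k))"
  let ?D = "\<lambda>\<omega>. W ?v \<omega> - W ?u \<omega>"
  have uv: "0 \<le> ?u" "?u \<le> ?v" using R by (auto intro!: f_nonneg f_le grid_nonneg grid_mono)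
  note a = alive_measurable_at[OF R, of m k] and V = stopped_W_measurable_at[OF R, of m k]
  have Va: "(\<lambda>\<omega>. ?V \<omega> * ?a \<omega>) \<in> borel_measurable (G ?u)" using a V by (rule_tac borel_measurable_times)
  have Vai: "integrable M (\<lambda>\<omega>. ?V \<omega> * ?a \<omega>)"
    by (rule Bochner_Integration.integrable_bound[OF Suc(1) measurable_from_G[OF Va]])
      (auto simp: alive_def)
  note inc = brownian_increment_moments[OF bm uv a alive_integrable[OF R]]
    and inc2 = brownian_increment_moments[OF bm uv Va Vai]
  have S: "stopped_sum (\<lambda>s. W (f s)) R m (Suc k) = (\<lambda>\<omega>. ?V \<omega> + ?a \<omega> * ?D \<omega>)"
    by (simp add: stopped_sum_def[abs_def])
  have aa: "?a \<omega> * ?a \<omega> = ?a \<omega>" for \<omega> by (simp add: alive_def)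
  have "(?V \<omega> + ?a \<omega> * ?D \<omega>)\<^sup>2 = (?V \<omega>)\<^sup>2 + 2 * (?V \<omega> * ?a \<omega> * ?D \<omega>) + ?a \<omega> * ?a \<omega> * (?D \<omega>)\<^sup>2" for \<omega>
    by (simp add: power2_eq_square algebra_simps)
  then have S2: "(\<lambda>\<omega>. (stopped_sum (\<lambda>s. W (f s)) R m (Suc k) \<omega>)\<^sup>2) =
     (\<lambda>\<omega>. (?V \<omega>)\<^sup>2 + 2 * (?V \<omega> * ?a \<omega> * ?D \<omega>) + ?a \<omega> * (?D \<omega>)\<^sup>2)"
    unfolding S aa by simp
  have S3: "stopped_sum (\<lambda>s _. f s) R m (Suc k) = (\<lambda>\<omega>. stopped_sum (\<lambda>s _. f s) R m k \<omega> + ?a \<omega> * (?v - ?u))"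
    by (simp add: stopped_sum_def[abs_def])
  { case 1 show ?case unfolding S using Suc(1) inc(1) by simp }
  { case 2 show ?case unfolding S using Suc(1,2) inc(1,2) by simp }
  { case 3 show ?case unfolding S2 using Suc(3) inc(3) inc2(1) by simp }
  { case 4 show ?case unfolding S2 S3 using Suc(3,4,5) inc(3,4) inc2(1,2) alive_integrable[OF R, of m k]
      by simp }
  { case 5 show ?case unfolding S3 using Suc(5) alive_integrable[OF R, of m k] by simp }
qed

definition grid_passage :: "real \<Rightarrow> nat \<Rightarrow> 'a \<Rightarrow> real" where
  "grid_passage R m = stopped_sum (\<lambda>s _. s) R m m"

abbreviation "stopped_W R m \<equiv> stopped_sum (\<lambda>s. W (f s)) R m m"
abbreviation "sigma_cap R \<omega> \<equiv> capped_passage R (h \<omega>) g"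

lemma grid_passage_props:
  assumes R: "0 < R" and m: "0 < m"
  shows "\<exists>l\<le>m. grid_passage R m \<omega> = grid R m l \<and>
     stopped_W R m \<omega> = W (f (grid R m l)) \<omega> - W 0 \<omega> \<and>
     stopped_sum (\<lambda>s _. f s) R m m \<omega> = f (grid R m l) \<and>
     (\<forall>j<l. h \<omega> (grid R m j) \<le> g) \<and> (l < m \<longrightarrow> g < h \<omega> (grid R m l))"
proof -
  obtain l where l: "l \<le> m" "\<And>Y. stopped_sum Y R m m \<omega> = Y (grid R m l) \<omega> - Y (grid R m 0) \<omega>"
     "\<forall>j<l. h \<omega> (grid R m j) \<le> g" "l < m \<longrightarrow> g < h \<omega> (grid R m l)"
    using stopped_sum_eq[of m R m \<omega>] by blast
  have "grid R m 0 = 0" by (simp add: grid_def)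
  then show ?thesis
    using l f_0 by (intro exI[of _ l]) (simp add: grid_passage_def)
qed

lemma grid_passage_bounds:
  assumes R: "0 < R" and m: "0 < m"
  shows "0 \<le> grid_passage R m \<omega>" "grid_passage R m \<omega> \<le> R" "sigma_cap R \<omega> \<le> grid_passage R m \<omega>"
proof -
  obtain l where l: "l \<le> m" "grid_passage R m \<omega> = grid R m l" "l < m \<longrightarrow> g < h \<omega> (grid R m l)"
    using grid_passage_props[OF assms] by metis
  show "0 \<le> grid_passage R m \<omega>" "grid_passage R m \<omega> \<le> R"
    using l R by (auto intro: grid_nonneg grid_le)
  show "sigma_cap R \<omega> \<le> grid_passage R m \<omega>"
  proof (cases "l < m")
    case True then show ?thesis using l R by (auto intro!: capped_passage_le' grid_nonneg)
  next
    case False then have "grid R m l = R" using l(1) m by (simp add: grid_def)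
    then show ?thesis using l capped_passage_le by simp
  qed
qed

lemma grid_passage_measurable: "0 \<le> R \<Longrightarrow> grid_passage R m \<in> borel_measurable M"
  unfolding grid_passage_def stopped_sum_def[abs_def]
  by (intro borel_measurable_sum borel_measurable_times borel_measurable_const measurable_from_G[OF
      alive_measurable_at])

text \<open>
The first passage along the grid comes after the true passage, and just after the true passage there is an
interval on which the path is above the level; a fine grid has a point in it.
\<close>

lemma grid_passage_tendsto:
  assumes R: "0 < R" and \<omega>: "\<omega> \<in> space M"
  shows "(\<lambda>m. grid_passage R m \<omega>) \<longlonglongrightarrow> sigma_cap R \<omega>"
proof (rule LIMSEQ_I)
  fix e :: real assume e: "0 < e"
  show "\<exists>no. \<forall>m\<ge>no. norm (grid_passage R m \<omega> - sigma_cap R \<omega>) < e"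
  proof (cases "sigma_cap R \<omega> < R")
    case False
    then have "sigma_cap R \<omega> = R" using capped_passage_le[of R "h \<omega>" g] by simp
    then have "grid_passage R m \<omega> = sigma_cap R \<omega>" if "m \<ge> 1" for m
      using grid_passage_bounds[OF R, of m \<omega>] that by simp
    then show ?thesis using e by (intro exI[of _ 1]) auto
  next
    case True
    then have "sigma_cap R \<omega> < min R (sigma_cap R \<omega> + e)" using e by simp
    then obtain s where s: "0 \<le> s" "s < min R (sigma_cap R \<omega> + e)" "g < h \<omega> s"
      unfolding capped_passage_less_iff by auto
    obtain d where d: "d > 0" "s + d \<le> min R (sigma_cap R \<omega> + e)" "\<And>r. s \<le> r \<Longrightarrow> r < s + d \<Longrightarrow> g < h \<omega> r"
      using passage_persists[OF h_cont[OF \<omega>] s] by blast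
    show ?thesis
    proof (intro exI[of _ "Suc (nat \<lceil>R / d\<rceil>)"] allI impI)
      fix m assume "m \<ge> Suc (nat \<lceil>R / d\<rceil>)"
      then have "R / d < real m" by linarith
      then have m: "0 < m" "R / real m < d" using d(1) R \<open>m \<ge> Suc (nat \<lceil>R / d\<rceil>)\<close>
          by (simp_all add: field_simps)
      define j where "j = nat \<lceil>s * real m / R\<rceil>"
      have "s * real m / R \<le> real j" "real j < s * real m / R + 1"
        using s(1) R unfolding j_def by (simp_all add: real_nat_ceiling_ge) linarith
      then have j: "s \<le> grid R m j" "grid R m j < s + R / real m"
        using R m by (auto simp: grid_def field_simps)
      have hj: "g < h \<omega> (grid R m j)" using j m d by (intro d(3)) auto
      obtain l where l: "l \<le> m" "grid_passage R m \<omega> = grid R m l" "\<And>i. i < l \<Longrightarrow> h \<omega> (grid R m i) \<le> g"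
        using grid_passage_props[OF R m(1)] by metis
      have "l \<le> j" using l(3)[of j] hj by (meson not_le)
      then have "grid R m l \<le> grid R m j" using R by (intro grid_mono) auto
      then have "grid_passage R m \<omega> < sigma_cap R \<omega> + e" using l(2) j m(2) d(2) by linarith
      then show "norm (grid_passage R m \<omega> - sigma_cap R \<omega>) < e"
        using grid_passage_bounds(3)[OF R m(1), of \<omega>] by simp
    qed
  qed
qed

lemma sigma_cap_measurable: "sigma_cap R \<in> borel_measurable M"
  by (rule capped_passage_measurable[OF h_cont h_measurable])

lemma grid_passage_integral_tendsto:
  assumes R: "0 < R" and q: "continuous_on UNIV q"
  shows "(\<lambda>m. \<integral>\<omega>. q (grid_passage R (Suc m) \<omega>) \<partial>M) \<longlonglongrightarrow> (\<integral>\<omega>. q (sigma_cap R \<omega>) \<partial>M)"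
    and "integrable M (\<lambda>\<omega>. q (sigma_cap R \<omega>))"
    and "integrable M (\<lambda>\<omega>. q (grid_passage R (Suc m) \<omega>) :: real)"
proof -
  have "bounded (q ` {0..R})"
    by (intro compact_imp_bounded compact_continuous_image continuous_on_subset[OF q]) auto
  then obtain B where "\<forall>y\<in>q ` {0..R}. norm y \<le> B" unfolding bounded_iff by blast
  then have B: "\<And>x. x \<in> {0..R} \<Longrightarrow> \<bar>q x\<bar> \<le> B" by simp
  have qm: "q \<in> borel_measurable borel" by (rule borel_measurable_continuous_onI[OF q])
  have m1: "(\<lambda>\<omega>. q (sigma_cap R \<omega>)) \<in> borel_measurable M"
    by (rule measurable_compose[OF sigma_cap_measurable qm])
  have m2: "(\<lambda>\<omega>. q (grid_passage R m \<omega>)) \<in> borel_measurable M" for m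
    by (rule measurable_compose[OF grid_passage_measurable qm]) (use R in simp)
  have b1: "\<bar>q (sigma_cap R \<omega>)\<bar> \<le> B" for \<omega>
    using capped_passage_le capped_passage_ge0 R by (intro B) auto
  have b2: "\<bar>q (grid_passage R (Suc m) \<omega>)\<bar> \<le> B" for m \<omega>
    using grid_passage_bounds[OF R, of "Suc m"] by (intro B) auto
  have lim: "(\<lambda>m. q (grid_passage R (Suc m) \<omega>)) \<longlonglongrightarrow> q (sigma_cap R \<omega>)" if "\<omega> \<in> space M" for \<omega>
  proof (rule isCont_tendsto_compose[where g=q])
    show "isCont q (sigma_cap R \<omega>)" using q by (simp add: continuous_on_eq_continuous_at)
    show "(\<lambda>m. grid_passage R (Suc m) \<omega>) \<longlonglongrightarrow> sigma_cap R \<omega>"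
      by (rule LIMSEQ_Suc[OF grid_passage_tendsto[OF R that]])
  qed
  show "(\<lambda>m. \<integral>\<omega>. q (grid_passage R (Suc m) \<omega>) \<partial>M) \<longlonglongrightarrow> (\<integral>\<omega>. q (sigma_cap R \<omega>) \<partial>M)"
    by (rule integral_dominated_convergence[where w="\<lambda>_. B"]) (use m1 m2 b2 lim in auto)
  show "integrable M (\<lambda>\<omega>. q (sigma_cap R \<omega>))"
    by (rule integrable_const_bound[of _ B]) (use b1 m1 in auto)
  show "integrable M (\<lambda>\<omega>. q (grid_passage R (Suc m) \<omega>))"
    by (rule integrable_const_bound[of _ B]) (use b2 m2 in auto)
qed

lemma sigma_cap_integrable: "0 < R \<Longrightarrow> integrable M (sigma_cap R)"
  using grid_passage_integral_tendsto(2)[of R "\<lambda>x. x"] by simp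

text \<open>
The second moment of the stopped martingale is the mean clock at the stopping time \<open>\<tau> \<le> R\<close>, and
\<open>f(\<tau>) \<le> C (1 + \<tau>\<^sup>2) \<le> C (1 + R \<tau>)\<close>. It therefore grows like \<open>R\<close> only, as the means of \<open>\<tau>\<close> stay bounded.
\<close>

lemma stopped_W_second_moment:
  assumes R: "0 < R"
  shows "(\<integral>\<omega>. (stopped_W R (Suc m) \<omega>)\<^sup>2 \<partial>M) \<le> C * (1 + R * (\<integral>\<omega>. grid_passage R (Suc m) \<omega> \<partial>M))"
proof -
  have R0: "0 \<le> R" using R by simp
  have int: "integrable M (grid_passage R (Suc m))"
    using grid_passage_integral_tendsto(3)[OF R, of "\<lambda>x. x"] by simp
  have "(\<integral>\<omega>. (stopped_W R (Suc m) \<omega>)\<^sup>2 \<partial>M) = (\<integral>\<omega>. stopped_sum (\<lambda>s _. f s) R (Suc m) (Suc m) \<omega> \<partial>M)"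
    by (rule stopped_W_moments(4)[OF R0])
  also have "\<dots> \<le> (\<integral>\<omega>. C * (1 + R * grid_passage R (Suc m) \<omega>) \<partial>M)"
  proof (rule integral_mono)
    fix \<omega> assume "\<omega> \<in> space M"
    obtain l where l: "grid_passage R (Suc m) \<omega> = grid R (Suc m) l"
      "stopped_sum (\<lambda>s _. f s) R (Suc m) (Suc m) \<omega> = f (grid R (Suc m) l)"
      using grid_passage_props[OF R, of "Suc m" \<omega>] by auto
    note b = grid_passage_bounds[OF R, of "Suc m" \<omega>, simplified]
    have "f (grid R (Suc m) l) \<le> C * (1 + (grid_passage R (Suc m) \<omega>)\<^sup>2)"
      using f_growth[of "grid R (Suc m) l"] b l by simp
    also have "\<dots> \<le> C * (1 + R * grid_passage R (Suc m) \<omega>)"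
      using b C_nonneg by (intro mult_left_mono add_left_mono) (auto simp: power2_eq_square mult_right_mono)
    finally show "stopped_sum (\<lambda>s _. f s) R (Suc m) (Suc m) \<omega> \<le> C * (1 + R * grid_passage R (Suc m) \<omega>)"
      unfolding l(2) .
  qed (use stopped_W_moments(5)[OF R0] int in auto)
  also have "\<dots> = C * (1 + R * (\<integral>\<omega>. grid_passage R (Suc m) \<omega> \<partial>M))"
    using int by (simp add: prob_space)
  finally show ?thesis .
qed

text \<open>
The value of \<open>h\<close> at the grid passage, up to the null event that \<open>W\<close> does not start at \<open>0\<close>.
\<close>

definition stopped_h :: "real \<Rightarrow> nat \<Rightarrow> 'a \<Rightarrow> real" where
  "stopped_h R m \<omega> = c * grid_passage R (Suc m) \<omega> - nu * stopped_W R (Suc m) \<omega>"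

lemma stopped_h_integral:
  assumes R: "0 < R"
  shows "integrable M (stopped_h R m)"
    "(\<integral>\<omega>. stopped_h R m \<omega> \<partial>M) = c * (\<integral>\<omega>. grid_passage R (Suc m) \<omega> \<partial>M)"
proof -
  have R0: "0 \<le> R" using R by simp
  have int: "integrable M (grid_passage R (Suc m))"
    using grid_passage_integral_tendsto(3)[OF R, of "\<lambda>x. x"] by simp
  note V = stopped_W_moments(1,2)[OF R0, of "Suc m" "Suc m"]
  show "integrable M (stopped_h R m)" unfolding stopped_h_def[abs_def] using int V by simp
  show "(\<integral>\<omega>. stopped_h R m \<omega> \<partial>M) = c * (\<integral>\<omega>. grid_passage R (Suc m) \<omega> \<partial>M)"
    unfolding stopped_h_def using int V by simp
qed

lemma stopped_h_eq:
  assumes R: "0 < R" and "W 0 \<omega> = 0"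
  shows "stopped_h R m \<omega> = h \<omega> (grid_passage R (Suc m) \<omega>)"
  using grid_passage_props[OF R, of "Suc m" \<omega>] assms(2) unfolding stopped_h_def h_def by auto

text \<open>
Let the grid become fine. The stopped values of \<open>h\<close> have mean \<open>c\<close> times the mean of the grid passage, and they
converge to a value that is at most \<open>g\<close>. They are bounded in \<open>L\<^sup>2\<close> for fixed \<open>R\<close>, hence uniformly integrable,
so the bound by \<open>g\<close> passes to the limit of the means.
\<close>

lemma capped_passage_expectation_upper:
  assumes R: "0 < R"
  shows "c * (\<integral>\<omega>. sigma_cap R \<omega> \<partial>M) \<le> g"
proof (rule field_le_epsilon)
  fix e :: real assume e: "0 < e"
  have R0: "0 \<le> R" using R by simp
  define B2 where "B2 = 2 * c\<^sup>2 * R\<^sup>2 + 2 * nu\<^sup>2 * (C * (1 + R * R))"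
  have B2: "0 \<le> B2" using C_nonneg R by (simp add: B2_def)
  (* \<open>B2\<close> bounds the second moments. Clamping the stopped values to \<open>[-B, B]\<close>
     loses at most \<open>B2 / B \<le> e\<close> in the mean. *)
  define B where "B = max (g + 1) (B2 / e)"
  have B: "g \<le> B" "0 < B" using g_nonneg by (simp_all add: B_def less_max_iff_disj le_max_iff_disj)
  have "B2 / e \<le> B" by (simp add: B_def)
  then have B3: "B2 / B \<le> e" using e B(2) by (simp add: field_simps)
  define clamp where "clamp x = max (- B) (min B x)" for x :: real
  note int = stopped_h_integral[OF R]
  have sq: "integrable M (\<lambda>\<omega>. (stopped_h R m \<omega>)\<^sup>2)" "(\<integral>\<omega>. (stopped_h R m \<omega>)\<^sup>2 \<partial>M) \<le> B2" for m
  proof -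
    let ?b = "\<lambda>\<omega>. 2 * c\<^sup>2 * R\<^sup>2 + 2 * nu\<^sup>2 * (stopped_W R (Suc m) \<omega>)\<^sup>2"
    have bi: "integrable M ?b" using stopped_W_moments(3)[OF R0] by simp
    have le: "(stopped_h R m \<omega>)\<^sup>2 \<le> ?b \<omega>" for \<omega>
    proof -
      let ?a = "c * grid_passage R (Suc m) \<omega>" and ?d = "nu * stopped_W R (Suc m) \<omega>"
      have "(?a - ?d)\<^sup>2 + (?a + ?d)\<^sup>2 = 2 * ?a\<^sup>2 + 2 * ?d\<^sup>2" by (simp add: power2_eq_square algebra_simps)
      then have "(?a - ?d)\<^sup>2 \<le> 2 * ?a\<^sup>2 + 2 * ?d\<^sup>2" using zero_le_power2[of "?a + ?d"] by linarith
      moreover have "?a\<^sup>2 \<le> c\<^sup>2 * R\<^sup>2"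
        using grid_passage_bounds[OF R, of "Suc m" \<omega>] c_pos unfolding power_mult_distrib[symmetric]
        by (intro power_mono mult_left_mono) auto
      ultimately show ?thesis unfolding stopped_h_def by (simp add: power_mult_distrib)
    qed
    show i: "integrable M (\<lambda>\<omega>. (stopped_h R m \<omega>)\<^sup>2)"
    proof (rule Bochner_Integration.integrable_bound[OF bi])
      show "(\<lambda>\<omega>. (stopped_h R m \<omega>)\<^sup>2) \<in> borel_measurable M"
        by (rule borel_measurable_power[OF borel_measurable_integrable[OF int(1)]])
      show "AE \<omega> in M. norm ((stopped_h R m \<omega>)\<^sup>2) \<le> norm (?b \<omega>)"
        by (rule AE_I2) (use le in \<open>simp add: order_trans[OF _ abs_ge_self]\<close>)
    qed
    have "(\<integral>\<omega>. (stopped_h R m \<omega>)\<^sup>2 \<partial>M) \<le> (\<integral>\<omega>. ?b \<omega> \<partial>M)"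
      by (rule integral_mono[OF i bi le])
    also have "\<dots> = 2 * c\<^sup>2 * R\<^sup>2 + 2 * nu\<^sup>2 * (\<integral>\<omega>. (stopped_W R (Suc m) \<omega>)\<^sup>2 \<partial>M)"
      using stopped_W_moments(3)[OF R0] by (simp add: prob_space)
    also have "\<dots> \<le> B2"
    proof -
      have "(\<integral>\<omega>. grid_passage R (Suc m) \<omega> \<partial>M) \<le> (\<integral>\<omega>. R \<partial>M)"
        using grid_passage_integral_tendsto(3)[OF R, of "\<lambda>x. x"] grid_passage_bounds[OF R]
        by (intro integral_mono) auto
      then have "C * (1 + R * (\<integral>\<omega>. grid_passage R (Suc m) \<omega> \<partial>M)) \<le> C * (1 + R * R)"
        using C_nonneg R by (intro mult_left_mono add_left_mono) (auto simp: prob_space)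
      then have "(\<integral>\<omega>. (stopped_W R (Suc m) \<omega>)\<^sup>2 \<partial>M) \<le> C * (1 + R * R)"
        using stopped_W_second_moment[OF R, of m] by linarith
      then show ?thesis unfolding B2_def by (intro add_left_mono mult_left_mono) auto
    qed
    finally show "(\<integral>\<omega>. (stopped_h R m \<omega>)\<^sup>2 \<partial>M) \<le> B2" .
  qed
  have cm: "(\<lambda>\<omega>. clamp (u \<omega>)) \<in> borel_measurable M" if "u \<in> borel_measurable M" for u
    unfolding clamp_def by (intro borel_measurable_max borel_measurable_min borel_measurable_const that)
  have cb: "\<bar>clamp x\<bar> \<le> B" for x unfolding clamp_def using B(2) by (auto simp: abs_le_iff)
  have h_cap_m: "(\<lambda>\<omega>. h \<omega> (sigma_cap R \<omega>)) \<in> borel_measurable M"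
  proof (rule borel_measurable_LIMSEQ_metric)
    show "(\<lambda>\<omega>. h \<omega> (grid_passage R (Suc m) \<omega>)) \<in> borel_measurable M" for m
    proof -
      have "(\<lambda>\<omega>. c * grid_passage R (Suc m) \<omega> - nu * (stopped_W R (Suc m) \<omega> + W 0 \<omega>)) \<in> borel_measurable M"
        using borel_measurable_integrable[OF stopped_W_moments(1)[OF R0]] grid_passage_measurable[OF R0]
        by (intro borel_measurable_diff borel_measurable_times borel_measurable_add) auto
      moreover have "h \<omega> (grid_passage R (Suc m) \<omega>) =
          c * grid_passage R (Suc m) \<omega> - nu * (stopped_W R (Suc m) \<omega> + W 0 \<omega>)" for \<omega>
        using grid_passage_props[OF R, of "Suc m" \<omega>] unfolding h_def by auto
      ultimately show ?thesis by simp
    qed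
  next
    fix \<omega> assume \<omega>: "\<omega> \<in> space M"
    show "(\<lambda>m. h \<omega> (grid_passage R (Suc m) \<omega>)) \<longlonglongrightarrow> h \<omega> (sigma_cap R \<omega>)"
      by (rule continuous_on_tendsto_compose[OF h_cont[OF \<omega>] LIMSEQ_Suc[OF grid_passage_tendsto[OF R \<omega>]]])
        (use grid_passage_bounds(1)[OF R] capped_passage_ge0[OF R0] in auto)
  qed
  have lim: "AE \<omega> in M. (\<lambda>m. clamp (stopped_h R m \<omega>)) \<longlonglongrightarrow> clamp (h \<omega> (sigma_cap R \<omega>))"
    using brownian_motionD(6)[OF bm] AE_space
  proof eventually_elim
    case (elim \<omega>)
    have "(\<lambda>m. h \<omega> (grid_passage R (Suc m) \<omega>)) \<longlonglongrightarrow> h \<omega> (sigma_cap R \<omega>)"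
      by (rule continuous_on_tendsto_compose[OF h_cont[OF elim(2)] LIMSEQ_Suc[OF grid_passage_tendsto[OF R
          elim(2)]]])
        (use grid_passage_bounds(1)[OF R] capped_passage_ge0[OF R0] in auto)
    then show ?case unfolding clamp_def stopped_h_eq[OF R elim(1)] by (intro tendsto_intros)
  qed
  have conv: "(\<lambda>m. \<integral>\<omega>. clamp (stopped_h R m \<omega>) \<partial>M) \<longlonglongrightarrow> (\<integral>\<omega>. clamp (h \<omega> (sigma_cap R \<omega>)) \<partial>M)"
    by (rule integral_dominated_convergence[where w="\<lambda>_. B"])
      (use cm[OF borel_measurable_integrable[OF int(1)]] cm[OF h_cap_m] lim cb in auto)
  have le: "c * (\<integral>\<omega>. grid_passage R (Suc m) \<omega> \<partial>M) \<le> (\<integral>\<omega>. clamp (stopped_h R m \<omega>) \<partial>M) + e" for m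
  proof -
    have ci: "integrable M (\<lambda>\<omega>. clamp (stopped_h R m \<omega>))"
      by (rule integrable_const_bound[of _ B]) (use cm[OF borel_measurable_integrable[OF int(1)]] cb in auto)
    have "(\<integral>\<omega>. stopped_h R m \<omega> \<partial>M) \<le> (\<integral>\<omega>. clamp (stopped_h R m \<omega>) + (stopped_h R m \<omega>)\<^sup>2 / B \<partial>M)"
    proof (rule integral_mono[OF int(1)])
      fix \<omega>
      let ?y = "stopped_h R m \<omega>"
      have sqB: "0 \<le> ?y\<^sup>2 / B" using B(2) by simp
      show "?y \<le> clamp ?y + ?y\<^sup>2 / B"
      proof (cases "?y \<le> B")
        case True then show ?thesis using sqB unfolding clamp_def by (auto simp: max_def min_def)
      next
        case False
        then have "?y * B \<le> ?y * ?y" using B(2) by (intro mult_left_mono) auto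
        then have "?y \<le> ?y\<^sup>2 / B" using B(2) by (simp add: field_simps power2_eq_square)
        moreover have "clamp ?y = B" using False B(2) by (simp add: clamp_def)
        ultimately show ?thesis using B(2) by simp
      qed
    qed (use ci sq(1) in auto)
    also have "\<dots> = (\<integral>\<omega>. clamp (stopped_h R m \<omega>) \<partial>M) + (\<integral>\<omega>. (stopped_h R m \<omega>)\<^sup>2 \<partial>M) / B"
      using ci sq(1) by simp
    also have "\<dots> \<le> (\<integral>\<omega>. clamp (stopped_h R m \<omega>) \<partial>M) + e"
      by (intro add_left_mono order_trans[OF divide_right_mono[OF sq(2)] B3]) (use B(2) in simp)
    finally show ?thesis unfolding int(2) .
  qed
  have "c * (\<integral>\<omega>. sigma_cap R \<omega> \<partial>M) \<le> (\<integral>\<omega>. clamp (h \<omega> (sigma_cap R \<omega>)) \<partial>M) + e"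
  proof (rule LIMSEQ_le)
    show "(\<lambda>m. c * (\<integral>\<omega>. grid_passage R (Suc m) \<omega> \<partial>M)) \<longlonglongrightarrow> c * (\<integral>\<omega>. sigma_cap R \<omega> \<partial>M)"
      by (rule tendsto_mult_left[OF grid_passage_integral_tendsto(1)[OF R continuous_on_id]])
    show "(\<lambda>m. (\<integral>\<omega>. clamp (stopped_h R m \<omega>) \<partial>M) + e) \<longlonglongrightarrow> (\<integral>\<omega>. clamp (h \<omega> (sigma_cap R \<omega>)) \<partial>M) + e"
      by (rule tendsto_add[OF conv tendsto_const])
  qed (use le in blast)
  moreover have "(\<integral>\<omega>. clamp (h \<omega> (sigma_cap R \<omega>)) \<partial>M) \<le> (\<integral>\<omega>. g \<partial>M)"
  proof (rule integral_mono_AE)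
    show "integrable M (\<lambda>\<omega>. clamp (h \<omega> (sigma_cap R \<omega>)))"
      by (rule integrable_const_bound[of _ B]) (use cm[OF h_cap_m] cb in auto)
    show "AE \<omega> in M. clamp (h \<omega> (sigma_cap R \<omega>)) \<le> g"
      using brownian_motionD(6)[OF bm] AE_space
    proof eventually_elim
      case (elim \<omega>)
      have "h \<omega> (sigma_cap R \<omega>) \<le> g"
        by (rule barrier_at_capped_passage[OF h_cont[OF elim(2)] _ R0]) (use elim(1) f_0 g_nonneg in \<open>simp
            add: h_def\<close>)
      then show ?case using B(2) g_nonneg by (simp add: clamp_def min_le_iff_disj)
    qed
  qed simp
  ultimately show "c * (\<integral>\<omega>. sigma_cap R \<omega> \<partial>M) \<le> g + e" by (simp add: prob_space)
qed

text \<open>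
A path stopped before the grid is exhausted contributes at least \<open>g\<close>. On the remaining paths the loss
is at most \<open>\<nu> \<bar>V\<bar>\<close> with \<open>V\<close> the stopped martingale. It is split by
\<open>\<bar>V\<bar> \<le> (th V\<^sup>2 + 1 / th) / 2\<close>, and the probability of these paths is controlled by \<open>q / R\<close>, because
\<open>max 0 (2 \<tau> - R) = R\<close> when \<open>\<tau> = R\<close>.
\<close>

lemma capped_passage_expectation_lower:
  assumes R: "0 < R" and th: "0 < th"
  defines "E \<equiv> \<integral>\<omega>. sigma_cap R \<omega> \<partial>M" and "q \<equiv> \<integral>\<omega>. max 0 (2 * sigma_cap R \<omega> - R) \<partial>M"
  shows "g - g / R * q - nu * (th * (C * (1 + R * E)) + q / (R * th)) / 2 \<le> c * E"
proof -
  have R0: "0 \<le> R" using R by simp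
  let ?t = "\<lambda>m. grid_passage R (Suc m)"
  define Em where "Em m = (\<integral>\<omega>. ?t m \<omega> \<partial>M)" for m
  define qm where "qm m = (\<integral>\<omega>. max 0 (2 * ?t m \<omega> - R) \<partial>M)" for m
  have c1: "continuous_on UNIV (\<lambda>x::real. x)" and c2: "continuous_on UNIV (\<lambda>x::real. max 0 (2 * x - R))"
    by (auto intro!: continuous_intros)
  have ti: "integrable M (?t m)" for m using grid_passage_integral_tendsto(3)[OF R c1] .
  have qi: "integrable M (\<lambda>\<omega>. max 0 (2 * ?t m \<omega> - R))" for m using grid_passage_integral_tendsto(3)[OF R c2] .
  have Em: "Em \<longlonglongrightarrow> E" unfolding Em_def E_def by (rule grid_passage_integral_tendsto(1)[OF R c1])
  have qm: "qm \<longlonglongrightarrow> q" unfolding qm_def q_def by (rule grid_passage_integral_tendsto(1)[OF R c2])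
  have "g - g / R * qm m - nu * (th * (C * (1 + R * Em m)) + qm m / (R * th)) / 2 \<le> c * Em m" for m
  proof -
    let ?V = "stopped_W R (Suc m)" and ?q = "\<lambda>\<omega>. max 0 (2 * ?t m \<omega> - R)"
    let ?l = "\<lambda>\<omega>. g - g / R * ?q \<omega> - nu * (th * (?V \<omega>)\<^sup>2 + ?q \<omega> / (R * th)) / 2"
    note Vi = stopped_W_moments(3)[OF R0, of "Suc m" "Suc m"]
    have li: "integrable M ?l" using Vi qi[of m] by simp
    have "(\<integral>\<omega>. ?l \<omega> \<partial>M) \<le> (\<integral>\<omega>. stopped_h R m \<omega> \<partial>M)"
    proof (rule integral_mono_AE[OF li stopped_h_integral(1)[OF R]])
      show "AE \<omega> in M. ?l \<omega> \<le> stopped_h R m \<omega>"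
        using brownian_motionD(6)[OF bm]
      proof eventually_elim
        case (elim \<omega>)
        obtain l where l: "l \<le> Suc m" "?t m \<omega> = grid R (Suc m) l" "l < Suc m \<longrightarrow> g < h \<omega> (grid R (Suc m) l)"
          using grid_passage_props[OF R, of "Suc m" \<omega>] by auto
        have qn: "0 \<le> ?q \<omega>" by simp
        show ?case
        proof (cases "l < Suc m")
          case True
          then have "g < stopped_h R m \<omega>" using l stopped_h_eq[OF R elim] by simp
          moreover have "0 \<le> g / R * ?q \<omega>" "0 \<le> nu * (th * (?V \<omega>)\<^sup>2 + ?q \<omega> / (R * th)) / 2"
            using qn g_nonneg nu_nonneg R th by (auto intro!: mult_nonneg_nonneg add_nonneg_nonneg
                divide_nonneg_nonneg)
          ultimately show ?thesis by linarith
        next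
          case False
          then have "?t m \<omega> = R" using l by (simp add: grid_def)
          then have q: "?q \<omega> = R" using R by simp
          (* the grid is exhausted without a passage: use the arithmetic-geometric mean inequality *)
          have "0 \<le> (th * \<bar>?V \<omega>\<bar> - 1)\<^sup>2 / th" using th by simp
          also have "\<dots> = th * (?V \<omega>)\<^sup>2 - 2 * \<bar>?V \<omega>\<bar> + 1 / th"
            using th by (simp add: power2_eq_square field_simps)
          finally have v: "0 \<le> th * (?V \<omega>)\<^sup>2 - 2 * \<bar>?V \<omega>\<bar> + 1 / th" .
          have "a \<le> (p + r) / 2" if "0 \<le> p - 2 * a + r" for a p r :: real using that by simp
          from this[OF v] have "\<bar>?V \<omega>\<bar> \<le> (th * (?V \<omega>)\<^sup>2 + 1 / th) / 2" .
          then have "?V \<omega> \<le> (th * (?V \<omega>)\<^sup>2 + 1 / th) / 2" by (rule order_trans[OF abs_ge_self])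
          then have "nu * ?V \<omega> \<le> nu * ((th * (?V \<omega>)\<^sup>2 + 1 / th) / 2)"
            using nu_nonneg by (rule mult_left_mono)
          moreover have "0 \<le> c * ?t m \<omega>" using c_pos grid_passage_bounds[OF R, of "Suc m" \<omega>] by simp
          ultimately have "- (nu * ((th * (?V \<omega>)\<^sup>2 + 1 / th) / 2)) \<le> stopped_h R m \<omega>"
            unfolding stopped_h_def by linarith
          moreover have "?l \<omega> = - (nu * ((th * (?V \<omega>)\<^sup>2 + 1 / th) / 2))"
            unfolding q using R by simp
          ultimately show ?thesis by (simp only:)
        qed
      qed
    qed
    moreover have "(\<integral>\<omega>. ?l \<omega> \<partial>M) = g - g / R * qm m - nu * (th * (\<integral>\<omega>. (?V \<omega>)\<^sup>2 \<partial>M) + qm m / (R * th)) / 2"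
      using Vi qi[of m] by (simp add: qm_def prob_space)
    moreover have "nu * (th * (\<integral>\<omega>. (?V \<omega>)\<^sup>2 \<partial>M) + qm m / (R * th)) / 2 \<le>
        nu * (th * (C * (1 + R * Em m)) + qm m / (R * th)) / 2"
      unfolding Em_def using nu_nonneg th stopped_W_second_moment[OF R, of m]
      by (intro divide_right_mono mult_left_mono add_right_mono) auto
    ultimately show ?thesis unfolding stopped_h_integral(2)[OF R] Em_def by linarith
  qed
  then show ?thesis
    by (intro LIMSEQ_le[of "\<lambda>m. g - g / R * qm m - nu * (th * (C * (1 + R * Em m)) +
        qm m / (R * th)) / 2" _ "\<lambda>m. c * Em m"])
      (use R th in \<open>auto intro!: tendsto_intros Em qm\<close>)
qed

lemma passage_exists_AE: "AE \<omega> in M. \<exists>s\<ge>0. g < h \<omega> s"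
proof -
  define N where "N = {\<omega>\<in>space M. \<not> (\<exists>s\<ge>0. g < h \<omega> s)}"
  have N: "N \<in> sets M"
    unfolding N_def using passage_exists_measurable[of M h g, OF h_cont h_measurable]
        by (rule sets.sets_Collect_neg)
  have "prob N * R \<le> g / c" if R: "0 < R" for R
  proof -
    have R0: "0 \<le> R" using R by simp
    have "(\<integral>\<omega>. indicator N \<omega> * R \<partial>M) \<le> (\<integral>\<omega>. sigma_cap R \<omega> \<partial>M)"
    proof (intro integral_mono sigma_cap_integrable R)
      fix \<omega>
      show "indicator N \<omega> * R \<le> sigma_cap R \<omega>"
        using capped_eq_cap[of g "h \<omega>" R] capped_passage_ge0[OF R0, of "h \<omega>" g]
        by (cases "\<omega> \<in> N") (auto simp: N_def)
    qed (use N in \<open>simp add: emeasure_eq_measure less_top[symmetric]\<close>)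
    also have "\<dots> \<le> g / c" using capped_passage_expectation_upper[OF R] c_pos by (simp add: field_simps)
    finally show ?thesis using N by simp
  qed
  have "prob N = 0"
  proof (rule ccontr)
    assume "prob N \<noteq> 0"
    then have p: "0 < prob N" by (simp add: zero_less_measure_iff)
    have "0 < (g / c + 1) / prob N" using p g_nonneg c_pos by (intro divide_pos_pos add_nonneg_pos) auto
    from \<open>\<And>R. 0 < R \<Longrightarrow> prob N * R \<le> g / c\<close>[OF this] show False using p by simp
  qed
  then have "emeasure M N = 0" by (simp add: emeasure_eq_measure)
  then show ?thesis using N by (intro AE_I[of _ _ N]) (auto simp: N_def)
qed

text \<open>
The upper bound holds for every cap \<open>R\<close>. In the lower bound take \<open>th = d / R\<close>: then \<open>q\<close>, the mean of
\<open>max 0 (2 \<sigma> - R)\<close>, tends to \<open>0\<close> as \<open>R\<close> grows because \<open>\<sigma>\<close> is integrable, and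
what remains of the error is of order \<open>d\<close>, which is arbitrary.
\<close>

lemma wald_identity:
  shows "integrable M (\<lambda>\<omega>. first_passage (h \<omega>) g)" "(\<integral>\<omega>. first_passage (h \<omega>) g \<partial>M) = g / c"
proof -
  let ?s = "\<lambda>\<omega>. first_passage (h \<omega>) g"
  define E where "E n = (\<integral>\<omega>. sigma_cap (real (Suc n)) \<omega> \<partial>M)" for n
  have cap: "sigma_cap R \<omega> = min R (?s \<omega>)" if "\<exists>s\<ge>0. g < h \<omega> s" for R \<omega>
    by (rule capped_eq_min_first[OF that])
  have inc: "incseq E"
    unfolding E_def
  proof (intro incseq_SucI integral_mono_AE sigma_cap_integrable)
    show "AE \<omega> in M. sigma_cap (real (Suc n)) \<omega> \<le> sigma_cap (real (Suc (Suc n))) \<omega>" for n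
      using passage_exists_AE
    proof eventually_elim
      case (elim \<omega>) show ?case unfolding cap[OF elim] by simp
    qed
  qed auto
  have Eb: "E n \<le> g / c" for n
    using capped_passage_expectation_upper[of "real (Suc n)"] c_pos by (simp add: E_def field_simps)
  then have "\<forall>n. E n \<le> g / c" by blast
  then obtain x where x: "E \<longlonglongrightarrow> x" by (rule incseq_convergent[OF inc])
  have sm: "?s \<in> borel_measurable M" by (rule first_passage_measurable[OF h_cont h_measurable])
  have lim: "AE \<omega> in M. (\<lambda>n. sigma_cap (real (Suc n)) \<omega>) \<longlonglongrightarrow> ?s \<omega>"
    using passage_exists_AE
  proof eventually_elim
    case (elim \<omega>)
    show ?case by (rule LIMSEQ_Suc[OF tendsto_eventually[OF capped_passage_tendsto[OF elim]]])
  qed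
  have mono: "AE \<omega> in M. mono (\<lambda>n. sigma_cap (real (Suc n)) \<omega>)"
    using passage_exists_AE
  proof eventually_elim
    case (elim \<omega>) show ?case unfolding cap[OF elim] by (auto intro!: monoI)
  qed
  have nn: "AE \<omega> in M. 0 \<le> sigma_cap (real (Suc n)) \<omega>" for n
    by (rule AE_I2, rule capped_passage_ge0) simp
  note conv = integral_monotone_convergence_nonneg[OF sigma_cap_integrable mono nn lim x[unfolded E_def] sm]
  show int: "integrable M ?s" using conv(1) by simp
  have xs: "(\<integral>\<omega>. ?s \<omega> \<partial>M) = x" using conv(2) by simp
  have "x \<le> g / c" by (rule LIMSEQ_le_const2[OF x]) (use Eb in auto)
  moreover have "g / c \<le> x"
  proof -
    define q where "q n = (\<integral>\<omega>. max 0 (2 * sigma_cap (real (Suc n)) \<omega> - real (Suc n)) \<partial>M)" for n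
    have q0: "q \<longlonglongrightarrow> (\<integral>\<omega>. 0 \<partial>M)" unfolding q_def
    proof (rule integral_dominated_convergence[where w="\<lambda>\<omega>. 2 * ?s \<omega>"])
      show "AE \<omega> in M. (\<lambda>n. max 0 (2 * sigma_cap (real (Suc n)) \<omega> - real (Suc n))) \<longlonglongrightarrow> 0"
        using passage_exists_AE
      proof eventually_elim
        case (elim \<omega>)
        have "eventually (\<lambda>n. 2 * ?s \<omega> \<le> real (Suc n)) sequentially"
          unfolding eventually_sequentially
          by (rule exI[of _ "nat \<lceil>2 * ?s \<omega>\<rceil>"]) (auto simp: nat_le_iff ceiling_le_iff)
        then have "eventually (\<lambda>n. max 0 (2 * sigma_cap (real (Suc n)) \<omega> - real (Suc n)) = 0) sequentially"
          unfolding cap[OF elim] by eventually_elim (simp add: min_def)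
        then show ?case by (rule tendsto_eventually)
      qed
      show "AE \<omega> in M. norm (max 0 (2 * sigma_cap (real (Suc n)) \<omega> - real (Suc n))) \<le> 2 * ?s \<omega>" for n
        using passage_exists_AE
      proof eventually_elim
        case (elim \<omega>)
        show ?case using first_passage_ge0[of "h \<omega>" g] unfolding cap[OF elim] by (auto simp: min_def max_def)
      qed
      show "(\<lambda>\<omega>. max 0 (2 * sigma_cap (real (Suc n)) \<omega> - real (Suc n))) \<in> borel_measurable M" for n
        by (intro borel_measurable_max borel_measurable_const borel_measurable_diff borel_measurable_times
            sigma_cap_measurable)
    qed (use int in auto)
    then have q0: "q \<longlonglongrightarrow> 0" by simp
    have Rinv: "(\<lambda>n. 1 / real (Suc n)) \<longlonglongrightarrow> 0" by (rule LIMSEQ_Suc[OF lim_1_over_n])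
    have "g - nu * (d * (C * x)) / 2 \<le> c * x" if d: "0 < d" for d
    proof (rule LIMSEQ_le)
      show "(\<lambda>n. g - g * (1 / real (Suc n)) * q n -
         nu * (d * (C * (1 / real (Suc n) + E n)) + q n / d) / 2) \<longlonglongrightarrow> g - nu * (d * (C * x)) / 2"
      proof -
        have "(\<lambda>n. g - g * r n * q n - nu * (d * (C * (r n + E n)) + q n / d) / 2)
            \<longlonglongrightarrow> g - g * 0 * 0 - nu * (d * (C * (0 + x)) + 0 / d) / 2" if "r \<longlonglongrightarrow> 0" for r
          using d by (intro tendsto_intros that q0 x) auto
        from this[OF Rinv] show ?thesis by simp
      qed
      show "(\<lambda>n. c * E n) \<longlonglongrightarrow> c * x" by (intro tendsto_intros x)
      have "g - g * (1 / real (Suc n)) * q n - nu * (d * (C * (1 / real (Suc n) + E n)) + q n / d) / 2 \<le>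
          c * E n" for n
      proof -
        let ?R = "real (Suc n)"
        have R: "0 < ?R" by simp
        have e1: "d / ?R * (C * (1 + ?R * E n)) = d * (C * (1 / ?R + E n))"
          using R by (simp add: field_simps del: of_nat_Suc)
        have e2: "q n / (?R * (d / ?R)) = q n / d"
          using R by (simp del: of_nat_Suc)
        have e3: "g / ?R = g * (1 / ?R)" by simp
        have "0 < d / ?R" using R d by (intro divide_pos_pos)
        from capped_passage_expectation_lower[OF R this] show ?thesis
          unfolding E_def[symmetric] q_def[symmetric] e1 e2 e3 .
      qed
      then show "\<exists>N. \<forall>n\<ge>N. g - g * (1 / real (Suc n)) * q n -
         nu * (d * (C * (1 / real (Suc n) + E n)) + q n / d) / 2 \<le> c * E n" by blast
    qed
    note * = this
    have "g \<le> c * x"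
    proof (rule tendsto_upperbound[of "\<lambda>d. g - nu * (d * (C * x)) / 2" _ "at_right 0"])
      show "((\<lambda>d. g - nu * (d * (C * x)) / 2) \<longlongrightarrow> g) (at_right 0)"
        by (auto intro!: tendsto_eq_intros)
      show "\<forall>\<^sub>F d in at_right 0. g - nu * (d * (C * x)) / 2 \<le> c * x"
        unfolding eventually_at_right_field using * by (intro exI[of _ 1]) auto
    qed simp
    then show ?thesis using c_pos by (simp add: field_simps)
  qed
  ultimately show "(\<integral>\<omega>. ?s \<omega> \<partial>M) = g / c" using xs by simp
qed

end

section \<open>Measurability of path-valued maps\<close>

text \<open>
Openness for uniform convergence on compacts in the first component and Levy closeness in the second. Every
open set of the product topology has this property, and it is all that the measurability of path-valued maps
and the convergence of laws require.
\<close>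

definition path_open :: "real \<Rightarrow> ((real \<Rightarrow> real) \<times> (real \<Rightarrow> real)) set \<Rightarrow> bool" where
  "path_open T U \<longleftrightarrow> U \<subseteq> C_paths \<times> D_up_paths T \<and>
     (\<forall>\<phi> x. (\<phi>, x) \<in> U \<longrightarrow> (\<exists>b. \<exists>e>0. \<forall>\<psi>\<in>C_paths. \<forall>y\<in>D_up_paths T.
        (\<forall>t\<in>{0..b}. \<bar>\<psi> t - \<phi> t\<bar> < e) \<longrightarrow> levy_close T e x y \<longrightarrow> (\<psi>, y) \<in> U))"

lemma path_openD:
  assumes "path_open T U" "(\<phi>, x) \<in> U"
  shows "\<exists>b. \<exists>e>0. \<forall>\<psi>\<in>C_paths. \<forall>y\<in>D_up_paths T.
    (\<forall>t\<in>{0..b}. \<bar>\<psi> t - \<phi> t\<bar> < e) \<longrightarrow> levy_close T e x y \<longrightarrow> (\<psi>, y) \<in> U"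
  using assms(1)[unfolded path_open_def, THEN conjunct2, rule_format, OF assms(2)] .

lemma topspace_C_topology: "topspace C_topology = C_paths"
proof -
  have "openin C_topology C_paths" unfolding openin_C_topology by (auto intro: exI[of _ 1])
  then show ?thesis
    by (intro antisym openin_subset) (auto simp: topspace_def openin_C_topology)
qed

lemma topspace_D_circ: "topspace (D_circ_topology T) = C_paths \<times> D_up_paths T"
proof -
  have "openin (M1_topology T) (D_paths T)" unfolding openin_M1_topology by (auto intro: exI[of _ 1])
  then have "topspace (M1_topology T) = D_paths T"
    by (intro antisym openin_subset) (auto simp: topspace_def openin_M1_topology)
  moreover have "D_up_paths T \<subseteq> D_paths T" by (auto simp: D_up_paths_def)
  ultimately show ?thesis
    unfolding D_circ_topology_def by (auto simp: topspace_C_topology)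
qed

lemma levy_close_mono:
  assumes "levy_close T d x y" "d \<le> e" and xy: "x \<in> D_up_paths T" "y \<in> D_up_paths T"
  shows "levy_close T e x y"
  unfolding levy_close_def
proof (intro conjI ballI)
  show "0 \<le> e" "\<bar>x 0 - y 0\<bar> \<le> e" using assms by (auto simp: levy_close_def)
  fix t assume t: "t \<in> {0..T}"
  have d: "0 \<le> d" and *: "y t \<le> x (min T (t + d)) + d" "x t \<le> y (min T (t + d)) + d"
    using assms(1) t by (auto simp: levy_close_def)
  have "x (min T (t + d)) \<le> x (min T (t + e))" "y (min T (t + d)) \<le> y (min T (t + e))"
    using t d assms(2) by (auto intro!: D_up_pathsD(5)[OF xy(1)] D_up_pathsD(5)[OF xy(2)])
  then show "y t \<le> x (min T (t + e)) + e" "x t \<le> y (min T (t + e)) + e"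
    using * assms(2) by linarith+
qed

lemma levy_close_refl: "x \<in> D_up_paths T \<Longrightarrow> 0 \<le> e \<Longrightarrow> 0 \<le> T \<Longrightarrow> levy_close T e x x"
  by (rule levy_close_mono[of _ 0]) (auto simp: levy_close_def)

lemma levy_close_trans:
  assumes "levy_close T d x y" "levy_close T e y z"
  shows "levy_close T (d + e) x z"
  unfolding levy_close_def
proof (intro conjI ballI)
  have d: "0 \<le> d" "0 \<le> e" using assms by (auto simp: levy_close_def)
  show "0 \<le> d + e" "\<bar>x 0 - z 0\<bar> \<le> d + e" using assms by (auto simp: levy_close_def)
  fix t assume t: "t \<in> {0..T}"
  have "x t \<le> y (min T (t + d)) + d" using assms(1) t by (simp add: levy_close_def)
  also have "y (min T (t + d)) \<le> z (min T (min T (t + d) + e)) + e"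
    using assms(2) t d unfolding levy_close_def by (auto dest!: bspec[of _ _ "min T (t + d)"])
  also have "min T (min T (t + d) + e) = min T (t + (d + e))" using d by (auto simp: min_def)
  finally show "x t \<le> z (min T (t + (d + e))) + (d + e)" by simp
  have "z t \<le> y (min T (t + e)) + e" using assms(2) t by (simp add: levy_close_def)
  also have "y (min T (t + e)) \<le> x (min T (min T (t + e) + d)) + d"
    using assms(1) t d unfolding levy_close_def by (auto dest!: bspec[of _ _ "min T (t + e)"])
  also have "min T (min T (t + e) + d) = min T (t + (d + e))" using d by (auto simp: min_def)
  finally show "z t \<le> x (min T (t + (d + e))) + (d + e)" by simp
qed

text \<open>
Between two grid times both paths are monotone, so closeness at the grid points extends to all times up to a
shift by one mesh width. The grid contains \<open>0\<close> and \<open>T\<close>, where no shift in time is permitted.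
\<close>

lemma levy_close_grid:
  assumes T: "0 < T" and x: "x \<in> D_up_paths T" and y: "y \<in> D_up_paths T" and m: "0 < m"
    and grid: "\<And>i. i \<le> m \<Longrightarrow> \<bar>x (T * real i / real m) - y (T * real i / real m)\<bar> \<le> d"
    and d: "d \<le> e" "T / real m \<le> e"
  shows "levy_close T e x y"
  unfolding levy_close_def
proof (intro conjI ballI)
  show "0 \<le> e" using d(2) T m by (meson divide_nonneg_nonneg less_imp_le of_nat_0_le_iff order_trans)
  show "\<bar>x 0 - y 0\<bar> \<le> e" using grid[of 0] d(1) by simp
  fix t assume t: "t \<in> {0..T}"
  define i where "i = nat \<lceil>t * real m / T\<rceil>"
  have p: "0 \<le> t * real m / T" using t T by simp
  have i: "t * real m / T \<le> real i" "real i < t * real m / T + 1"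
    using p unfolding i_def by (simp_all add: real_nat_ceiling_ge) linarith
  have "t * real m / T \<le> real m" using t T m by (simp add: field_simps)
  then have im: "i \<le> m" unfolding i_def by (simp add: nat_le_iff ceiling_le_iff)
  let ?t = "T * real i / real m"
  have t1: "t \<le> ?t" using i(1) T m by (simp add: field_simps)
  have t2: "?t \<le> T" using im T m by (simp add: field_simps)
  have "?t < t + T / real m" using i(2) T m by (simp add: field_simps)
  then have t3: "?t \<le> min T (t + e)" using t2 d(2) by simp
  have g: "\<bar>x ?t - y ?t\<bar> \<le> e" using grid[OF im] d(1) by linarith
  have "x t \<le> x ?t" "y t \<le> y ?t" "x ?t \<le> x (min T (t + e))" "y ?t \<le> y (min T (t + e))"
    using t t1 t2 t3 by (auto intro!: D_up_pathsD(5)[OF x] D_up_pathsD(5)[OF y])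
  then show "y t \<le> x (min T (t + e)) + e" "x t \<le> y (min T (t + e)) + e" using g by linarith+
qed

lemma openin_D_circ_path_open:
  assumes T: "0 \<le> T" and U: "openin (D_circ_topology T) U"
  shows "path_open T U"
  unfolding path_open_def
proof (intro conjI allI impI)
  show "U \<subseteq> C_paths \<times> D_up_paths T" using openin_subset[OF U] by (simp add: topspace_D_circ)
  fix \<phi> x assume z: "(\<phi>, x) \<in> U"
  then have x: "x \<in> D_up_paths T" using openin_subset[OF U] by (auto simp: topspace_D_circ)
  obtain A B where A: "openin C_topology A" "\<phi> \<in> A"
    and B: "openin (subtopology (M1_topology T) (D_up_paths T)) B" "x \<in> B" and AB: "A \<times> B \<subseteq> U"
    using U z unfolding D_circ_topology_def openin_prod_topology_alt by blast
  obtain S where S: "openin (M1_topology T) S" "B = S \<inter> D_up_paths T"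
    using B(1) unfolding openin_subtopology by blast
  obtain b e1 where e1: "e1 > 0" "\<And>\<psi>. \<psi> \<in> C_paths \<Longrightarrow> (\<forall>t\<in>{0..b}. \<bar>\<psi> t - \<phi> t\<bar> < e1) \<Longrightarrow> \<psi> \<in> A"
    using A unfolding openin_C_topology by meson
  obtain e2 where e2: "e2 > 0" "\<And>y. y \<in> D_paths T \<Longrightarrow> M1_dist T x y < e2 \<Longrightarrow> y \<in> S"
    using S B(2) unfolding openin_M1_topology by blast
  show "\<exists>b. \<exists>e>0. \<forall>\<psi>\<in>C_paths. \<forall>y\<in>D_up_paths T.
        (\<forall>t\<in>{0..b}. \<bar>\<psi> t - \<phi> t\<bar> < e) \<longrightarrow> levy_close T e x y \<longrightarrow> (\<psi>, y) \<in> U"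
  proof (rule exI[of _ b], rule exI[of _ "min e1 (e2 / 4)"], intro conjI ballI impI)
    fix \<psi> y assume \<psi>: "\<psi> \<in> C_paths" "\<forall>t\<in>{0..b}. \<bar>\<psi> t - \<phi> t\<bar> < min e1 (e2 / 4)"
      and y: "y \<in> D_up_paths T" "levy_close T (min e1 (e2 / 4)) x y"
    have "M1_dist T x y \<le> 3 * min e1 (e2 / 4)" by (rule M1_dist_le_levy_close[OF T x y])
    then have "M1_dist T x y < e2" using e2(1) by (auto simp: min_def split: if_splits)
    then have "y \<in> B" using e2(2) y(1) S(2) D_up_pathsD(1)[OF y(1)] by blast
    moreover have "\<psi> \<in> A" using e1(2)[OF \<psi>(1)] \<psi>(2) by simp
    ultimately show "(\<psi>, y) \<in> U" using AB by blast
  qed (use e1 e2 in simp)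
qed

lemma levy_close_of_cell:
  assumes T: "0 < T" and x: "x \<in> D_up_paths T" and y: "y \<in> D_up_paths T" and m: "0 < m"
    and "\<And>i. i \<le> m \<Longrightarrow> \<bar>x (T * real i / real m) - v i\<bar> \<le> 1 / real m"
    and "\<And>i. i \<le> m \<Longrightarrow> \<bar>y (T * real i / real m) - v i\<bar> \<le> 1 / real m"
    and "2 / real m \<le> e" "T / real m \<le> e"
  shows "levy_close T e x y"
proof (rule levy_close_grid[OF T x y m _ assms(7,8)])
  fix i assume "i \<le> m"
  from assms(5)[OF this] assms(6)[OF this]
  show "\<bar>x (T * real i / real m) - y (T * real i / real m)\<bar> \<le> 2 / real m" by (simp add: abs_le_iff)
qed

text \<open>
Paths that stay within \<open>2 / m\<close> of prescribed multiples of \<open>1 / m\<close> on consecutive intervals of length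
\<open>1 / k\<close>. Only rational times occur, so a cell is visibly measurable.
\<close>

definition C_cell :: "nat \<Rightarrow> nat \<Rightarrow> int list \<Rightarrow> (real \<Rightarrow> real) set" where
  "C_cell k m v = {\<psi>\<in>C_paths. \<forall>i<length v. \<forall>q\<in>{q. real i / real k \<le> real_of_rat q \<and> real_of_rat q <
      real (Suc i) / real k}.
     \<bar>\<psi> (real_of_rat q) - real_of_int (v ! i) / real m\<bar> \<le> 2 / real m}"

definition D_cell :: "real \<Rightarrow> nat \<Rightarrow> int list \<Rightarrow> (real \<Rightarrow> real) set" where
  "D_cell T m v = {y\<in>D_up_paths T. \<forall>i\<le>m. \<bar>y (T * real i / real m) - real_of_int (v ! i) / real m\<bar> \<le>
      1 / real m}"

lemma C_cell_bound:
  assumes \<psi>: "\<psi> \<in> C_cell k m v" and i: "i < length v" and t: "real i / real k \<le> t" "t < real (Suc i) / real k"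
  shows "\<bar>\<psi> t - real_of_int (v ! i) / real m\<bar> \<le> 2 / real m"
proof (rule ccontr)
  let ?h = "\<lambda>t. \<bar>\<psi> t - real_of_int (v ! i) / real m\<bar>"
  assume *: "\<not> ?h t \<le> 2 / real m"
  have "continuous_on {0..} \<psi>" using \<psi> by (simp add: C_cell_def C_paths_def)
  then have h: "continuous_on {0..} ?h" by (intro continuous_intros)
  have t0: "0 \<le> t" using t(1) by (rule order_trans[rotated]) simp
  obtain d where d: "d > 0" "t + d \<le> real (Suc i) / real k" "\<And>r. t \<le> r \<Longrightarrow> r < t + d \<Longrightarrow> 2 / real m < ?h r"
    using passage_persists[OF h t0 t(2), of "2 / real m"] * unfolding not_le by blast
  obtain q where q: "t < real_of_rat q" "real_of_rat q < t + d" using of_rat_dense[of t "t + d"] d(1) by auto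
  have "q \<in> {q. real i / real k \<le> real_of_rat q \<and> real_of_rat q < real (Suc i) / real k}"
    unfolding mem_Collect_eq using q t d(2) by linarith
  then have "?h (real_of_rat q) \<le> 2 / real m"
    using \<psi> i unfolding C_cell_def by blast
  then show False using d(3)[of "real_of_rat q"] q by simp
qed

lemma C_cell_measurable: "C_cell k m v \<in> sets path_space"
proof -
  have eq: "C_cell k m v = {w\<in>space path_space. \<forall>i\<in>{..<length v}. \<forall>q\<in>{q. real i / real k \<le> real_of_rat q \<and>
      real_of_rat q < real (Suc i) / real k}.
     \<bar>w (real_of_rat q) - real_of_int (v ! i) / real m\<bar> \<le> 2 / real m}"
    unfolding C_cell_def space_path_space by blast
  show ?thesis unfolding eq
  proof (intro sets.sets_Collect_countable_All')
    fix i q assume "q \<in> {q. real i / real k \<le> real_of_rat q \<and> real_of_rat q < real (Suc i) / real k}"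
    then have "real i / real k \<le> real_of_rat q" by simp
    then have q: "0 \<le> real_of_rat q" by (rule order_trans[rotated]) simp
    note [measurable] = measurable_path_eval[OF q]
    show "{w\<in>space path_space. \<bar>w (real_of_rat q) - real_of_int (v ! i) / real m\<bar> \<le>
        2 / real m} \<in> sets path_space"
      by measurable
  qed (rule countableI_type)+
qed

text \<open>
There are countably many pairs of cells, and each point of an open set has a pair around it inside the set: a
uniformly continuous path is nearly constant on short intervals, and a monotone path is determined in the Levy
sense by its values on a grid.
\<close>

lemma exists_cells:
  assumes T: "0 < T" and U: "path_open T U" and z: "(\<phi>, x) \<in> U"
  shows "\<exists>k m v v'. C_cell k m v \<times> D_cell T m v' \<subseteq> U \<and> \<phi> \<in> C_cell k m v \<and> x \<in> D_cell T m v'"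
proof -
  have \<phi>: "\<phi> \<in> C_paths" and x: "x \<in> D_up_paths T" using U[unfolded path_open_def, THEN conjunct1] z by blast+
  obtain b e where e: "e > 0" and
    be: "\<forall>\<psi>\<in>C_paths. \<forall>y\<in>D_up_paths T. (\<forall>t\<in>{0..b}. \<bar>\<psi> t - \<phi> t\<bar> < e) \<longrightarrow> levy_close T e x y \<longrightarrow> (\<psi>, y) \<in> U"
    using path_openD[OF U z] by blast
  (* two paths in a cell differ by at most \<open>4 / m\<close>; in the second component the mesh \<open>T / m\<close> matters as well *)
  define m where "m = Suc (nat \<lceil>max (4 / e) (T / e)\<rceil>)"
  have m0: "0 < m" by (simp add: m_def)
  have "max (4 / e) (T / e) < real m" unfolding m_def by linarith
  then have "4 / e < real m" "T / e < real m" by simp_all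
  then have m4: "4 / real m < e" and mT: "T / real m < e"
    using e m0 by (simp_all add: field_simps)
  have "2 / real m \<le> 4 / real m" by (rule divide_right_mono) simp_all
  then have m: "0 < m" "4 / real m < e" "T / real m \<le> e" "2 / real m \<le> e"
    using m0 m4 mT by simp_all
  have "uniformly_continuous_on {0..\<bar>b\<bar> + 2} \<phi>"
    by (rule compact_uniformly_continuous[OF continuous_on_subset[of "{0..}" \<phi>]]) (use \<phi> in \<open>auto simp:
        C_paths_def\<close>)
  moreover have "0 < 1 / real m" using m(1) by simp
  ultimately obtain d where d0: "d > 0" and dd: "\<forall>t\<in>{0..\<bar>b\<bar> + 2}. \<forall>s\<in>{0..\<bar>b\<bar> + 2}. dist s t < d \<longrightarrow>
      dist (\<phi> s) (\<phi> t) < 1 / real m"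
    unfolding uniformly_continuous_on_def by blast
  have d: "d > 0" "\<And>s t. s \<in> {0..\<bar>b\<bar> + 2} \<Longrightarrow> t \<in> {0..\<bar>b\<bar> + 2} \<Longrightarrow> \<bar>s - t\<bar> < d \<Longrightarrow> \<bar>\<phi> s - \<phi> t\<bar> < 1 / real m"
    using d0 dd[unfolded dist_real_def] by blast+
  define k where "k = Suc (nat \<lceil>1 / d\<rceil>)"
  have k0: "0 < k" by (simp add: k_def)
  have "1 / d < real k" unfolding k_def by linarith
  then have k: "0 < k" "1 / real k < d" "1 \<le> real k" using d(1) k0 by (simp_all add: field_simps)
  define N where "N = Suc (nat \<lceil>\<bar>b\<bar> * real k\<rceil>)"
  have "0 \<le> \<bar>b\<bar> * real k" by simp
  then have "\<bar>b\<bar> * real k < real N" "real N < \<bar>b\<bar> * real k + 2" unfolding N_def by linarith+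
  moreover from this have "real N < (\<bar>b\<bar> + 2) * real k" using k(3) by (simp add: algebra_simps)
  ultimately have N: "\<bar>b\<bar> < real N / real k" "real N / real k < \<bar>b\<bar> + 2"
    using k0 by (simp_all add: pos_less_divide_eq pos_divide_less_eq)
  define v where "v = map (\<lambda>i. \<lfloor>\<phi> (real i / real k) * real m\<rfloor>) [0..<N]"
  define v' where "v' = map (\<lambda>i. \<lfloor>x (T * real i / real m) * real m\<rfloor>) [0..<Suc m]"
  have fl: "\<bar>a - real_of_int \<lfloor>a * real m\<rfloor> / real m\<bar> \<le> 1 / real m" for a
  proof -
    have "\<bar>a * real m - real_of_int \<lfloor>a * real m\<rfloor>\<bar> \<le> 1" by linarith
    then have "\<bar>a * real m - real_of_int \<lfloor>a * real m\<rfloor>\<bar> / real m \<le> 1 / real m" by (rule divide_right_mono) simp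
    moreover have "a - real_of_int \<lfloor>a * real m\<rfloor> / real m = (a * real m - real_of_int \<lfloor>a * real m\<rfloor>) / real m"
      using m(1) by (simp add: diff_divide_distrib)
    ultimately show ?thesis by (simp only: abs_divide abs_of_nat)
  qed
  have xv: "x \<in> D_cell T m v'"
    unfolding D_cell_def using x fl by (auto simp: v'_def nth_append)
  have \<phi>v: "\<phi> \<in> C_cell k m v"
    unfolding C_cell_def
  proof (intro CollectI conjI allI impI ballI \<phi>)
    fix i q assume i: "i < length v" and q: "q \<in> {q. real i / real k \<le> real_of_rat q \<and> real_of_rat q <
        real (Suc i) / real k}"
    have iN: "i < N" using i by (simp add: v_def)
    have le: "real (Suc i) / real k \<le> real N / real k" using iN by (intro divide_right_mono) auto
    have q': "real i / real k \<le> real_of_rat q" "real_of_rat q < real (Suc i) / real k" using q by blast+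
    have i0: "0 \<le> real i / real k" by simp
    have r: "real_of_rat q \<in> {0..\<bar>b\<bar> + 2}" "real i / real k \<in> {0..\<bar>b\<bar> + 2}"
      unfolding atLeastAtMost_iff using q' N le i0 by linarith+
    have "real (Suc i) / real k = real i / real k + 1 / real k" by (simp add: add_divide_distrib)
    then have "\<bar>real_of_rat q - real i / real k\<bar> < d" using q' k(2) by linarith
    from d(2)[OF r this] fl[of "\<phi> (real i / real k)"] iN
    show "\<bar>\<phi> (real_of_rat q) - real_of_int (v ! i) / real m\<bar> \<le> 2 / real m"
      by (simp add: v_def abs_le_iff abs_less_iff)
  qed
  have "C_cell k m v \<times> D_cell T m v' \<subseteq> U"
  proof safe
    fix \<psi> y assume \<psi>: "\<psi> \<in> C_cell k m v" and y: "y \<in> D_cell T m v'"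
    show "(\<psi>, y) \<in> U"
    proof (rule be[THEN bspec, THEN bspec, THEN mp, THEN mp])
      show "\<psi> \<in> C_paths" "y \<in> D_up_paths T" using \<psi> y by (auto simp: C_cell_def D_cell_def)
      show "levy_close T e x y"
        by (rule levy_close_of_cell[OF T x \<open>y \<in> D_up_paths T\<close> m(1) _ _ m(4,3), of "\<lambda>i. real_of_int (v' ! i) /
            real m"])
          (use xv y in \<open>auto simp: D_cell_def\<close>)
      show "\<forall>t\<in>{0..b}. \<bar>\<psi> t - \<phi> t\<bar> < e"
      proof
        fix t assume t: "t \<in> {0..b}"
        define i where "i = nat \<lfloor>t * real k\<rfloor>"
        have p: "0 \<le> t * real k" using t by simp
        have i: "real i \<le> t * real k" "t * real k < real (Suc i)" using p unfolding i_def by linarith+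
        have "t * real k \<le> \<bar>b\<bar> * real k" using t by (intro mult_right_mono) auto
        also have "\<dots> < real N" using N(1) k by (simp add: field_simps)
        finally have "i < N" using i(1) by linarith
        then have il: "i < length v" by (simp add: v_def)
        have r: "real i / real k \<le> t" "t < real (Suc i) / real k" using i k by (simp_all add: field_simps)
        show "\<bar>\<psi> t - \<phi> t\<bar> < e"
          using C_cell_bound[OF \<psi> il r] C_cell_bound[OF \<phi>v il r] m(2) by (simp add: abs_le_iff abs_less_iff)
      qed
    qed
  qed
  then show ?thesis using \<phi>v xv by blast
qed

text \<open>
By \<open>exists_cells\<close> an open set is a countable union of products of cells, and a cell only restricts countably
many coordinates.
\<close>

lemma path_open_measurable:
  assumes T: "0 < T" and U: "path_open T U" and w: "w \<in> measurable M path_space"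
    and Y: "\<And>t. t \<in> {0..T} \<Longrightarrow> (\<lambda>\<omega>. Y \<omega> t) \<in> borel_measurable M"
    and YD: "\<And>\<omega>. \<omega> \<in> space M \<Longrightarrow> Y \<omega> \<in> D_up_paths T"
  shows "{\<omega>\<in>space M. (w \<omega>, Y \<omega>) \<in> U} \<in> sets M"
proof -
  let ?J = "{(k, m, v, v'). C_cell k m v \<times> D_cell T m v' \<subseteq> U}"
  let ?S = "\<lambda>(k, m, v, v'). {\<omega>\<in>space M. w \<omega> \<in> C_cell k m v \<and> Y \<omega> \<in> D_cell T m v'}"
  have "{\<omega>\<in>space M. (w \<omega>, Y \<omega>) \<in> U} = (\<Union>j\<in>?J. ?S j)"
    using exists_cells[OF T U] by (fastforce simp: subset_iff)
  also have "\<dots> \<in> sets M"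
  proof (intro sets.countable_UN')
    show "countable ?J" by simp
    show "?S ` ?J \<subseteq> sets M"
    proof safe
      fix k m v v'
      have 1: "{\<omega>\<in>space M. w \<omega> \<in> C_cell k m v} \<in> sets M"
        using measurable_sets[OF w C_cell_measurable] by (simp add: vimage_def Collect_conj_eq Int_commute)
      have t: "T * real i / real m \<in> {0..T}" if "i \<in> {..m}" for i
        using that T by (cases "m = 0") (auto simp: field_simps)
      have "{\<omega>\<in>space M. \<forall>i\<in>{..m}. \<bar>Y \<omega> (T * real i / real m) - real_of_int (v' ! i) / real m\<bar> \<le>
          1 / real m} \<in> sets M"
      proof (intro sets.sets_Collect_countable_All')
        fix i assume "i \<in> {..m}"
        note [measurable] = Y[OF t[OF this]]
        show "{\<omega>\<in>space M. \<bar>Y \<omega> (T * real i / real m) - real_of_int (v' ! i) / real m\<bar> \<le> 1 / real m} \<in> sets M"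
          by measurable
      qed auto
      moreover have "{\<omega>\<in>space M. w \<omega> \<in> C_cell k m v \<and> Y \<omega> \<in> D_cell T m v'} =
        {\<omega>\<in>space M. w \<omega> \<in> C_cell k m v} \<inter>
        {\<omega>\<in>space M. \<forall>i\<in>{..m}. \<bar>Y \<omega> (T * real i / real m) - real_of_int (v' ! i) / real m\<bar> \<le> 1 / real m}"
        using YD by (auto simp: D_cell_def)
      ultimately show "{\<omega>\<in>space M. w \<omega> \<in> C_cell k m v \<and> Y \<omega> \<in> D_cell T m v'} \<in> sets M"
        using 1 by auto
    qed
  qed
  finally show ?thesis .
qed

lemma path_pair_measurable_borel_of:
  assumes T: "0 < T" and w: "w \<in> measurable M path_space"
    and Y: "\<And>t. t \<in> {0..T} \<Longrightarrow> (\<lambda>\<omega>. Y \<omega> t) \<in> borel_measurable M"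
    and YD: "\<And>\<omega>. \<omega> \<in> space M \<Longrightarrow> Y \<omega> \<in> D_up_paths T"
  shows "(\<lambda>\<omega>. (w \<omega>, Y \<omega>)) \<in> M \<rightarrow>\<^sub>M borel_of (D_circ_topology T)"
  unfolding borel_of_def
proof (rule measurable_sigma_sets)
  show "sets (sigma (topspace (D_circ_topology T)) {U. openin (D_circ_topology T) U}) =
     sigma_sets (topspace (D_circ_topology T)) {U. openin (D_circ_topology T) U}"
    by (rule sets_measure_of) (auto dest: openin_subset)
  show "{U. openin (D_circ_topology T) U} \<subseteq> Pow (topspace (D_circ_topology T))"
    by (auto dest: openin_subset)
  show "(\<lambda>\<omega>. (w \<omega>, Y \<omega>)) \<in> space M \<rightarrow> topspace (D_circ_topology T)"
    using measurable_space[OF w] YD by (auto simp: topspace_D_circ space_path_space)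
  fix U assume "U \<in> {U. openin (D_circ_topology T) U}"
  then have "path_open T U" using T by (auto intro: openin_D_circ_path_open)
  from path_open_measurable[OF T this w Y YD]
  show "(\<lambda>\<omega>. (w \<omega>, Y \<omega>)) -` U \<inter> space M \<in> sets M" by (simp add: vimage_def Int_def conj_commute)
qed

lemma continuous_map_borel_measurable:
  fixes F :: "'a \<Rightarrow> real"
  assumes F: "continuous_map X euclideanreal F"
  shows "F \<in> borel_measurable (borel_of X)"
proof (rule borel_measurableI)
  fix S :: "real set" assume "open S"
  then have "openin X {x \<in> topspace X. F x \<in> S}"
    using F openin_continuous_map_preimage by fastforce
  moreover have "{U. openin X U} \<subseteq> Pow (topspace X)" by (auto dest: openin_subset)
  ultimately show "F -` S \<inter> space (borel_of X) \<in> sets (borel_of X)"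
    unfolding borel_of_def by (auto simp: vimage_def Int_def conj_commute space_measure_of_conv)
qed

section \<open>Convergence in law of nearby paths\<close>

lemma continuous_path_functionalE:
  assumes T: "0 \<le> T" and F: "continuous_map (D_circ_topology T) euclideanreal F"
    and \<phi>: "\<phi> \<in> C_paths" and x: "x \<in> D_up_paths T" and r: "0 < r"
  obtains b e where "e > 0" "\<And>\<psi> y. \<psi> \<in> C_paths \<Longrightarrow> y \<in> D_up_paths T \<Longrightarrow>
    \<forall>t\<in>{0..b}. \<bar>\<psi> t - \<phi> t\<bar> < e \<Longrightarrow> levy_close T e x y \<Longrightarrow> \<bar>F (\<psi>, y) - F (\<phi>, x)\<bar> < r"
proof -
  define U where "U = {z \<in> topspace (D_circ_topology T). F z \<in> ball (F (\<phi>, x)) r}"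
  have "openin (D_circ_topology T) U"
    unfolding U_def by (rule openin_continuous_map_preimage[OF F]) simp
  then have po: "path_open T U" by (rule openin_D_circ_path_open[OF T])
  have mem: "(\<phi>, x) \<in> U" using \<phi> x r by (simp add: topspace_D_circ U_def)
  obtain b e where e: "e > 0" and be: "\<forall>\<psi>\<in>C_paths. \<forall>y\<in>D_up_paths T.
    (\<forall>t\<in>{0..b}. \<bar>\<psi> t - \<phi> t\<bar> < e) \<longrightarrow> levy_close T e x y \<longrightarrow> (\<psi>, y) \<in> U"
    using path_openD[OF po mem] by blast
  show ?thesis
  proof (rule that[OF e])
    fix \<psi> y assume "\<psi> \<in> C_paths" "y \<in> D_up_paths T" "\<forall>t\<in>{0..b}. \<bar>\<psi> t - \<phi> t\<bar> < e" "levy_close T e x y"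
    then have "(\<psi>, y) \<in> U" using be by blast
    then show "\<bar>F (\<psi>, y) - F (\<phi>, x)\<bar> < r" by (simp add: U_def dist_real_def abs_minus_commute)
  qed
qed

text \<open>
The pairs near which \<open>F\<close>, as a function of its second component, varies by more than \<open>r\<close> at Levy distance
less than \<open>\<delta>\<close>. It is open, and for continuous \<open>F\<close> it decreases to the empty set as \<open>\<delta>\<close> tends to \<open>0\<close>.
\<close>

definition oscillation_set :: "real \<Rightarrow> ((real \<Rightarrow> real) \<times> (real \<Rightarrow> real) \<Rightarrow> real) \<Rightarrow> real \<Rightarrow> real \<Rightarrow>
    ((real \<Rightarrow> real) \<times> (real \<Rightarrow> real)) set" where
  "oscillation_set T F r \<delta> = {(\<phi>, x). \<phi> \<in> C_paths \<and> x \<in> D_up_paths T \<and>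
     (\<exists>y\<in>D_up_paths T. \<exists>d<\<delta>. levy_close T d x y \<and> r < \<bar>F (\<phi>, y) - F (\<phi>, x)\<bar>)}"

lemma oscillation_set_open:
  assumes T: "0 \<le> T" and F: "continuous_map (D_circ_topology T) euclideanreal F"
  shows "path_open T (oscillation_set T F r \<delta>)"
  unfolding path_open_def
proof (intro conjI allI impI)
  show "oscillation_set T F r \<delta> \<subseteq> C_paths \<times> D_up_paths T" by (auto simp: oscillation_set_def)
  fix \<phi> x assume "(\<phi>, x) \<in> oscillation_set T F r \<delta>"
  then obtain y d where \<phi>: "\<phi> \<in> C_paths" and x: "x \<in> D_up_paths T" and y: "y \<in> D_up_paths T"
    and d: "d < \<delta>" "levy_close T d x y" "r < \<bar>F (\<phi>, y) - F (\<phi>, x)\<bar>"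
    unfolding oscillation_set_def by blast
  (* the oscillation exceeds \<open>r\<close> by \<open>2 s\<close>, which leaves room to move both points *)
  define s where "s = (\<bar>F (\<phi>, y) - F (\<phi>, x)\<bar> - r) / 2"
  have s: "0 < s" using d(3) by (simp add: s_def)
  obtain b1 e1 where e1: "e1 > 0" "\<And>\<psi> z. \<psi> \<in> C_paths \<Longrightarrow> z \<in> D_up_paths T \<Longrightarrow> \<forall>t\<in>{0..b1}. \<bar>\<psi> t - \<phi> t\<bar> < e1 \<Longrightarrow>
     levy_close T e1 x z \<Longrightarrow> \<bar>F (\<psi>, z) - F (\<phi>, x)\<bar> < s"
    by (rule continuous_path_functionalE[OF T F \<phi> x s]) (rule that, assumption, blast)
  obtain b2 e2 where e2: "e2 > 0" "\<And>\<psi> z. \<psi> \<in> C_paths \<Longrightarrow> z \<in> D_up_paths T \<Longrightarrow> \<forall>t\<in>{0..b2}. \<bar>\<psi> t - \<phi> t\<bar> < e2 \<Longrightarrow>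
     levy_close T e2 y z \<Longrightarrow> \<bar>F (\<psi>, z) - F (\<phi>, y)\<bar> < s"
    by (rule continuous_path_functionalE[OF T F \<phi> y s]) (rule that, assumption, blast)
  define e where "e = min (min e1 e2) ((\<delta> - d) / 2)"
  have e: "0 < e" "e \<le> e1" "e \<le> e2" using e1(1) e2(1) d(1) by (simp_all add: e_def)
  have "e \<le> (\<delta> - d) / 2" unfolding e_def by (rule min.cobounded2)
  then have e4: "d + e < \<delta>" using d(1) by (simp add: field_simps)
  show "\<exists>b. \<exists>e>0. \<forall>\<psi>\<in>C_paths. \<forall>y\<in>D_up_paths T.
     (\<forall>t\<in>{0..b}. \<bar>\<psi> t - \<phi> t\<bar> < e) \<longrightarrow> levy_close T e x y \<longrightarrow> (\<psi>, y) \<in> oscillation_set T F r \<delta>"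
  proof (rule exI[of _ "max b1 b2"], rule exI[of _ e], intro conjI ballI impI e(1))
    fix \<psi> z assume \<psi>: "\<psi> \<in> C_paths" and z: "z \<in> D_up_paths T"
      and near: "\<forall>t\<in>{0..max b1 b2}. \<bar>\<psi> t - \<phi> t\<bar> < e" and xz: "levy_close T e x z"
    have n1: "\<forall>t\<in>{0..b1}. \<bar>\<psi> t - \<phi> t\<bar> < e1" and n2: "\<forall>t\<in>{0..b2}. \<bar>\<psi> t - \<phi> t\<bar> < e2"
      using near e(2,3) by (meson atLeastAtMost_iff le_max_iff_disj less_le_trans)+
    have 1: "\<bar>F (\<psi>, z) - F (\<phi>, x)\<bar> < s"
      by (rule e1(2)[OF \<psi> z n1 levy_close_mono[OF xz e(2) x z]])
    have 2: "\<bar>F (\<psi>, y) - F (\<phi>, y)\<bar> < s"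
      by (rule e2(2)[OF \<psi> y n2 levy_close_refl[OF y _ T]]) (use e2 in simp)
    have "r < \<bar>F (\<psi>, y) - F (\<psi>, z)\<bar>" using 1 2 d(3) unfolding s_def by (simp add: abs_if split: if_splits)
    moreover have "levy_close T (e + d) z y" by (rule levy_close_trans[OF levy_close_sym[OF xz] d(2)])
    ultimately show "(\<psi>, z) \<in> oscillation_set T F r \<delta>"
      unfolding oscillation_set_def using \<psi> z y e4
          by (auto simp: add.commute intro!: bexI[of _ y] exI[of _ "e + d"])
  qed
qed

lemma oscillation_set_vanishes:
  assumes T: "0 \<le> T" and F: "continuous_map (D_circ_topology T) euclideanreal F" and r: "0 < r"
    and \<phi>: "\<phi> \<in> C_paths" and x: "x \<in> D_up_paths T"
  shows "\<exists>n. (\<phi>, x) \<notin> oscillation_set T F r (1 / real (Suc n))"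
proof -
  obtain b e where e: "e > 0" "\<And>\<psi> y. \<psi> \<in> C_paths \<Longrightarrow> y \<in> D_up_paths T \<Longrightarrow> \<forall>t\<in>{0..b}. \<bar>\<psi> t - \<phi> t\<bar> < e \<Longrightarrow>
     levy_close T e x y \<Longrightarrow> \<bar>F (\<psi>, y) - F (\<phi>, x)\<bar> < r"
    by (rule continuous_path_functionalE[OF T F \<phi> x r]) (rule that, assumption, blast)
  obtain n where n: "1 / real (Suc n) < e" using e(1) nat_approx_posE by blast
  have "\<not> r < \<bar>F (\<phi>, y) - F (\<phi>, x)\<bar>" if y: "y \<in> D_up_paths T"
      and d: "d < 1 / real (Suc n)" "levy_close T d x y" for y d
  proof -
    have "levy_close T e x y" by (rule levy_close_mono[OF d(2) _ x y]) (use d(1) n in linarith)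
    then show ?thesis using e(2)[OF \<phi> y] e(1) by force
  qed
  then show ?thesis unfolding oscillation_set_def by blast
qed

text \<open>
The pairs \<open>(w n, \<Phi> (w n))\<close> all have the same law. Outside the event that \<open>Y n\<close> is far from \<open>\<Phi> (w n)\<close> on a
grid, which has small probability for large \<open>n\<close>, and outside the event that \<open>(w n, \<Phi> (w n))\<close> lies in the
oscillation set, whose probability is small and does not depend on \<open>n\<close>, the two values of \<open>F\<close> differ
by at most \<open>r / 4\<close>.
\<close>

lemma law_convergence_of_close_paths:
  fixes F :: "(real \<Rightarrow> real) \<times> (real \<Rightarrow> real) \<Rightarrow> real"
  assumes T: "0 < T"
    and P: "\<And>n. prob_space (M n)" and w: "\<And>n. w n \<in> measurable (M n) path_space"
    and N: "prob_space N" and v: "v \<in> measurable N path_space"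
    and law: "\<And>n. distr (M n) path_space (w n) = distr N path_space v"
    and \<Phi>: "\<And>t. t \<in> {0..T} \<Longrightarrow> (\<lambda>p. \<Phi> p t) \<in> borel_measurable path_space"
    and \<Phi>D: "\<And>p. p \<in> C_paths \<Longrightarrow> \<Phi> p \<in> D_up_paths T"
    and Y: "\<And>n t. t \<in> {0..T} \<Longrightarrow> (\<lambda>\<omega>. Y n \<omega> t) \<in> borel_measurable (M n)"
    and YD: "\<And>n \<omega>. \<omega> \<in> space (M n) \<Longrightarrow> Y n \<omega> \<in> D_up_paths T"
    and close: "\<And>t d. t \<in> {0..T} \<Longrightarrow> 0 < d \<Longrightarrow>
      (\<lambda>n. measure (M n) {\<omega>\<in>space (M n). d < \<bar>Y n \<omega> t - \<Phi> (w n \<omega>) t\<bar>}) \<longlonglongrightarrow> 0"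
    and F: "continuous_map (D_circ_topology T) euclideanreal F"
    and F_bounded: "bounded (F ` topspace (D_circ_topology T))"
  shows "(\<lambda>n. \<integral>\<omega>. F (w n \<omega>, Y n \<omega>) \<partial>M n) \<longlonglongrightarrow> (\<integral>\<omega>. F (v \<omega>, \<Phi> (v \<omega>)) \<partial>N)"
proof (rule LIMSEQ_I)
  fix r :: real assume r: "0 < r"
  have T0: "0 \<le> T" using T by simp
  interpret N: prob_space N by fact
  obtain B where "\<And>z. z \<in> topspace (D_circ_topology T) \<Longrightarrow> \<bar>F z\<bar> \<le> B"
    using F_bounded unfolding bounded_iff by auto
  then have "\<bar>F (p, x)\<bar> \<le> max 1 B" if "p \<in> C_paths" "x \<in> D_up_paths T" for p x
    using that by (force simp: topspace_D_circ)
  then obtain K where K: "0 < K" "\<And>p x. p \<in> C_paths \<Longrightarrow> x \<in> D_up_paths T \<Longrightarrow> \<bar>F (p, x)\<bar> \<le> K"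
    by (metis less_max_iff_disj zero_less_one)
  have wC: "w n \<omega> \<in> C_paths" if "\<omega> \<in> space (M n)" for n \<omega>
    using measurable_space[OF w that] by (simp add: space_path_space)
  have vC: "v \<omega> \<in> C_paths" if "\<omega> \<in> space N" for \<omega>
    using measurable_space[OF v that] by (simp add: space_path_space)
  have id: "(\<lambda>p. p) \<in> measurable path_space path_space" by simp
  have F\<Phi>: "(\<lambda>p. F (p, \<Phi> p)) \<in> borel_measurable path_space"
    by (rule measurable_compose[OF path_pair_measurable_borel_of[OF T id \<Phi>]
        continuous_map_borel_measurable[OF F]])
      (auto simp: space_path_space \<Phi>D)
  have FY: "(\<lambda>\<omega>. F (w n \<omega>, Y n \<omega>)) \<in> borel_measurable (M n)" for n
    by (rule measurable_compose[OF path_pair_measurable_borel_of[OF T w Y] continuous_map_borel_measurable[OF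
        F]])
      (auto simp: YD)
  have FZ: "(\<lambda>\<omega>. F (w n \<omega>, \<Phi> (w n \<omega>))) \<in> borel_measurable (M n)" for n
    by (rule measurable_compose[OF w F\<Phi>])
  define Os where "Os j = {p\<in>space path_space. (p, \<Phi> p) \<in> oscillation_set T F (r / 4) (1 / real (Suc j))}"
      for j
  have Os: "Os j \<in> sets path_space" for j
    unfolding Os_def by (rule path_open_measurable[OF T oscillation_set_open[OF T0 F] id \<Phi>]) (auto simp:
        space_path_space \<Phi>D)
  have lawO: "measure (M n) {\<omega>\<in>space (M n). w n \<omega> \<in> Os j} = measure N {\<omega>\<in>space N. v \<omega> \<in> Os j}" for n j
    using measure_distr[OF w[of n] Os[of j]] measure_distr[OF v Os[of j]] law[of n]
    by (simp add: vimage_def Int_def conj_commute)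
  have "(\<lambda>j. measure N {\<omega>\<in>space N. v \<omega> \<in> Os j}) \<longlonglongrightarrow> measure N (\<Inter>j. {\<omega>\<in>space N. v \<omega> \<in> Os j})"
  proof (rule N.finite_Lim_measure_decseq)
    show "range (\<lambda>j. {\<omega>\<in>space N. v \<omega> \<in> Os j}) \<subseteq> N.events"
      using measurable_sets[OF v Os] by (auto simp: vimage_def Int_def conj_commute)
    have "Os (Suc j) \<subseteq> Os j" for j
    proof -
      have "1 / real (Suc (Suc j)) \<le> 1 / real (Suc j)" by (simp add: field_simps)
      then show ?thesis unfolding Os_def oscillation_set_def by (auto intro: less_le_trans) 
    qed
    then show "decseq (\<lambda>j. {\<omega>\<in>space N. v \<omega> \<in> Os j})" by (intro decseq_SucI) auto
  qed
  moreover have "(\<Inter>j. {\<omega>\<in>space N. v \<omega> \<in> Os j}) = {}"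
    using oscillation_set_vanishes[OF T0 F, of "r / 4"] r vC \<Phi>D unfolding Os_def by fastforce
  ultimately have "(\<lambda>j. measure N {\<omega>\<in>space N. v \<omega> \<in> Os j}) \<longlonglongrightarrow> 0" by simp
  then have "eventually (\<lambda>j. measure N {\<omega>\<in>space N. v \<omega> \<in> Os j} < r / (8 * K)) sequentially"
    using r K(1) by (intro order_tendstoD(2)) auto
  then obtain j where j: "measure N {\<omega>\<in>space N. v \<omega> \<in> Os j} < r / (8 * K)"
    unfolding eventually_sequentially by blast
  define d where "d = 1 / real (Suc j) / 2"
  have d: "0 < d" "d < 1 / real (Suc j)" by (simp_all add: d_def field_simps)
  define m where "m = Suc (nat \<lceil>T / d\<rceil>)"
  have m0: "0 < m" by (simp add: m_def)
  have "T / d < real m" unfolding m_def by linarith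
  then have m: "T / real m \<le> d" using d(1) m0 by (simp add: field_simps)
  let ?t = "\<lambda>i. T * real i / real m"
  have t: "?t i \<in> {0..T}" if "i \<in> {..m}" for i using that T m0 by (auto simp: field_simps)
  define A where "A n i = {\<omega>\<in>space (M n). d < \<bar>Y n \<omega> (?t i) - \<Phi> (w n \<omega>) (?t i)\<bar>}" for n i
  have A: "A n i \<in> sets (M n)" if "i \<in> {..m}" for n i
  proof -
    note [measurable] = Y[OF t[OF that], of n] measurable_compose[OF w \<Phi>[OF t[OF that]], of n]
    show ?thesis unfolding A_def by measurable
  qed
  have "(\<lambda>n. \<Sum>i\<in>{..m}. measure (M n) (A n i)) \<longlonglongrightarrow> (\<Sum>i\<in>{..m}. 0)"
    unfolding A_def by (intro tendsto_sum close t d(1))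
  then have "eventually (\<lambda>n. (\<Sum>i\<in>{..m}. measure (M n) (A n i)) < r / (8 * K)) sequentially"
    using r K(1) by (intro order_tendstoD(2)) auto
  then obtain n0 where n0: "\<And>n. n \<ge> n0 \<Longrightarrow> (\<Sum>i\<in>{..m}. measure (M n) (A n i)) < r / (8 * K)"
    unfolding eventually_sequentially by blast
  have lawF: "(\<integral>\<omega>. F (v \<omega>, \<Phi> (v \<omega>)) \<partial>N) = (\<integral>\<omega>. F (w n \<omega>, \<Phi> (w n \<omega>)) \<partial>M n)" for n
    using integral_distr[OF v F\<Phi>] integral_distr[OF w F\<Phi>, of n] law[of n] by simp
  show "\<exists>no. \<forall>n\<ge>no. norm ((\<integral>\<omega>. F (w n \<omega>, Y n \<omega>) \<partial>M n) - (\<integral>\<omega>. F (v \<omega>, \<Phi> (v \<omega>)) \<partial>N)) < r"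
  proof (intro exI[of _ n0] allI impI)
    fix n assume n: "n \<ge> n0"
    interpret Mn: prob_space "M n" by (rule P)
    let ?O = "{\<omega>\<in>space (M n). w n \<omega> \<in> Os j}" and ?A = "\<Union>i\<in>{..m}. A n i"
    have Om: "?O \<in> sets (M n)" using measurable_sets[OF w Os, of n j]
        by (simp add: vimage_def Int_def conj_commute)
    have Am: "?A \<in> sets (M n)" using A by auto
    have i1: "integrable (M n) (\<lambda>\<omega>. F (w n \<omega>, Y n \<omega>))"
      by (rule Mn.integrable_const_bound[of _ K]) (use K(2) wC YD FY in auto)
    have i2: "integrable (M n) (\<lambda>\<omega>. F (w n \<omega>, \<Phi> (w n \<omega>)))"
      by (rule Mn.integrable_const_bound[of _ K]) (use K(2) wC \<Phi>D FZ in auto)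
    have "norm ((\<integral>\<omega>. F (w n \<omega>, Y n \<omega>) \<partial>M n) - (\<integral>\<omega>. F (w n \<omega>, \<Phi> (w n \<omega>)) \<partial>M n)) =
       norm (\<integral>\<omega>. F (w n \<omega>, Y n \<omega>) - F (w n \<omega>, \<Phi> (w n \<omega>)) \<partial>M n)"
      using i1 i2 by simp
    also have "\<dots> \<le> (\<integral>\<omega>. norm (F (w n \<omega>, Y n \<omega>) - F (w n \<omega>, \<Phi> (w n \<omega>))) \<partial>M n)"
      by (rule integral_norm_bound)
    also have "\<dots> \<le> (\<integral>\<omega>. r / 4 + 2 * K * (indicator ?O \<omega> + indicator ?A \<omega>) \<partial>M n)"
    proof (rule integral_mono)
      fix \<omega> assume \<omega>: "\<omega> \<in> space (M n)"
      note p = wC[OF \<omega>] YD[OF \<omega>] \<Phi>D[OF wC[OF \<omega>]]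
      have b: "norm (F (w n \<omega>, Y n \<omega>) - F (w n \<omega>, \<Phi> (w n \<omega>))) \<le> 2 * K"
        using K(2)[OF p(1,2)] K(2)[OF p(1,3)] by (simp add: abs_if split: if_splits)
      have K0: "0 \<le> K" using K(1) by simp
      show "norm (F (w n \<omega>, Y n \<omega>) - F (w n \<omega>, \<Phi> (w n \<omega>))) \<le>
          r / 4 + 2 * K * (indicator ?O \<omega> + indicator ?A \<omega>)"
      proof (cases "\<omega> \<in> ?O \<or> \<omega> \<in> ?A")
        case True
        then have "(1::real) \<le> indicator ?O \<omega> + indicator ?A \<omega>" by (auto simp: indicator_def)
        then have "2 * K * 1 \<le> 2 * K * (indicator ?O \<omega> + indicator ?A \<omega>)" using K0
            by (intro mult_left_mono) auto
        then show ?thesis using b r by linarith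
      next
        case False
        have "levy_close T d (\<Phi> (w n \<omega>)) (Y n \<omega>)"
        proof (rule levy_close_grid[OF T p(3,2) m0 _ order_refl m])
          fix i assume "i \<le> m"
          then have "\<omega> \<notin> A n i" using False by blast
          then show "\<bar>\<Phi> (w n \<omega>) (?t i) - Y n \<omega> (?t i)\<bar> \<le> d"
            using \<omega> unfolding A_def by (simp add: abs_minus_commute not_less)
        qed
        moreover have "(w n \<omega>, \<Phi> (w n \<omega>)) \<notin> oscillation_set T F (r / 4) (1 / real (Suc j))"
          using False \<omega> p(1) unfolding Os_def by (auto simp: space_path_space)
        ultimately have "\<bar>F (w n \<omega>, Y n \<omega>) - F (w n \<omega>, \<Phi> (w n \<omega>))\<bar> \<le> r / 4"
          using p d(2) unfolding oscillation_set_def not_less[symmetric] by blast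
        moreover have "0 \<le> 2 * K * (indicator ?O \<omega> + indicator ?A \<omega>)" using K0 by simp
        ultimately show ?thesis by simp
      qed
    qed (use i1 i2 Om Am in \<open>auto simp: Mn.emeasure_eq_measure less_top[symmetric]\<close>)
    also have "\<dots> = r / 4 + 2 * K * (Mn.prob ?O + Mn.prob ?A)"
      using Om Am by (simp add: Mn.prob_space Mn.emeasure_eq_measure less_top[symmetric])
    also have "\<dots> \<le> r / 4 + 2 * K * (r / (8 * K) + r / (8 * K))"
    proof -
      have "Mn.prob ?A \<le> (\<Sum>i\<in>{..m}. Mn.prob (A n i))"
        by (rule Mn.finite_measure_subadditive_finite) (use A in auto)
      then have "Mn.prob ?O + Mn.prob ?A \<le> r / (8 * K) + r / (8 * K)"
        using n0[OF n] j lawO[of n j] by linarith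
      then show ?thesis using K(1) by (intro add_left_mono mult_left_mono) auto
    qed
    also have "\<dots> = 3 * r / 4" using K(1) by (simp add: field_simps)
    also have "\<dots> < r" using r by simp
    finally show "norm ((\<integral>\<omega>. F (w n \<omega>, Y n \<omega>) \<partial>M n) - (\<integral>\<omega>. F (v \<omega>, \<Phi> (v \<omega>)) \<partial>N)) < r"
      unfolding lawF[of n] .
  qed
qed

section \<open>Kernels, means and coefficients\<close>

lemma L1_loc_nonnegD:
  assumes "L1_loc_nonneg K"
  shows "\<And>t. 0 \<le> t \<Longrightarrow> 0 \<le> K t" "\<And>b. 0 \<le> b \<Longrightarrow> set_integrable lborel {0..b} K"
  using assms by (auto simp: L1_loc_nonneg_def)

definition kernel_mass :: "(real \<Rightarrow> real) \<Rightarrow> real \<Rightarrow> real" where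
  "kernel_mass K d = (LINT u:{0..d}|lborel. K u)"

lemma set_integrable_kernel_reflect:
  assumes K: "L1_loc_nonneg K" and t: "0 \<le> t"
  shows "set_integrable lborel {0..t} (\<lambda>s. K (t - s))"
    and "0 \<le> d \<Longrightarrow> d \<le> t \<Longrightarrow> (LINT s:{t-d..t}|lborel. K (t - s)) = kernel_mass K d"
proof -
  have eq: "indicator {0..d} (t + (-1) * s) = (indicator {t-d..t} s :: real)" for s d :: real
    by (auto simp: indicator_def)
  show "set_integrable lborel {0..t} (\<lambda>s. K (t - s))"
    using lborel_integrable_real_affine[OF L1_loc_nonnegD(2)[OF K t, unfolded set_integrable_def], of "-1" t]
        eq[of t]
    by (simp add: set_integrable_def)
  show "0 \<le> d \<Longrightarrow> d \<le> t \<Longrightarrow> (LINT s:{t-d..t}|lborel. K (t - s)) = kernel_mass K d"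
    using lborel_integral_real_affine[of "-1" "\<lambda>u. indicator {0..d} u *\<^sub>R K u" t] eq[of d]
    by (simp add: set_lebesgue_integral_def kernel_mass_def)
qed

lemma kernel_mass_mono:
  assumes K: "L1_loc_nonneg K" and d: "0 \<le> c" "c \<le> d"
  shows "kernel_mass K c \<le> kernel_mass K d" "0 \<le> kernel_mass K d"
proof -
  show "0 \<le> kernel_mass K d"
    unfolding kernel_mass_def set_lebesgue_integral_def
    by (rule integral_nonneg_AE) (use L1_loc_nonnegD(1)[OF K] in \<open>auto simp: indicator_def\<close>)
  show "kernel_mass K c \<le> kernel_mass K d"
    unfolding kernel_mass_def set_lebesgue_integral_def
  proof (rule integral_mono)
    show "integrable lborel (\<lambda>x. indicator {0..c} x *\<^sub>R K x)" "integrable lborel (\<lambda>x. indicator {0..d} x *\<^sub>R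
        K x)"
      using L1_loc_nonnegD(2)[OF K, unfolded set_integrable_def] d by auto
    show "indicator {0..c} x *\<^sub>R K x \<le> indicator {0..d} x *\<^sub>R K x" for x
      using L1_loc_nonnegD(1)[OF K, of x] d by (auto simp: indicator_def)
  qed
qed

definition clamp_time :: "real \<Rightarrow> real \<Rightarrow> real" where "clamp_time T s = max 0 (min T s)"

lemma clamp_time_in: "0 \<le> T \<Longrightarrow> clamp_time T s \<in> {0..T}"
  and clamp_time_eq: "s \<in> {0..T} \<Longrightarrow> clamp_time T s = s"
  by (auto simp: clamp_time_def)

lemma clamp_time_cont: "continuous_on UNIV (clamp_time T)"
  unfolding clamp_time_def by (intro continuous_intros)

lemma set_integrable_kernel_times:
  fixes \<phi> :: "real \<Rightarrow> real"
  assumes K: "L1_loc_nonneg K" and t: "0 \<le> t" "t \<le> T"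
    and \<phi>: "(\<lambda>s. \<phi> (clamp_time T s)) \<in> borel_measurable borel" and b: "\<And>s. s \<in> {0..T} \<Longrightarrow> \<bar>\<phi> s\<bar> \<le> B"
  shows "set_integrable lborel {0..t} (\<lambda>s. K (t - s) * \<phi> s)"
proof -
  have "integrable lborel (\<lambda>s. (indicator {0..t} s *\<^sub>R K (t - s)) * \<phi> (clamp_time T s))"
  proof (rule Bochner_Integration.integrable_bound)
    show i: "integrable lborel (\<lambda>s. (indicator {0..t} s *\<^sub>R K (t - s)) * B)"
      using set_integrable_kernel_reflect(1)[OF K t(1)] unfolding set_integrable_def
          by (intro integrable_mult_left) auto
    show "(\<lambda>s. (indicator {0..t} s *\<^sub>R K (t - s)) * \<phi> (clamp_time T s)) \<in> borel_measurable lborel"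
      using borel_measurable_integrable[OF set_integrable_kernel_reflect(1)[OF K t(1), unfolded
          set_integrable_def]] \<phi> by simp
    show "AE s in lborel. norm ((indicator {0..t} s *\<^sub>R K (t - s)) * \<phi> (clamp_time T s)) \<le>
        norm ((indicator {0..t} s *\<^sub>R K (t - s)) * B)"
      using b[OF clamp_time_in[of T]] t by (intro AE_I2) (auto simp: abs_mult intro!: mult_left_mono
          order_trans[OF _ abs_ge_self])
  qed
  moreover have "(\<lambda>s. (indicator {0..t} s *\<^sub>R K (t - s)) * \<phi> (clamp_time T s)) =
      (\<lambda>s. indicator {0..t} s *\<^sub>R (K (t - s) * \<phi> s))"
    using t by (auto simp: indicator_def clamp_time_eq)
  ultimately show ?thesis unfolding set_integrable_def by (simp only:)
qed

text \<open>
Lags up to \<open>d\<close> see values at least \<open>a\<close>; the longer lags see values at least \<open>- S\<close> and carry only the remaining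
mass.
\<close>

lemma kernel_convolution_lower:
  fixes \<phi> :: "real \<Rightarrow> real"
  assumes K: "L1_loc_nonneg K" and d: "0 \<le> d" "d \<le> t"
    and int: "set_integrable lborel {0..t} (\<lambda>s. K (t - s) * \<phi> s)"
    and near: "\<And>s. s \<in> {t-d..t} \<Longrightarrow> a \<le> \<phi> s" and far: "\<And>s. s \<in> {0..t} \<Longrightarrow> - S \<le> \<phi> s" and S: "0 \<le> S"
  shows "a * kernel_mass K d - S * (kernel_mass K t - kernel_mass K d) \<le>
      (LINT s:{0..t}|lborel. K (t - s) * \<phi> s)"
proof -
  have t: "0 \<le> t" using d by simp
  have k1: "integrable lborel (\<lambda>s. indicator {0..t} s *\<^sub>R K (t - s))"
    using set_integrable_kernel_reflect(1)[OF K t] by (simp add: set_integrable_def)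
  have "set_integrable lborel {t-d..t} (\<lambda>s. K (t - s))"
    by (rule set_integrable_subset[OF set_integrable_kernel_reflect(1)[OF K t]]) (use d in auto)
  then have k2: "integrable lborel (\<lambda>s. indicator {t-d..t} s *\<^sub>R K (t - s))"
    by (simp add: set_integrable_def)
  have m: "integral\<^sup>L lborel (\<lambda>s. indicator {0..t} s *\<^sub>R K (t - s)) = kernel_mass K t"
    "integral\<^sup>L lborel (\<lambda>s. indicator {t-d..t} s *\<^sub>R K (t - s)) = kernel_mass K d"
    using set_integrable_kernel_reflect(2)[OF K t, of t] set_integrable_kernel_reflect(2)[OF K t, of d] t d
    by (auto simp: set_lebesgue_integral_def)
  have "a * kernel_mass K d - S * (kernel_mass K t - kernel_mass K d) =
    integral\<^sup>L lborel (\<lambda>s. (a + S) * (indicator {t-d..t} s *\<^sub>R K (t - s)) -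
        S * (indicator {0..t} s *\<^sub>R K (t - s)))"
  proof -
    have "integral\<^sup>L lborel (\<lambda>s. (a + S) * (indicator {t-d..t} s *\<^sub>R K (t - s)) -
        S * (indicator {0..t} s *\<^sub>R K (t - s))) =
      (a + S) * integral\<^sup>L lborel (\<lambda>s. indicator {t-d..t} s *\<^sub>R K (t - s)) -
      S * integral\<^sup>L lborel (\<lambda>s. indicator {0..t} s *\<^sub>R K (t - s))"
      using k1 k2 by simp
    then show ?thesis unfolding m by (simp add: algebra_simps)
  qed
  also have "\<dots> \<le> integral\<^sup>L lborel (\<lambda>s. indicator {0..t} s *\<^sub>R (K (t - s) * \<phi> s))"
  proof (rule integral_mono)
    fix s
    show "(a + S) * (indicator {t-d..t} s *\<^sub>R K (t - s)) - S * (indicator {0..t} s *\<^sub>R K (t - s)) \<le>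
        indicator {0..t} s *\<^sub>R (K (t - s) * \<phi> s)"
    proof (cases "s \<in> {0..t}")
      case True
      have K0: "0 \<le> K (t - s)" using True L1_loc_nonnegD(1)[OF K] by simp
      show ?thesis
      proof (cases "s \<in> {t-d..t}")
        case T2: True
        show ?thesis using mult_left_mono[OF near[OF T2] K0] True T2 by (simp add: algebra_simps)
      next
        case False
        show ?thesis using mult_left_mono[OF far[OF True] K0] True False by (simp add: algebra_simps)
      qed
    qed (use d in auto)
  qed (use k1 k2 int in \<open>auto simp: set_integrable_def\<close>)
  finally show ?thesis by (simp add: set_lebesgue_integral_def)
qed

text \<open>
The process is the limit of its discretizations in time, each of which is a countable combination of random
variables.
\<close>

lemma measurable_path_process:
  fixes Z :: "real \<Rightarrow> 'a \<Rightarrow> real"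
  assumes T: "0 \<le> T" and Z: "\<And>t. t \<in> {0..T} \<Longrightarrow> Z t \<in> borel_measurable M"
    and cont: "\<And>\<omega>. \<omega> \<in> space M \<Longrightarrow> continuous_on {0..T} (\<lambda>t. Z t \<omega>)"
  shows "(\<lambda>(s, \<omega>). Z (clamp_time T s) \<omega>) \<in> borel_measurable (lborel \<Otimes>\<^sub>M M)"
proof (rule borel_measurable_LIMSEQ_metric)
  let ?r = "\<lambda>m s. real_of_int \<lfloor>s * real (Suc m)\<rfloor> / real (Suc m)"
  show "(\<lambda>(s, \<omega>). Z (clamp_time T (?r m s)) \<omega>) \<in> borel_measurable (lborel \<Otimes>\<^sub>M M)" for m
  proof -
    have 1: "(\<lambda>p. Z (clamp_time T (real_of_int i / real (Suc m))) (snd p)) \<in> borel_measurable (lborel \<Otimes>\<^sub>M M)"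
        for i
      by (rule measurable_compose[OF measurable_snd Z[OF clamp_time_in[OF T]]])
    have 2: "(\<lambda>p. \<lfloor>fst p * real (Suc m)\<rfloor>) \<in> measurable (lborel \<Otimes>\<^sub>M M) (count_space UNIV)"
      by measurable
    show ?thesis
      using measurable_compose_countable[OF 1 2] by (simp add: split_beta')
  qed
  fix p :: "real \<times> 'a" assume "p \<in> space (lborel \<Otimes>\<^sub>M M)"
  then obtain s :: real and \<omega> where p: "p = (s, \<omega>)" and \<omega>: "\<omega> \<in> space M" by (auto simp: space_pair_measure)
  have "(\<lambda>m. ?r m s) \<longlonglongrightarrow> s"
  proof (rule tendsto_sandwich)
    have gen: "s - 1 / k \<le> fl / k \<and> fl / k \<le> s" if "0 < k" "s * k - 1 \<le> fl" "fl \<le> s * k" for k fl :: real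
      using that divide_right_mono[OF that(2), of k] divide_right_mono[OF that(3), of k]
      by (simp add: diff_divide_distrib)
    have r: "s - 1 / real (Suc m) \<le> ?r m s \<and> ?r m s \<le> s" for m
    proof (rule gen)
      show "s * real (Suc m) - 1 \<le> real_of_int \<lfloor>s * real (Suc m)\<rfloor>" "real_of_int \<lfloor>s * real (Suc m)\<rfloor> \<le>
          s * real (Suc m)"
        by linarith+
    qed simp
    show "\<forall>\<^sub>F m in sequentially. s - 1 / real (Suc m) \<le> ?r m s" "\<forall>\<^sub>F m in sequentially. ?r m s \<le> s"
      by (simp_all only: r[THEN conjunct1] r[THEN conjunct2] eventually_True)
    show "(\<lambda>m. s - 1 / real (Suc m)) \<longlonglongrightarrow> s"
      using tendsto_diff[OF tendsto_const LIMSEQ_Suc[OF lim_1_over_n], of s] by simp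
  qed simp
  then have "(\<lambda>m. clamp_time T (?r m s)) \<longlonglongrightarrow> clamp_time T s"
    using clamp_time_cont[of T] by (intro isCont_tendsto_compose[where g="clamp_time T"]) (auto simp:
        continuous_on_eq_continuous_at)
  then have "(\<lambda>m. Z (clamp_time T (?r m s)) \<omega>) \<longlonglongrightarrow> Z (clamp_time T s) \<omega>"
    by (rule continuous_on_tendsto_compose[OF cont[OF \<omega>]]) (use clamp_time_in[OF T] in auto)
  then show "(\<lambda>m. (\<lambda>(s, \<omega>). Z (clamp_time T (?r m s)) \<omega>) p) \<longlonglongrightarrow> (\<lambda>(s, \<omega>). Z (clamp_time T s) \<omega>) p"
    by (simp add: p)
qed

text \<open>
Conditional expectation is a contraction of \<open>L\<^sup>1\<close> and preserves the mean.
\<close>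

lemma martingale_abs_expectation_le:
  assumes M: "prob_space M" and F: "subalgebra M F" and Z: "integrable M Z" and Y: "integrable M Y"
    and c: "AE \<omega> in M. real_cond_exp M F Z \<omega> = Y \<omega>"
  shows "(\<integral>\<omega>. \<bar>Y \<omega>\<bar> \<partial>M) \<le> (\<integral>\<omega>. \<bar>Z \<omega>\<bar> \<partial>M)" "(\<integral>\<omega>. Y \<omega> \<partial>M) = (\<integral>\<omega>. Z \<omega> \<partial>M)"
proof -
  interpret prob_space M by fact
  interpret finite_measure_subalgebra M F by unfold_locales (rule F)
  have Zm: "Z \<in> borel_measurable M" using Z by simp
  have "ennreal (\<integral>\<omega>. \<bar>Y \<omega>\<bar> \<partial>M) = (\<integral>\<^sup>+\<omega>. ennreal \<bar>Y \<omega>\<bar> \<partial>M)"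
    by (rule nn_integral_eq_integral[symmetric]) (use Y in auto)
  also have "\<dots> \<le> (\<integral>\<^sup>+\<omega>. nn_cond_exp M F (\<lambda>x. ennreal \<bar>Z x\<bar>) \<omega> \<partial>M)"
    by (rule nn_integral_mono_AE) (use c real_cond_exp_abs[OF Zm] in eventually_elim, simp)
  also have "\<dots> = (\<integral>\<^sup>+\<omega>. ennreal \<bar>Z \<omega>\<bar> \<partial>M)"
    using nn_cond_exp_intg[of "\<lambda>_. 1" "\<lambda>x. ennreal \<bar>Z x\<bar>"] Zm by simp
  also have "\<dots> = ennreal (\<integral>\<omega>. \<bar>Z \<omega>\<bar> \<partial>M)"
    by (rule nn_integral_eq_integral) (use Z in auto)
  finally show "(\<integral>\<omega>. \<bar>Y \<omega>\<bar> \<partial>M) \<le> (\<integral>\<omega>. \<bar>Z \<omega>\<bar> \<partial>M)" by (simp add: ennreal_le_iff)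
  have "(\<integral>\<omega>. Y \<omega> \<partial>M) = (\<integral>\<omega>. real_cond_exp M F Z \<omega> \<partial>M)"
    by (rule integral_cong_AE) (use c Y in auto)
  then show "(\<integral>\<omega>. Y \<omega> \<partial>M) = (\<integral>\<omega>. Z \<omega> \<partial>M)" using real_cond_exp_int(2)[OF Z] by simp
qed

lemma subalgebra_natural_filtration:
  assumes "\<And>s. s \<in> I \<Longrightarrow> Y s \<in> borel_measurable M"
  shows "subalgebra M (natural_filtration M I Y t)"
proof -
  let ?A = "\<Union>s\<in>{s \<in> I. s \<le> t}. {Y s -` A \<inter> space M | A. A \<in> sets borel}"
  have "?A \<subseteq> sets M" using assms measurable_sets by blast
  moreover from this have "?A \<subseteq> Pow (space M)" using sets.space_closed by blast
  ultimately show ?thesis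
    unfolding subalgebra_def natural_filtration_def
    by (simp add: space_measure_of sets_measure_of sets.sigma_sets_subset)
qed

lemma locally_uniform_limitD:
  assumes f: "locally_uniform_limit fn f" and x: "0 \<le> x" and e: "0 < e"
  shows "\<exists>d>0. \<exists>N. \<forall>n\<ge>N. \<forall>s\<ge>0. \<forall>r\<ge>0. \<bar>s - x\<bar> \<le> d \<longrightarrow> \<bar>r - x\<bar> \<le> d \<longrightarrow> \<bar>fn n s - f r\<bar> < e"
proof -
  let ?S = "\<lambda>d. ({x - d..x + d} \<inter> {0..}) \<times> ({x - d..x + d} \<inter> {0..})"
  let ?q = "\<lambda>d n. SUP (s, r) \<in> ?S d. ereal \<bar>fn n s - f r\<bar>"
  have "((\<lambda>d. limsup (?q d)) \<longlongrightarrow> 0) (at_right 0)"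
    using f x by (simp add: locally_uniform_limit_def)
  then have "eventually (\<lambda>d. limsup (?q d) < ereal e) (at_right 0)"
    using e by (intro order_tendstoD(2)) auto
  then obtain b where b: "0 < b" "\<And>d. 0 < d \<Longrightarrow> d < b \<Longrightarrow> limsup (?q d) < ereal e"
    unfolding eventually_at_right_field by blast
  define d where "d = b / 2"
  have d: "0 < d" "limsup (?q d) < ereal e" using b by (auto simp: d_def)
  have "eventually (\<lambda>n. ?q d n < ereal e) sequentially" by (rule Limsup_lessD[OF d(2)])
  then obtain N where N: "\<And>n. n \<ge> N \<Longrightarrow> ?q d n < ereal e" unfolding eventually_sequentially by blast
  have "\<bar>fn n s - f r\<bar> < e" if "n \<ge> N" "0 \<le> s" "0 \<le> r" "\<bar>s - x\<bar> \<le> d" "\<bar>r - x\<bar> \<le> d" for n s r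
  proof -
    have "(s, r) \<in> ?S d" using that by (auto simp: abs_le_iff)
    then have "(case (s, r) of (s, r) \<Rightarrow> ereal \<bar>fn n s - f r\<bar>) \<le> ?q d n" by (rule SUP_upper)
    also have "\<dots> < ereal e" by (rule N[OF that(1)])
    finally show ?thesis by simp
  qed
  then show ?thesis using d(1) by blast
qed

text \<open>
Cover the compact interval by finitely many of the neighbourhoods of \<open>locally_uniform_limitD\<close>.
\<close>

lemma locally_uniform_limit_uniform:
  assumes f: "locally_uniform_limit fn f" and e: "0 < e"
  shows "\<exists>N. \<forall>n\<ge>N. \<forall>x\<in>{0..R}. \<bar>fn n x - f x\<bar> < e"
proof -
  have "\<exists>d N. 0 < d \<and> (\<forall>n\<ge>N. \<forall>s\<ge>0. \<bar>s - x\<bar> \<le> d \<longrightarrow> \<bar>fn n s - f s\<bar> < e)" if "x \<in> {0..R}" for x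
    using locally_uniform_limitD[OF f _ e, of x] that by (auto, meson)
  then obtain d N where dN: "\<And>x. x \<in> {0..R} \<Longrightarrow> 0 < d x"
    "\<And>x n s. x \<in> {0..R} \<Longrightarrow> n \<ge> N x \<Longrightarrow> 0 \<le> s \<Longrightarrow> \<bar>s - x\<bar> \<le> d x \<Longrightarrow> \<bar>fn n s - f s\<bar> < e"
    by metis
  obtain D where D: "D \<subseteq> {0..R}" "finite D" "{0..R} \<subseteq> (\<Union>x\<in>D. ball x (d x))"
    by (rule compactE_image[of "{0..R}" "{0..R}" "\<lambda>x. ball x (d x)"]) (use dN(1) in auto)
  show ?thesis
  proof (intro exI[of _ "Max (insert 0 (N ` D))"] allI impI ballI)
    fix n x assume n: "Max (insert 0 (N ` D)) \<le> n" and x: "x \<in> {0..R}"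
    obtain y where y: "y \<in> D" "x \<in> ball y (d y)" using D(3) x by blast
    have "N y \<le> n" using n y(1) D(2) by auto
    then show "\<bar>fn n x - f x\<bar> < e"
      using dN(2)[of y n x] y D(1) x by (auto simp: dist_real_def abs_minus_commute)
  qed
qed

lemma locally_uniform_limit_pointwise:
  assumes "locally_uniform_limit fn f" "0 \<le> x"
  shows "(\<lambda>n. fn n x) \<longlonglongrightarrow> f x"
proof (rule LIMSEQ_I)
  fix r :: real assume "0 < r"
  from locally_uniform_limit_uniform[OF assms(1) this, of x]
  obtain N where "\<forall>n\<ge>N. \<forall>y\<in>{0..x}. \<bar>fn n y - f y\<bar> < r" by blast
  then have "\<forall>n\<ge>N. norm (fn n x - f x) < r" using assms(2) by simp
  then show "\<exists>no. \<forall>n\<ge>no. norm (fn n x - f x) < r" by blast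
qed

lemma locally_uniform_limit_continuous:
  assumes f: "locally_uniform_limit fn f"
  shows "continuous_on {0..} f"
  unfolding continuous_on_iff
proof (intro ballI allI impI)
  fix x e :: real assume x: "x \<in> {0..}" and e: "0 < e"
  have "0 \<le> x" "0 < e / 2" using x e by auto
  from locally_uniform_limitD[OF f this]
  obtain d N where d: "d > 0" and dN: "\<forall>n\<ge>N. \<forall>s\<ge>0. \<forall>r\<ge>0. \<bar>s - x\<bar> \<le> d \<longrightarrow> \<bar>r - x\<bar> \<le> d \<longrightarrow> \<bar>fn n s - f r\<bar> < e / 2"
    by blast
  show "\<exists>d>0. \<forall>r\<in>{0..}. dist r x < d \<longrightarrow> dist (f r) (f x) < e"
  proof (intro exI[of _ d] conjI ballI impI d)
    fix r :: real assume r: "r \<in> {0..}" "dist r x < d"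
    have "\<bar>fn N x - f r\<bar> < e / 2" "\<bar>fn N x - f x\<bar> < e / 2"
      using dN[rule_format, of N x r] dN[rule_format, of N x x] r x d by (auto simp: dist_real_def)
    then show "dist (f r) (f x) < e" unfolding dist_real_def
        by (simp add: abs_if field_simps split: if_splits)
  qed
qed

lemma kernel_measure_integral:
  assumes K: "L1_loc_nonneg K" and T: "0 \<le> T" and F: "continuous_on {0..T} F"
  shows "(\<integral>x. F x \<partial>kernel_measure T K) = (LINT u:{0..T}|lborel. K u * F u :: real)"
    "set_integrable lborel {0..T} (\<lambda>u. K u * F u)"
proof -
  have S: "{0..T} \<inter> space lborel \<in> sets lborel" by simp
  have Km: "K \<in> borel_measurable (restrict_space lborel {0..T})"
    using borel_measurable_integrable[OF L1_loc_nonnegD(2)[OF K T, unfolded set_integrable_def]]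
    by (subst borel_measurable_restrict_space_iff[OF S]) (simp add: mult.commute)
  have Fm: "F \<in> borel_measurable (restrict_space lborel {0..T})"
    using borel_measurable_continuous_on_restrict[OF F]
        by (simp cong: measurable_cong_sets add: sets_restrict_space)
  have Kn: "AE u in restrict_space lborel {0..T}. 0 \<le> K u"
    by (rule AE_I2) (use L1_loc_nonnegD(1)[OF K] in \<open>auto simp: space_restrict_space\<close>)
  have "(\<integral>x. F x \<partial>kernel_measure T K) = (\<integral>u. K u *\<^sub>R F u \<partial>restrict_space lborel {0..T})"
    unfolding kernel_measure_def by (rule integral_density[OF Fm Km Kn])
  also have "\<dots> = (LINT u:{0..T}|lborel. K u * F u)"
    by (subst integral_restrict_space[OF S]) (simp add: set_lebesgue_integral_def)
  finally show "(\<integral>x. F x \<partial>kernel_measure T K) = (LINT u:{0..T}|lborel. K u * F u :: real)" .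
  have "bounded (F ` {0..T})" by (intro compact_imp_bounded compact_continuous_image F) auto
  then obtain B where B: "\<forall>y\<in>F ` {0..T}. norm y \<le> B" unfolding bounded_iff by blast
  have m: "(\<lambda>u. indicator {0..T} u *\<^sub>R (K u * F u)) \<in> borel_measurable lborel"
    using borel_measurable_times[OF Km Fm] by (subst (asm) borel_measurable_restrict_space_iff[OF S]) (simp
        add: mult_ac)
  have "integrable lborel (\<lambda>u. B * (indicator {0..T} u *\<^sub>R K u))"
    using L1_loc_nonnegD(2)[OF K T] by (simp add: set_integrable_def)
  then show "set_integrable lborel {0..T} (\<lambda>u. K u * F u)"
    unfolding set_integrable_def
  proof (rule Bochner_Integration.integrable_bound[OF _ m], intro AE_I2)
    fix u show "norm (indicator {0..T} u *\<^sub>R (K u * F u)) \<le> norm (B * (indicator {0..T} u *\<^sub>R K u))"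
    proof (cases "u \<in> {0..T}")
      case True
      then have "\<bar>F u\<bar> \<le> B" using B by simp
      then have "\<bar>F u\<bar> \<le> \<bar>B\<bar>" by linarith
      then have "K u * \<bar>F u\<bar> \<le> K u * \<bar>B\<bar>"
        using True L1_loc_nonnegD(1)[OF K, of u] by (intro mult_left_mono) auto
      then show ?thesis using True L1_loc_nonnegD(1)[OF K, of u]
        by (simp add: abs_mult mult.commute[of "\<bar>B\<bar>"])
    qed simp
  qed
qed

text \<open>
Test the weak convergence with the constant \<open>1\<close>, and with the hat function \<open>max 0 (1 - u / d)\<close>, which is below
the indicator of \<open>[0, d]\<close> and has value \<open>1\<close> at \<open>0\<close>.
\<close>

lemma kernel_mass_tendsto:
  assumes T: "0 < T" and K: "\<And>n. L1_loc_nonneg (K n)"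
    and conv: "weak_convergence (top_of_set {0..T}) (\<lambda>n. kernel_measure T (K n)) (dirac_zero T)"
    and d: "0 < d" "d \<le> T"
  shows "(\<lambda>n. kernel_mass (K n) d) \<longlonglongrightarrow> 1"
proof -
  have T0: "0 \<le> T" using T by simp
  have lim: "(\<lambda>n. LINT u:{0..T}|lborel. K n u * F u) \<longlonglongrightarrow> F 0" if F: "continuous_on {0..T} F"
      for F :: "real \<Rightarrow> real"
  proof -
    have "continuous_map (top_of_set {0..T}) euclideanreal F" using F by simp
    moreover have "bounded (F ` topspace (top_of_set {0..T}))"
      using F by (simp add: compact_imp_bounded compact_continuous_image)
    ultimately have "(\<lambda>n. \<integral>x. F x \<partial>kernel_measure T (K n)) \<longlonglongrightarrow> (\<integral>x. F x \<partial>dirac_zero T)"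
      using conv unfolding weak_convergence_def by blast
    moreover have "(\<integral>x. F x \<partial>dirac_zero T) = F 0"
      unfolding dirac_zero_def
      by (rule integral_return) (use T in \<open>auto simp: space_restrict_space
          borel_measurable_continuous_on_restrict[OF F]\<close>)
    ultimately show ?thesis by (simp add: kernel_measure_integral(1)[OF K T0 F])
  qed
  have T1: "(\<lambda>n. kernel_mass (K n) T) \<longlonglongrightarrow> 1"
    using lim[of "\<lambda>_. 1"] by (simp add: kernel_mass_def)
  define F where "F u = max 0 (1 - u / d)" for u :: real
  have F: "continuous_on {0..T} F" unfolding F_def using d(1) by (intro continuous_intros) auto
  have F0: "(\<lambda>n. LINT u:{0..T}|lborel. K n u * F u) \<longlonglongrightarrow> 1" using lim[OF F] by (simp add: F_def)
  have le: "(LINT u:{0..T}|lborel. K n u * F u) \<le> kernel_mass (K n) d" for n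
    unfolding kernel_mass_def set_lebesgue_integral_def
  proof (rule integral_mono)
    show "integrable lborel (\<lambda>u. indicator {0..T} u *\<^sub>R (K n u * F u))"
      using kernel_measure_integral(2)[OF K T0 F] by (simp add: set_integrable_def)
    show "integrable lborel (\<lambda>u. indicator {0..d} u *\<^sub>R K n u)"
      using L1_loc_nonnegD(2)[OF K, of d] d by (simp add: set_integrable_def)
    fix u
    have "F u \<le> 1" "0 \<le> F u" if "0 \<le> u" using that d by (auto simp: F_def)
    moreover have "F u = 0" if "d < u" using that d by (auto simp: F_def max_def field_simps)
    ultimately show "indicator {0..T} u *\<^sub>R (K n u * F u) \<le> indicator {0..d} u *\<^sub>R K n u"
      using L1_loc_nonnegD(1)[OF K, of u] d by (auto simp: indicator_def mult_left_le)
  qed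
  show ?thesis
    by (rule tendsto_sandwich[OF _ _ F0 T1])
      (use le kernel_mass_mono(1)[OF K, of d T] d in auto)
qed

section \<open>Uniform control of continuous paths\<close>

text \<open>
Paths that leave the range \<open>[-k, k]\<close> before \<open>U\<close>, or that vary by more than \<open>c\<close> over a time less than
\<open>1 / (k + 1)\<close>. These sets are open and decrease to the empty set, so a single law gives them small probability.
\<close>

definition wild_paths :: "real \<Rightarrow> real \<Rightarrow> nat \<Rightarrow> (real \<Rightarrow> real) set" where
  "wild_paths U c k = {w\<in>C_paths. (\<exists>u\<in>{0..U}. real k < \<bar>w u\<bar>) \<or>
     (\<exists>u\<in>{0..U}. \<exists>v\<in>{0..U}. \<bar>u - v\<bar> < 1 / real (Suc k) \<and> c < \<bar>w u - w v\<bar>)}"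

lemma wild_paths_open: "path_open T (wild_paths U c k \<times> D_up_paths T)"
  unfolding path_open_def
proof (intro conjI allI impI)
  show "wild_paths U c k \<times> D_up_paths T \<subseteq> C_paths \<times> D_up_paths T" by (auto simp: wild_paths_def)
  fix w and x :: "real \<Rightarrow> real" assume "(w, x) \<in> wild_paths U c k \<times> D_up_paths T"
  then have w: "w \<in> wild_paths U c k" by simp
  have "\<exists>e>0. \<forall>\<psi>\<in>C_paths. (\<forall>t\<in>{0..U}. \<bar>\<psi> t - w t\<bar> < e) \<longrightarrow> \<psi> \<in> wild_paths U c k"
  proof (cases "\<exists>u\<in>{0..U}. real k < \<bar>w u\<bar>")
    case True
    then obtain u where u: "u \<in> {0..U}" "real k < \<bar>w u\<bar>" by blast
    show ?thesis
    proof (intro exI[of _ "\<bar>w u\<bar> - real k"] conjI ballI impI)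
      fix \<psi> assume \<psi>: "\<psi> \<in> C_paths" "\<forall>t\<in>{0..U}. \<bar>\<psi> t - w t\<bar> < \<bar>w u\<bar> - real k"
      have "real k < \<bar>\<psi> u\<bar>" using \<psi>(2)[rule_format, OF u(1)] by linarith
      then show "\<psi> \<in> wild_paths U c k" unfolding wild_paths_def using \<psi>(1) u(1) by blast
    qed (use u in simp)
  next
    case False
    then obtain u v where u: "u \<in> {0..U}" "v \<in> {0..U}" "\<bar>u - v\<bar> < 1 / real (Suc k)" "c < \<bar>w u - w v\<bar>"
      using w unfolding wild_paths_def by blast
    define e where "e = (\<bar>w u - w v\<bar> - c) / 2"
    have e: "\<bar>w u - w v\<bar> = c + 2 * e" by (simp add: e_def field_simps)
    show ?thesis
    proof (intro exI[of _ e] conjI ballI impI)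
      fix \<psi> assume \<psi>: "\<psi> \<in> C_paths" "\<forall>t\<in>{0..U}. \<bar>\<psi> t - w t\<bar> < e"
      have "c < \<bar>\<psi> u - \<psi> v\<bar>" using \<psi>(2)[rule_format, OF u(1)] \<psi>(2)[rule_format, OF u(2)] e by linarith
      then show "\<psi> \<in> wild_paths U c k" unfolding wild_paths_def using \<psi>(1) u(1-3) by blast
    qed (use u(4) in \<open>simp add: e_def\<close>)
  qed
  then show "\<exists>b. \<exists>e>0. \<forall>\<psi>\<in>C_paths. \<forall>y\<in>D_up_paths T. (\<forall>t\<in>{0..b}. \<bar>\<psi> t - w t\<bar> < e) \<longrightarrow>
      levy_close T e x y \<longrightarrow> (\<psi>, y) \<in> wild_paths U c k \<times> D_up_paths T"
    by blast
qed

text \<open>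
The left limits required of a path come for free from monotonicity, as suprema.
\<close>

lemma D_up_pathsI:
  fixes x :: "real \<Rightarrow> real"
  assumes mono: "\<And>s t. 0 \<le> s \<Longrightarrow> s \<le> t \<Longrightarrow> t \<le> T \<Longrightarrow> x s \<le> x t"
    and nonneg: "\<And>t. t \<in> {0..T} \<Longrightarrow> 0 \<le> x t"
    and right: "\<And>t. 0 \<le> t \<Longrightarrow> t < T \<Longrightarrow> (x \<longlongrightarrow> x t) (at_right t)"
  shows "restrict x {0..T} \<in> D_up_paths T"
proof -
  let ?x = "restrict x {0..T}"
  have "continuous (at_right t) ?x" if t: "t \<in> {0..<T}" for t
  proof -
    have "eventually (\<lambda>s. x s = ?x s) (at_right t)"
      using eventually_at_right_real[of t T] t by (auto elim!: eventually_mono)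
    moreover have "(x \<longlongrightarrow> ?x t) (at_right t)" using right[of t] t by simp
    ultimately show ?thesis unfolding continuous_within by (rule Lim_transform_eventually[rotated])
  qed
  moreover have "\<exists>l. (?x \<longlongrightarrow> l) (at_left t)" if t: "t \<in> {0<..T}" for t
  proof -
    (* monotone paths approach the supremum of their earlier values *)
    define l where "l = Sup (x ` {0..<t})"
    have bdd: "bdd_above (x ` {0..<t})" by (rule bdd_aboveI[of _ "x t"]) (use mono t in auto)
    have ev: "eventually (\<lambda>s. s0 < s \<and> s < t) (at_left t)" if "s0 < t" for s0
      using that eventually_at_left_real[of s0 t] by simp
    have "(?x \<longlongrightarrow> l) (at_left t)"
    proof (rule order_tendstoI)
      fix a assume "a < l"
      then obtain s0 where s0: "0 \<le> s0" "s0 < t" "a < x s0"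
        unfolding l_def using less_cSup_iff[OF _ bdd, of a] t by auto
      show "eventually (\<lambda>s. a < ?x s) (at_left t)"
        using ev[OF s0(2)]
      proof eventually_elim
        case (elim s) then show ?case using mono[of s0 s] s0 t by auto
      qed
    next
      fix a assume "l < a"
      have "0 < t" using t by simp
      from ev[OF this] show "eventually (\<lambda>s. ?x s < a) (at_left t)"
      proof eventually_elim
        case (elim s)
        then have "x s \<le> l" unfolding l_def by (intro cSup_upper bdd) auto
        then show ?case using elim t \<open>l < a\<close> by auto
      qed
    qed
    then show ?thesis by blast
  qed
  ultimately show ?thesis
    unfolding D_up_paths_def D_paths_def using nonneg mono by (auto simp: mono_on_def)
qed

lemma zero_D_up: "restrict (\<lambda>_. 0) {0..T} \<in> D_up_paths T"
  by (rule D_up_pathsI) auto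

lemma wild_paths_measurable:
  "wild_paths U c k \<in> sets path_space"
proof -
  have "{w\<in>space path_space. (w, restrict (\<lambda>_. 0) {0..1::real}) \<in> wild_paths U c k \<times> D_up_paths 1} \<in> sets
      path_space"
    by (rule path_open_measurable[OF _ wild_paths_open]) (use zero_D_up[of 1] in auto)
  moreover have "{w\<in>space path_space. (w, restrict (\<lambda>_. 0) {0..1::real}) \<in> wild_paths U c k \<times> D_up_paths 1} =
      wild_paths U c k"
    unfolding space_path_space using zero_D_up[of 1] by (auto simp: wild_paths_def)
  ultimately show ?thesis by simp
qed

lemma wild_paths_decreasing: "j \<le> k \<Longrightarrow> wild_paths U c k \<subseteq> wild_paths U c j"
proof
  fix w assume jk: "j \<le> k" and w: "w \<in> wild_paths U c k"
  have 1: "1 / real (Suc k) \<le> 1 / real (Suc j)" using jk by (simp add: field_simps)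
  have 2: "real j \<le> real k" using jk by simp
  show "w \<in> wild_paths U c j"
    using w unfolding wild_paths_def mem_Collect_eq by (meson 1 2 le_less_trans less_le_trans)
qed

lemma wild_paths_vanish:
  assumes w: "w \<in> C_paths" and c: "0 < c"
  shows "\<exists>k. w \<notin> wild_paths U c k"
proof -
  have cont: "continuous_on {0..U} w" using w by (rule_tac continuous_on_subset[of "{0..}"]) (auto simp:
      C_paths_def)
  have "bounded (w ` {0..U})" by (intro compact_imp_bounded compact_continuous_image cont) auto
  then obtain B where B: "\<forall>y\<in>w ` {0..U}. norm y \<le> B" unfolding bounded_iff by blast
  have "uniformly_continuous_on {0..U} w" by (rule compact_uniformly_continuous[OF cont]) simp
  then obtain d where d: "d > 0" "\<forall>u\<in>{0..U}. \<forall>v\<in>{0..U}. dist v u < d \<longrightarrow> dist (w v) (w u) < c"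
    using c unfolding uniformly_continuous_on_def by blast
  obtain n1 where n1: "1 / real (Suc n1) < d" using d(1) nat_approx_posE by blast
  define k where "k = max n1 (nat \<lceil>B\<rceil>)"
  have kB: "B \<le> real k" unfolding k_def by linarith
  have "1 / real (Suc k) \<le> 1 / real (Suc n1)" by (simp add: k_def field_simps)
  then have kd: "1 / real (Suc k) < d" using n1 by linarith
  have "\<not> real k < \<bar>w u\<bar>" if "u \<in> {0..U}" for u
  proof -
    have "\<bar>w u\<bar> \<le> B" using B that by simp
    then show ?thesis using kB by linarith
  qed
  moreover have "\<not> (\<bar>u - v\<bar> < 1 / real (Suc k) \<and> c < \<bar>w u - w v\<bar>)" if "u \<in> {0..U}" "v \<in> {0..U}" for u v
    using d(2)[rule_format, of v u] that kd unfolding dist_real_def by linarith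
  ultimately show ?thesis unfolding wild_paths_def by blast
qed

section \<open>A single Volterra equation\<close>

locale volterra_solution =
  fixes T :: real and G0 K f :: "real \<Rightarrow> real" and lam nu :: real
    and M :: "'a measure" and W X :: "real \<Rightarrow> 'a \<Rightarrow> real"
  assumes T: "0 < T" and lam: "0 \<le> lam" and nu: "0 \<le> nu"
    and f: "admissible_time_change f" and K: "L1_loc_nonneg K"
    and G0: "mono_on {0..} G0 \<and> G0 0 = 0 \<and> (\<forall>t\<ge>0. 0 \<le> G0 t)"
    and sol: "weak_solution T G0 K f lam nu M W X"
begin

definition Y :: "real \<Rightarrow> 'a \<Rightarrow> real" where "Y t \<omega> = W (f (X t \<omega>)) \<omega>"

lemma brownian: "\<exists>G. brownian_motion M G W"
  using sol by (auto simp: weak_solution_def)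

sublocale prob_space M
  using brownian brownian_motionD(1) by blast

lemma X_measurable: "t \<in> {0..T} \<Longrightarrow> X t \<in> borel_measurable M"
  using sol by (auto simp: weak_solution_def)

lemma X_path:
  assumes "\<omega> \<in> space M"
  shows "X 0 \<omega> = 0" "mono_on {0..T} (\<lambda>t. X t \<omega>)" "continuous_on {0..T} (\<lambda>t. X t \<omega>)"
  using sol assms by (auto simp: weak_solution_def)

lemma X_mono: "\<omega> \<in> space M \<Longrightarrow> 0 \<le> s \<Longrightarrow> s \<le> t \<Longrightarrow> t \<le> T \<Longrightarrow> X s \<omega> \<le> X t \<omega>"
  using X_path(2) by (auto simp: mono_on_def)

lemma X_nonneg: "\<omega> \<in> space M \<Longrightarrow> t \<in> {0..T} \<Longrightarrow> 0 \<le> X t \<omega>"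
  using X_mono[of \<omega> 0 t] X_path(1)[of \<omega>] by simp

lemma f_props:
  shows f_nonneg: "0 \<le> x \<Longrightarrow> 0 \<le> f x" and f_mono: "mono_on {0..} f" and f_0: "f 0 = 0"
    and f_cont: "continuous_on {0..} f"
proof -
  obtain f' where "\<forall>x\<ge>0. (f has_real_derivative f' x) (at x within {0..})"
    using f by (auto simp: admissible_time_change_def)
  then show "continuous_on {0..} f" by (intro DERIV_continuous_on) auto
qed (use f in \<open>auto simp: admissible_time_change_def\<close>)

lemma W_path: "\<omega> \<in> space M \<Longrightarrow> continuous_on {0..} (\<lambda>t. W t \<omega>)"
  using brownian by (elim exE) (rule brownian_motionD(7))

lemma Y_path: "\<omega> \<in> space M \<Longrightarrow> continuous_on {0..T} (\<lambda>t. Y t \<omega>)"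
  unfolding Y_def
  by (rule continuous_on_compose2[OF W_path continuous_on_compose2[OF f_cont X_path(3)]])
    (auto intro: f_nonneg X_nonneg)

lemma Y_martingale: "martingale_on M (natural_filtration M {0..T} Y) {0..T} Y"
  using sol by (auto simp: weak_solution_def Y_def[abs_def] Let_def)

lemma Y_integrable: "t \<in> {0..T} \<Longrightarrow> integrable M (Y t)"
  using Y_martingale by (auto simp: martingale_on_def)

lemma Y_expectation:
  assumes t: "t \<in> {0..T}"
  shows "(\<integral>\<omega>. \<bar>Y t \<omega>\<bar> \<partial>M) \<le> (\<integral>\<omega>. \<bar>Y T \<omega>\<bar> \<partial>M)" "(\<integral>\<omega>. Y t \<omega> \<partial>M) = 0"
proof -
  have sub: "subalgebra M (natural_filtration M {0..T} Y s)" for s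
    by (rule subalgebra_natural_filtration) (use Y_integrable in auto)
  have c: "AE \<omega> in M. real_cond_exp M (natural_filtration M {0..T} Y s) (Y u) \<omega> = Y s \<omega>"
    if "s \<in> {0..T}" "u \<in> {0..T}" "s \<le> u" for s u
    using Y_martingale that by (auto simp: martingale_on_def)
  have T': "T \<in> {0..T}" "0 \<in> {0..T}" using T by auto
  show "(\<integral>\<omega>. \<bar>Y t \<omega>\<bar> \<partial>M) \<le> (\<integral>\<omega>. \<bar>Y T \<omega>\<bar> \<partial>M)"
    by (rule martingale_abs_expectation_le(1)[OF prob_space_axioms sub Y_integrable[OF T'(1)] Y_integrable[OF
        t] c])
      (use t T' in auto)
  have "(\<integral>\<omega>. Y 0 \<omega> \<partial>M) = (\<integral>\<omega>. Y t \<omega> \<partial>M)"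
    by (rule martingale_abs_expectation_le(2)[OF prob_space_axioms sub Y_integrable[OF t] Y_integrable[OF
        T'(2)] c])
      (use t T' in auto)
  moreover have "(\<integral>\<omega>. Y 0 \<omega> \<partial>M) = (\<integral>\<omega>. 0 \<partial>M)"
  proof (rule integral_cong_AE)
    obtain G where "brownian_motion M G W" using brownian by blast
    from brownian_motionD(6)[OF this] AE_space show "AE \<omega> in M. Y 0 \<omega> = 0"
      by eventually_elim (simp add: Y_def X_path(1) f_0)
  qed (use Y_integrable[OF T'(2)] in auto)
  ultimately show "(\<integral>\<omega>. Y t \<omega> \<partial>M) = 0" by simp
qed

text \<open>
Fubini's theorem applies since the first absolute moments of \<open>Z\<close> are bounded on \<open>[0, T]\<close> and the kernel is
integrable.
\<close>

lemma kernel_fubini: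
  fixes Z :: "real \<Rightarrow> 'a \<Rightarrow> real"
  assumes t: "t \<in> {0..T}" and Z: "\<And>s. s \<in> {0..T} \<Longrightarrow> integrable M (Z s)"
    and cont: "\<And>\<omega>. \<omega> \<in> space M \<Longrightarrow> continuous_on {0..T} (\<lambda>s. Z s \<omega>)"
    and b: "\<And>s. s \<in> {0..T} \<Longrightarrow> (\<integral>\<omega>. \<bar>Z s \<omega>\<bar> \<partial>M) \<le> B"
  shows "integrable M (\<lambda>\<omega>. LINT s:{0..t}|lborel. K (t - s) * Z s \<omega>)"
    "(\<integral>\<omega>. (LINT s:{0..t}|lborel. K (t - s) * Z s \<omega>) \<partial>M) = (LINT s:{0..t}|lborel. K (t - s) * (\<integral>\<omega>. Z s \<omega> \<partial>M))"
    "set_integrable lborel {0..t} (\<lambda>s. K (t - s) * (\<integral>\<omega>. Z s \<omega> \<partial>M))"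
proof -
  have T0: "0 \<le> T" and t0: "0 \<le> t" using T t by auto
  interpret P: pair_sigma_finite lborel M by unfold_locales
  let ?Z = "\<lambda>s \<omega>. Z (clamp_time T s) \<omega>"
  let ?k = "\<lambda>s. indicator {0..t} s *\<^sub>R K (t - s)"
  have km: "?k \<in> borel_measurable lborel" and ki: "integrable lborel ?k"
    using set_integrable_kernel_reflect(1)[OF K t0] unfolding set_integrable_def by auto
  have kn: "0 \<le> ?k s" for s using L1_loc_nonnegD(1)[OF K] by (auto simp: indicator_def)
  have Zm: "(\<lambda>(s, \<omega>). ?Z s \<omega>) \<in> borel_measurable (lborel \<Otimes>\<^sub>M M)"
    by (rule measurable_path_process[OF T0 _ cont]) (use Z in auto)
  have Zi: "integrable M (?Z s)" and Zb: "(\<integral>\<omega>. \<bar>?Z s \<omega>\<bar> \<partial>M) \<le> B" for s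
    using Z b clamp_time_in[OF T0] by auto
  have m: "(\<lambda>(s, \<omega>). ?k s * ?Z s \<omega>) \<in> borel_measurable (lborel \<Otimes>\<^sub>M M)"
    using borel_measurable_times[OF measurable_compose[OF measurable_fst km] Zm] by (simp add: split_beta')
  have int: "integrable (lborel \<Otimes>\<^sub>M M) (\<lambda>(s, \<omega>). ?k s * ?Z s \<omega>)"
  proof (rule P.Fubini_integrable[OF m])
    have am: "(\<lambda>s. \<integral>\<omega>. \<bar>?Z s \<omega>\<bar> \<partial>M) \<in> borel_measurable lborel"
      using borel_measurable_abs[OF Zm] by (intro borel_measurable_lebesgue_integral) (simp add: split_beta')
    have "integrable lborel (\<lambda>s. ?k s * (\<integral>\<omega>. \<bar>?Z s \<omega>\<bar> \<partial>M))"
    proof (rule Bochner_Integration.integrable_bound)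
      show "integrable lborel (\<lambda>s. ?k s * B)" using ki by (rule integrable_mult_left)
      show "AE s in lborel. norm (?k s * (\<integral>\<omega>. \<bar>?Z s \<omega>\<bar> \<partial>M)) \<le> norm (?k s * B)"
      proof (rule AE_I2)
        fix s
        have i0: "0 \<le> (\<integral>\<omega>. \<bar>?Z s \<omega>\<bar> \<partial>M)" by (rule integral_nonneg_AE) simp
        show "norm (?k s * (\<integral>\<omega>. \<bar>?Z s \<omega>\<bar> \<partial>M)) \<le> norm (?k s * B)"
          unfolding norm_mult using i0 Zb[of s] by (intro mult_left_mono) auto
      qed
    qed (intro borel_measurable_times km am)
    then show "integrable lborel (\<lambda>s. \<integral>\<omega>. norm (case (s, \<omega>) of (s, \<omega>) \<Rightarrow> ?k s * ?Z s \<omega>) \<partial>M)"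
      by (simp only: prod.case real_norm_def abs_mult abs_of_nonneg[OF kn] integral_mult_right_zero)
    show "AE s in lborel. integrable M (\<lambda>\<omega>. case (s, \<omega>) of (s, \<omega>) \<Rightarrow> ?k s * ?Z s \<omega>)"
      using Zi by (simp only: prod.case, intro AE_I2 integrable_mult_right)
  qed
  have eq: "(\<lambda>s. ?k s * ?Z s \<omega>) = (\<lambda>s. indicator {0..t} s *\<^sub>R (K (t - s) * Z s \<omega>))" for \<omega>
    using t by (auto simp: indicator_def clamp_time_eq)
  have eq2: "(\<lambda>s. ?k s * (\<integral>\<omega>. ?Z s \<omega> \<partial>M)) = (\<lambda>s. indicator {0..t} s *\<^sub>R (K (t - s) * (\<integral>\<omega>. Z s \<omega> \<partial>M)))"
    using t by (auto simp: indicator_def clamp_time_eq)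
  have "integrable M (\<lambda>\<omega>. \<integral>s. ?k s * ?Z s \<omega> \<partial>lborel)" by (rule P.integrable_snd[OF int])
  then show "integrable M (\<lambda>\<omega>. LINT s:{0..t}|lborel. K (t - s) * Z s \<omega>)"
    unfolding eq set_lebesgue_integral_def .
  have "(\<integral>\<omega>. \<integral>s. ?k s * ?Z s \<omega> \<partial>lborel \<partial>M) = (\<integral>s. \<integral>\<omega>. ?k s * ?Z s \<omega> \<partial>M \<partial>lborel)"
    by (rule P.Fubini_integral[OF int])
  then show "(\<integral>\<omega>. (LINT s:{0..t}|lborel. K (t - s) * Z s \<omega>) \<partial>M) =
      (LINT s:{0..t}|lborel. K (t - s) * (\<integral>\<omega>. Z s \<omega> \<partial>M))"
    unfolding eq set_lebesgue_integral_def integral_mult_right_zero eq2 .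
  have "integrable lborel (\<lambda>s. \<integral>\<omega>. ?k s * ?Z s \<omega> \<partial>M)" by (rule P.integrable_fst[OF int])
  then show "set_integrable lborel {0..t} (\<lambda>s. K (t - s) * (\<integral>\<omega>. Z s \<omega> \<partial>M))"
    unfolding integral_mult_right_zero eq2 set_integrable_def .
qed

lemma kernel_path_integrable:
  assumes t: "t \<in> {0..T}" and cont: "continuous_on {0..T} \<phi>"
  shows "set_integrable lborel {0..t} (\<lambda>s. K (t - s) * \<phi> s :: real)"
proof -
  have T0: "0 \<le> T" using T by simp
  have "bounded (\<phi> ` {0..T})" by (intro compact_imp_bounded compact_continuous_image cont) auto
  then obtain B where B: "\<forall>y\<in>\<phi> ` {0..T}. norm y \<le> B" unfolding bounded_iff by blast
  show ?thesis
  proof (rule set_integrable_kernel_times[OF K, of t T \<phi> B])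
    show "(\<lambda>s. \<phi> (clamp_time T s)) \<in> borel_measurable borel"
      by (rule borel_measurable_continuous_onI, rule continuous_on_compose2[OF cont clamp_time_cont])
        (use clamp_time_in[OF T0] in auto)
  qed (use B t in auto)
qed

lemma solution_AE:
  "AE \<omega> in M. \<forall>t\<in>{0..T}. X t \<omega> = G0 t - lam * (LINT s:{0..t}|lborel. K (t - s) * X s \<omega>)
     + nu * (LINT s:{0..t}|lborel. K (t - s) * Y s \<omega>)"
proof -
  have "AE \<omega> in M. \<forall>t\<in>{0..T}.
          X t \<omega> = G0 t + (LINT s:{0..t}|lborel. K (t - s) * (- lam * X s \<omega> + nu * Y s \<omega>))"
    using sol by (auto simp: weak_solution_def Y_def)
  then show ?thesis using AE_space
  proof eventually_elim
    case (elim \<omega>)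
    show ?case
    proof
      fix t assume t: "t \<in> {0..T}"
      note i = kernel_path_integrable[OF t X_path(3)[OF elim(2)]] kernel_path_integrable[OF t Y_path[OF
          elim(2)]]
      have "(LINT s:{0..t}|lborel. K (t - s) * (- lam * X s \<omega> + nu * Y s \<omega>)) =
         (LINT s:{0..t}|lborel. nu * (K (t - s) * Y s \<omega>) - lam * (K (t - s) * X s \<omega>))"
        by (rule set_lebesgue_integral_cong) (auto simp: algebra_simps)
      also have "\<dots> = (LINT s:{0..t}|lborel. nu * (K (t - s) * Y s \<omega>)) - (LINT s:{0..t}|lborel. lam * (K (t -
          s) * X s \<omega>))"
        by (rule set_integral_diff(2)) (use i in \<open>auto intro!: set_integrable_mult_right\<close>)
      finally show "X t \<omega> = G0 t - lam * (LINT s:{0..t}|lborel. K (t - s) * X s \<omega>)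
         + nu * (LINT s:{0..t}|lborel. K (t - s) * Y s \<omega>)"
        using elim(1) t by simp
    qed
  qed
qed

text \<open>
As \<open>\<lambda> X \<ge> 0\<close>, the process is dominated by \<open>G0\<close> plus a multiple of the convolution of the kernel with a
centred martingale, which is integrable and centred.
\<close>

lemma X_integrable:
  assumes t: "t \<in> {0..T}"
  shows "integrable M (X t)" "(\<integral>\<omega>. X t \<omega> \<partial>M) \<le> G0 t"
proof -
  let ?J = "\<lambda>\<omega>. LINT s:{0..t}|lborel. K (t - s) * Y s \<omega>"
  note J = kernel_fubini[OF t Y_integrable Y_path Y_expectation(1)]
  have EJ: "(\<integral>\<omega>. ?J \<omega> \<partial>M) = 0"
  proof -
    have "(LINT s:{0..t}|lborel. K (t - s) * (\<integral>\<omega>. Y s \<omega> \<partial>M)) = (LINT s:{0..t}|lborel. 0)"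
      by (rule set_lebesgue_integral_cong) (use t Y_expectation(2) in auto)
    then show ?thesis using J(2) by simp
  qed
  have le: "AE \<omega> in M. X t \<omega> \<le> G0 t + nu * ?J \<omega>"
    using solution_AE AE_space
  proof eventually_elim
    case (elim \<omega>)
    have "0 \<le> (LINT s:{0..t}|lborel. K (t - s) * X s \<omega>)"
      unfolding set_lebesgue_integral_def
      by (rule integral_nonneg_AE)
        (use t elim(2) L1_loc_nonnegD(1)[OF K] X_nonneg in \<open>auto simp: indicator_def intro!: AE_I2
            mult_nonneg_nonneg\<close>)
    from mult_nonneg_nonneg[OF lam this] show ?case using elim(1)[rule_format, OF t] by linarith
  qed
  have bi: "integrable M (\<lambda>\<omega>. G0 t + nu * ?J \<omega>)" using J(1) by simp
  show i: "integrable M (X t)"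
  proof (rule Bochner_Integration.integrable_bound[OF bi X_measurable[OF t]])
    show "AE \<omega> in M. norm (X t \<omega>) \<le> norm (G0 t + nu * ?J \<omega>)"
      using le AE_space by eventually_elim (use X_nonneg t in force)
  qed
  have "(\<integral>\<omega>. X t \<omega> \<partial>M) \<le> (\<integral>\<omega>. G0 t + nu * ?J \<omega> \<partial>M)" by (rule integral_mono_AE[OF i bi le])
  also have "\<dots> = G0 t" using J(1) EJ by (simp add: prob_space)
  finally show "(\<integral>\<omega>. X t \<omega> \<partial>M) \<le> G0 t" .
qed

definition mean :: "real \<Rightarrow> real" where "mean t = (\<integral>\<omega>. X t \<omega> \<partial>M)"

lemma mean_nonneg: "t \<in> {0..T} \<Longrightarrow> 0 \<le> mean t"
  unfolding mean_def by (rule integral_nonneg_AE) (use X_nonneg in auto)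

lemma mean_mono: "0 \<le> s \<Longrightarrow> s \<le> t \<Longrightarrow> t \<le> T \<Longrightarrow> mean s \<le> mean t"
  unfolding mean_def by (rule integral_mono) (use X_integrable X_mono in auto)

lemma mean_le: "t \<in> {0..T} \<Longrightarrow> mean t \<le> G0 t"
  unfolding mean_def by (rule X_integrable(2))

lemma mean_equation:
  assumes t: "t \<in> {0..T}"
  shows "mean t = G0 t - lam * (LINT s:{0..t}|lborel. K (t - s) * mean s)"
    "set_integrable lborel {0..t} (\<lambda>s. K (t - s) * mean s)"
proof -
  have b: "(\<integral>\<omega>. \<bar>X s \<omega>\<bar> \<partial>M) \<le> G0 T" if s: "s \<in> {0..T}" for s
  proof -
    have "(\<integral>\<omega>. \<bar>X s \<omega>\<bar> \<partial>M) = mean s" unfolding mean_def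
      by (rule Bochner_Integration.integral_cong) (use X_nonneg s in auto)
    also have "\<dots> \<le> G0 s" by (rule mean_le[OF s])
    also have "\<dots> \<le> G0 T" using G0 s by (auto simp: mono_on_def)
    finally show ?thesis .
  qed
  note J = kernel_fubini[OF t Y_integrable Y_path Y_expectation(1)]
  note I = kernel_fubini[OF t X_integrable(1) X_path(3) b]
  have EJ: "(LINT s:{0..t}|lborel. K (t - s) * (\<integral>\<omega>. Y s \<omega> \<partial>M)) = 0"
  proof -
    have "(LINT s:{0..t}|lborel. K (t - s) * (\<integral>\<omega>. Y s \<omega> \<partial>M)) = (LINT s:{0..t}|lborel. 0)"
      by (rule set_lebesgue_integral_cong) (use t Y_expectation(2) in auto)
    then show ?thesis by simp
  qed
  have "mean t = (\<integral>\<omega>. G0 t - lam * (LINT s:{0..t}|lborel. K (t - s) * X s \<omega>)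
     + nu * (LINT s:{0..t}|lborel. K (t - s) * Y s \<omega>) \<partial>M)"
    unfolding mean_def
    by (rule integral_cong_AE) (use solution_AE t X_measurable I(1) J(1) in auto)
  also have "\<dots> = G0 t - lam * (LINT s:{0..t}|lborel. K (t - s) * mean s)"
    using I(1) J(1) I(2) J(2) EJ by (simp add: prob_space mean_def)
  finally show "mean t = G0 t - lam * (LINT s:{0..t}|lborel. K (t - s) * mean s)" .
  show "set_integrable lborel {0..t} (\<lambda>s. K (t - s) * mean s)" using I(3) by (simp add: mean_def)
qed

text \<open>
The mean is nondecreasing, so the convolution is at most the kernel mass times the last value.
\<close>

lemma mean_lower:
  assumes t: "t \<in> {0..T}"
  shows "G0 t \<le> mean t * (1 + lam * kernel_mass K t)"
proof -
  have i: "set_integrable lborel {0..t} (\<lambda>s. K (t - s) * (mean t - mean s))"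
    using mean_equation(2)[OF t] set_integrable_kernel_reflect(1)[OF K, of t] t
    by (auto simp: right_diff_distrib intro!: set_integral_diff(1) set_integrable_mult_left)
  have "0 * kernel_mass K 0 - 0 * (kernel_mass K t - kernel_mass K 0) \<le>
      (LINT s:{0..t}|lborel. K (t - s) * (mean t - mean s))"
    by (rule kernel_convolution_lower[OF K _ _ i]) (use t mean_mono in auto)
  also have "\<dots> = (LINT s:{0..t}|lborel. K (t - s) * mean t - K (t - s) * mean s)"
    by (simp add: right_diff_distrib)
  also have "\<dots> = (LINT s:{0..t}|lborel. K (t - s) * mean t) - (LINT s:{0..t}|lborel. K (t - s) * mean s)"
    by (rule set_integral_diff(2)) (use mean_equation(2)[OF t] set_integrable_kernel_reflect(1)[OF K, of t] t
        in auto)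
  also have "(LINT s:{0..t}|lborel. K (t - s) * mean t) = kernel_mass K t * mean t"
    using set_integrable_kernel_reflect(2)[OF K, of t t] t by simp
  finally have "(LINT s:{0..t}|lborel. K (t - s) * mean s) \<le> kernel_mass K t * mean t" by simp
  note le = mult_left_mono[OF this lam]
  have "mean t * (1 + lam * kernel_mass K t) = mean t + lam * (kernel_mass K t * mean t)"
      by (simp add: algebra_simps)
  then show ?thesis using mean_equation(1)[OF t] le by linarith
qed

text \<open>
The mean is nondecreasing, so on lags up to \<open>d\<close> it is at least its value at \<open>t - d\<close>.
\<close>

lemma mean_upper:
  assumes t: "t \<in> {0..T}" and d: "0 \<le> d" "d \<le> t"
  shows "mean t \<le> G0 t - lam * (mean (t - d) * kernel_mass K d)"
proof -
  have "mean (t - d) * kernel_mass K d - 0 * (kernel_mass K t - kernel_mass K d) \<le>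
      (LINT s:{0..t}|lborel. K (t - s) * mean s)"
    by (rule kernel_convolution_lower[OF K d mean_equation(2)[OF t]]) (use t d mean_mono mean_nonneg in auto)
  from mult_left_mono[OF this lam] show ?thesis
    using mean_equation(1)[OF t] by simp
qed

text \<open>
Suppose that \<open>h \<le> a\<close> on all values taken up to the time \<open>t0 + N d\<close>. The integrand \<open>Z = X - h(X)\<close> at lags up to
\<open>d\<close> before \<open>r\<close> is then at least \<open>X (r - d) - a\<close>, so the equation at the time \<open>r\<close> gives
\<open>X r - X (r - d) \<ge> G0 t0 - a\<close> up to terms that vanish as the kernel concentrates at \<open>0\<close>. Summing over the \<open>N\<close>
steps bounds \<open>N\<close> times this increment by \<open>R\<close>.
\<close>

lemma barrier_forces_increase:
  assumes \<omega>: "\<omega> \<in> space M"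
    and eq: "\<forall>t\<in>{0..T}. X t \<omega> = G0 t + (LINT s:{0..t}|lborel. K (t - s) * (- lam * X s \<omega> + nu * Y s \<omega>))"
    and t: "0 \<le> t0" "0 < d" "t0 + real N * d \<le> T"
    and barrier: "\<And>x. 0 \<le> x \<Longrightarrow> x \<le> X (t0 + real N * d) \<omega> \<Longrightarrow> (1 + lam) * x - nu * W (f x) \<omega> \<le> a"
    and R: "X T \<omega> \<le> R"
    and S: "\<And>s. s \<in> {0..T} \<Longrightarrow> - S \<le> - lam * X s \<omega> + nu * Y s \<omega>" "0 \<le> S"
  shows "real N * (G0 t0 - a * kernel_mass K d - \<bar>1 - kernel_mass K d\<bar> * R - S * (kernel_mass K T -
      kernel_mass K d)) \<le> R"
proof -
  let ?Z = "\<lambda>s. - lam * X s \<omega> + nu * Y s \<omega>"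
  let ?b = "G0 t0 - a * kernel_mass K d - \<bar>1 - kernel_mass K d\<bar> * R - S * (kernel_mass K T - kernel_mass K d)"
  define r where "r j = t0 + real j * d" for j
  have r: "0 \<le> r j" "r j \<le> r N" "r N \<le> T" "r j \<le> T" if "j \<le> N" for j
  proof -
    have "real j * d \<le> real N * d" using that t(2) by (intro mult_right_mono) auto
    moreover have "0 \<le> real j * d" using t(2) by simp
    ultimately show "0 \<le> r j" "r j \<le> r N" "r N \<le> T" "r j \<le> T" using t unfolding r_def by linarith+
  qed
  have step: "?b \<le> X (r (Suc j)) \<omega> - X (r j) \<omega>" if j: "Suc j \<le> N" for j
  proof -
    let ?t = "r (Suc j)"
    have td: "?t - d = r j" by (simp add: r_def algebra_simps)
    have t1: "?t \<in> {0..T}" "r j \<in> {0..T}" "r j \<le> ?t" "?t \<le> r N" "d \<le> ?t"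
      using r[of "Suc j"] r[of j] j t td by auto
    have int: "set_integrable lborel {0..?t} (\<lambda>s. K (?t - s) * ?Z s)"
      by (rule kernel_path_integrable[OF t1(1)]) (intro continuous_intros X_path(3)[OF \<omega>] Y_path[OF \<omega>])
    have near: "X (r j) \<omega> - a \<le> ?Z s" if s: "s \<in> {?t - d..?t}" for s
    proof -
      have s': "0 \<le> s" "r j \<le> s" "s \<le> T" "s \<le> r N" using s td t1 by auto
      have "(1 + lam) * X s \<omega> - nu * W (f (X s \<omega>)) \<omega> \<le> a"
      proof (rule barrier)
        show "0 \<le> X s \<omega>" using X_nonneg[OF \<omega>] s' by simp
        show "X s \<omega> \<le> X (t0 + real N * d) \<omega>"
          using X_mono[OF \<omega> s'(1,4)] r(3)[of N] by (simp add: r_def)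
      qed
      moreover have "X (r j) \<omega> \<le> X s \<omega>" using X_mono[OF \<omega> _ s'(2,3)] t1 by simp
      ultimately show ?thesis by (simp add: Y_def algebra_simps)
    qed
    have "(X (r j) \<omega> - a) * kernel_mass K d - S * (kernel_mass K ?t - kernel_mass K d) \<le>
        (LINT s:{0..?t}|lborel. K (?t - s) * ?Z s)"
      by (rule kernel_convolution_lower[OF K _ t1(5) int near _ S(2)]) (use S(1) t1 t(2) in auto)
    also have "\<dots> = X ?t \<omega> - G0 ?t" using eq t1(1) by simp
    finally have 1: "(X (r j) \<omega> - a) * kernel_mass K d - S * (kernel_mass K ?t - kernel_mass K d) \<le>
        X ?t \<omega> - G0 ?t" .
    have "r 0 \<le> ?t" using t(2) by (simp add: r_def)
    then have 2: "G0 t0 \<le> G0 ?t" using G0 t(1) by (auto simp: mono_on_def r_def)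
    have 3: "S * (kernel_mass K ?t - kernel_mass K d) \<le> S * (kernel_mass K T - kernel_mass K d)"
      using kernel_mass_mono(1)[OF K, of ?t T] t1(1) S(2) by (intro mult_left_mono) auto
    have X0: "0 \<le> X (r j) \<omega>" "X (r j) \<omega> \<le> R"
      using X_nonneg[OF \<omega> t1(2)] X_mono[OF \<omega>, of "r j" T] t1(2) R by auto
    have "(1 - kernel_mass K d) * X (r j) \<omega> \<le> \<bar>1 - kernel_mass K d\<bar> * X (r j) \<omega>"
      using X0 by (intro mult_right_mono) auto
    also have "\<dots> \<le> \<bar>1 - kernel_mass K d\<bar> * R" using X0 by (intro mult_left_mono) auto
    finally show ?thesis using 1 2 3 by (simp add: algebra_simps)
  qed
  have sum: "real j * ?b \<le> X (r j) \<omega>" if "j \<le> N" for j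
    using that
  proof (induction j)
    case 0
    show ?case using X_nonneg[OF \<omega>, of "r 0"] r[of 0] by simp
  next
    case (Suc j)
    then show ?case using step[of j] by (simp add: algebra_simps)
  qed
  have "X (r N) \<omega> \<le> X T \<omega>" using r[of N] by (intro X_mono[OF \<omega>]) auto
  then show ?thesis using sum[of N] R by linarith
qed

end

section \<open>The limit of a sequence of Volterra equations\<close>

locale volterra_limit =
  fixes T :: real
    and lam nu :: "nat \<Rightarrow> real" and lam_lim nu_lim :: real
    and f :: "nat \<Rightarrow> real \<Rightarrow> real" and f_lim :: "real \<Rightarrow> real"
    and K :: "nat \<Rightarrow> real \<Rightarrow> real"
    and G0 :: "nat \<Rightarrow> real \<Rightarrow> real" and G0_lim :: "real \<Rightarrow> real"
    and M :: "nat \<Rightarrow> 'a measure"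
    and W X :: "nat \<Rightarrow> real \<Rightarrow> 'a \<Rightarrow> real"
    and M_lim :: "'b measure" and W_lim :: "real \<Rightarrow> 'b \<Rightarrow> real"
  assumes T: "T > 0"
    and lam_nonneg: "\<And>n. lam n \<ge> 0"
    and nu_nonneg: "\<And>n. nu n \<ge> 0"
    and f: "\<And>n. admissible_time_change (f n)"
    and K: "\<And>n. L1_loc_nonneg (K n)"
    and G0: "\<And>n. mono_on {0..} (G0 n) \<and> G0 n 0 = 0 \<and> (\<forall>t\<ge>0. 0 \<le> G0 n t)"
    and solution: "\<And>n. weak_solution T (G0 n) (K n) (f n) (lam n) (nu n) (M n) (W n) (X n)"
    and K_conv: "weak_convergence (top_of_set {0..T}) (\<lambda>n. kernel_measure T (K n)) (dirac_zero T)"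
    and G0_conv: "\<And>t. t \<in> {0..T} \<Longrightarrow> (\<lambda>n. G0 n t) \<longlonglongrightarrow> G0_lim t"
    and G0_lim_cont: "continuous_on {0..T} G0_lim"
    and f_conv: "locally_uniform_limit f f_lim"
    and f_growth: "bdd_above {f n x / (1 + x\<^sup>2) | n x. 0 \<le> x}"
    and lam_conv: "lam \<longlonglongrightarrow> lam_lim"
    and nu_conv: "nu \<longlonglongrightarrow> nu_lim"
    and W_lim: "standard_brownian_motion M_lim W_lim"
begin

sublocale sol: volterra_solution T "G0 n" "K n" "f n" "lam n" "nu n" "M n" "W n" "X n" for n
  by unfold_locales (rule T lam_nonneg nu_nonneg f K G0 solution)+

lemma bm_lim: "brownian_motion M_lim (natural_filtration M_lim {0..} W_lim) W_lim"
  using W_lim by (simp add: standard_brownian_motion_def)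

sublocale lim: prob_space M_lim
  by (rule brownian_motionD(1)[OF bm_lim])

lemma lam_lim_nonneg: "0 \<le> lam_lim" and nu_lim_nonneg: "0 \<le> nu_lim"
  by (rule LIMSEQ_le_const[OF lam_conv], use lam_nonneg in auto)
    (rule LIMSEQ_le_const[OF nu_conv], use nu_nonneg in auto)

lemma c_pos: "0 < 1 + lam_lim" using lam_lim_nonneg by simp

lemma growth: "\<exists>C\<ge>0. \<forall>n. \<forall>x\<ge>0. f n x \<le> C * (1 + x\<^sup>2)"
proof -
  obtain C where C: "\<And>y. y \<in> {f n x / (1 + x\<^sup>2) | n x. 0 \<le> x} \<Longrightarrow> y \<le> C"
    using f_growth unfolding bdd_above_def by blast
  have "f n x \<le> max 0 C * (1 + x\<^sup>2)" if "0 \<le> x" for n x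
  proof -
    have p: "0 < 1 + x\<^sup>2" by (simp add: add_pos_nonneg)
    have "f n x / (1 + x\<^sup>2) \<le> C" using C that by blast
    then have "f n x / (1 + x\<^sup>2) \<le> max 0 C" by simp
    then show ?thesis using p by (simp only: pos_divide_le_eq)
  qed
  then show ?thesis by (intro exI[of _ "max 0 C"]) auto
qed

definition C where "C = (SOME C. 0 \<le> C \<and> (\<forall>n. \<forall>x\<ge>0. f n x \<le> C * (1 + x\<^sup>2)))"

lemma C: "0 \<le> C" "\<And>n x. 0 \<le> x \<Longrightarrow> f n x \<le> C * (1 + x\<^sup>2)"
proof -
  have "0 \<le> C \<and> (\<forall>n. \<forall>x\<ge>0. f n x \<le> C * (1 + x\<^sup>2))"
    unfolding C_def by (rule someI_ex) (use growth in blast)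
  then show "0 \<le> C" "\<And>n x. 0 \<le> x \<Longrightarrow> f n x \<le> C * (1 + x\<^sup>2)" by auto
qed

lemma f_tendsto: "0 \<le> x \<Longrightarrow> (\<lambda>n. f n x) \<longlonglongrightarrow> f_lim x"
  by (rule locally_uniform_limit_pointwise[OF f_conv])

lemma f_lim_nonneg: "0 \<le> x \<Longrightarrow> 0 \<le> f_lim x"
  by (rule LIMSEQ_le_const[OF f_tendsto]) (use sol.f_nonneg in auto)

lemma f_lim_growth: "0 \<le> x \<Longrightarrow> f_lim x \<le> C * (1 + x\<^sup>2)"
  by (rule LIMSEQ_le_const2[OF f_tendsto]) (use C(2) in auto)

lemma f_lim_mono: "mono_on {0..} f_lim"
proof (rule mono_onI)
  fix x y :: real assume xy: "x \<in> {0..}" "y \<in> {0..}" "x \<le> y"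
  have "f n x \<le> f n y" for n using sol.f_mono[of n] xy unfolding mono_on_def by blast
  then show "f_lim x \<le> f_lim y" using f_tendsto[of x] f_tendsto[of y] xy by (intro LIMSEQ_le) auto
qed

lemma f_lim_0: "f_lim 0 = 0"
  using f_tendsto[of 0] LIMSEQ_unique[of "\<lambda>n. f n 0" "f_lim 0" 0] by (simp add: sol.f_0)

lemma f_lim_cont: "continuous_on {0..} f_lim"
  by (rule locally_uniform_limit_continuous[OF f_conv])

lemma G0_lim_mono: "0 \<le> s \<Longrightarrow> s \<le> t \<Longrightarrow> t \<le> T \<Longrightarrow> G0_lim s \<le> G0_lim t"
proof -
  assume st: "0 \<le> s" "s \<le> t" "t \<le> T"
  have "G0 n s \<le> G0 n t" for n using G0[of n] st unfolding mono_on_def by auto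
  then show ?thesis using G0_conv[of s] G0_conv[of t] st by (intro LIMSEQ_le) auto
qed

lemma G0_lim_0: "G0_lim 0 = 0"
  using G0_conv[of 0] T LIMSEQ_unique[of "\<lambda>n. G0 n 0" "G0_lim 0" 0] G0 by simp

lemma G0_lim_nonneg: "t \<in> {0..T} \<Longrightarrow> 0 \<le> G0_lim t"
  using G0_lim_mono[of 0 t] G0_lim_0 by simp

lemma mass_tendsto: "0 < d \<Longrightarrow> d \<le> T \<Longrightarrow> (\<lambda>n. kernel_mass (K n) d) \<longlonglongrightarrow> 1"
  by (rule kernel_mass_tendsto[OF T K K_conv])

text \<open>
By \<open>mean_lower\<close> the limit inferior is at least \<open>G0(t) / c\<close>, since the mass tends to \<open>1\<close>. Inserting this
at a time \<open>s < t\<close> into \<open>mean_upper\<close> bounds the limit superior by \<open>G0(t) - \<lambda> G0(s) / c\<close>, and continuity of the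
limit of \<open>G0\<close> lets \<open>s\<close> tend to \<open>t\<close>. For \<open>t = 0\<close> both sides vanish.
\<close>

lemma mean_tendsto:
  assumes t: "t \<in> {0..T}"
  shows "(\<lambda>n. sol.mean n t) \<longlonglongrightarrow> G0_lim t / (1 + lam_lim)"
proof (cases "t = 0")
  case True
  have "sol.mean n 0 = (\<integral>\<omega>. 0 \<partial>M n)" for n
    unfolding sol.mean_def by (rule Bochner_Integration.integral_cong) (auto simp: sol.X_path(1))
  then show ?thesis using True G0_lim_0 by simp
next
  case False
  then have t: "0 < t" "t \<le> T" using assms by auto
  define low where "low s n = G0 n s / (1 + lam n * kernel_mass (K n) s)" for s n
  have low: "low s n \<le> sol.mean n s" if "s \<in> {0..T}" for s n
  proof -
    have "0 < 1 + lam n * kernel_mass (K n) s"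
      using lam_nonneg[of n] kernel_mass_mono(2)[OF K, of 0 s n] that by (simp add: add_pos_nonneg)
    then show ?thesis using sol.mean_lower[OF that, of n] by (simp add: low_def field_simps)
  qed
  have low_lim: "low s \<longlonglongrightarrow> G0_lim s / (1 + lam_lim)" if "0 < s" "s \<le> T" for s
  proof -
    have "low s \<longlonglongrightarrow> G0_lim s / (1 + lam_lim * 1)"
      unfolding low_def using that c_pos
      by (intro tendsto_intros G0_conv lam_conv mass_tendsto) auto
    then show ?thesis by simp
  qed
  show ?thesis
  proof (rule order_tendstoI)
    fix a assume "a < G0_lim t / (1 + lam_lim)"
    from order_tendstoD(1)[OF low_lim[OF t] this]
    show "eventually (\<lambda>n. a < sol.mean n t) sequentially"
      by eventually_elim (use low[OF assms] less_le_trans in blast)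
  next
    fix a assume a: "G0_lim t / (1 + lam_lim) < a"
    have "(G0_lim \<longlongrightarrow> G0_lim t) (at t within {0..T})"
      using G0_lim_cont assms by (simp add: continuous_on_def)
    then have "(G0_lim \<longlongrightarrow> G0_lim t) (at t within {0..t})"
      by (rule tendsto_within_subset) (use t in auto)
    then have gl: "(G0_lim \<longlongrightarrow> G0_lim t) (at_left t)" using t by (simp add: at_within_Icc_at_left)
    have "((\<lambda>s. G0_lim t - lam_lim * (G0_lim s / (1 + lam_lim) * 1)) \<longlongrightarrow>
        G0_lim t - lam_lim * (G0_lim t / (1 + lam_lim) * 1)) (at_left t)"
      using c_pos by (intro tendsto_intros gl) auto
    moreover have "G0_lim t - lam_lim * (G0_lim t / (1 + lam_lim) * 1) = G0_lim t / (1 + lam_lim)"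
      using c_pos by (simp add: field_simps)
    ultimately have "eventually (\<lambda>s. G0_lim t - lam_lim * (G0_lim s / (1 + lam_lim) * 1) < a) (at_left t)"
      using a order_tendstoD(2) by force
    with eventually_at_left_real[OF t(1)]
    have "eventually (\<lambda>s. s \<in> {0<..<t} \<and> G0_lim t - lam_lim * (G0_lim s / (1 + lam_lim) * 1) < a) (at_left t)"
      by eventually_elim simp
    then obtain s where s: "s \<in> {0<..<t}" "G0_lim t - lam_lim * (G0_lim s / (1 + lam_lim) * 1) < a"
      using eventually_happens by force
    have "(\<lambda>n. G0 n t - lam n * (low s n * kernel_mass (K n) (t - s))) \<longlonglongrightarrow>
       G0_lim t - lam_lim * (G0_lim s / (1 + lam_lim) * 1)"
      using s(1) t assms by (intro tendsto_intros G0_conv lam_conv low_lim mass_tendsto) auto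
    from order_tendstoD(2)[OF this s(2)]
    show "eventually (\<lambda>n. sol.mean n t < a) sequentially"
    proof eventually_elim
      case (elim n)
      have "low s n * kernel_mass (K n) (t - s) \<le> sol.mean n s * kernel_mass (K n) (t - s)"
        using low[of s n] s(1) t kernel_mass_mono(2)[OF K, of 0 "t - s" n] by (intro mult_right_mono) auto
      then have "lam n * (low s n * kernel_mass (K n) (t - s)) \<le>
          lam n * (sol.mean n s * kernel_mass (K n) (t - s))"
        using lam_nonneg by (intro mult_left_mono) auto
      moreover have "sol.mean n t \<le> G0 n t - lam n * (sol.mean n s * kernel_mass (K n) (t - s))"
        using sol.mean_upper[OF assms, of "t - s" n] s(1) by simp
      ultimately show ?case using elim by linarith
    qed
  qed
qed

abbreviation wpath :: "nat \<Rightarrow> 'a \<Rightarrow> real \<Rightarrow> real" where "wpath n \<equiv> path_of (W n)"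

definition passage :: "real \<Rightarrow> (real \<Rightarrow> real) \<Rightarrow> real" where
  "passage g w = first_passage (barrier (1 + lam_lim) nu_lim f_lim w) g"

lemma brownian_n: "\<exists>G. brownian_motion (M n) G (W n)"
  by (rule sol.brownian)

lemma wpath_measurable: "wpath n \<in> measurable (M n) path_space"
  using brownian_n path_of_measurable by blast

lemma law_eq: "distr (M n) path_space (wpath n) = distr M_lim path_space (path_of W_lim)"
  using brownian_n[of n] brownian_law_unique[OF _ bm_lim] by blast

lemma barrier_cont: "w \<in> C_paths \<Longrightarrow> continuous_on {0..} (barrier (1 + lam_lim) nu_lim f_lim w)"
  unfolding barrier_def
  by (intro continuous_intros continuous_on_compose2[of "{0..}" w _ f_lim] f_lim_cont)
    (auto simp: C_paths_def f_lim_nonneg)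

lemma barrier_measurable: "0 \<le> s \<Longrightarrow> (\<lambda>w. barrier (1 + lam_lim) nu_lim f_lim w s) \<in> borel_measurable path_space"
  unfolding barrier_def
  by (intro borel_measurable_diff borel_measurable_times borel_measurable_const measurable_path_eval
      f_lim_nonneg)

lemma passage_measurable: "passage g \<in> borel_measurable path_space"
  unfolding passage_def
  by (rule first_passage_measurable[OF barrier_cont barrier_measurable]) (auto simp: space_path_space)

definition crosses :: "real \<Rightarrow> (real \<Rightarrow> real) \<Rightarrow> bool" where
  "crosses g w \<longleftrightarrow> (\<exists>s\<ge>0. g < barrier (1 + lam_lim) nu_lim f_lim w s)"

lemma first_passage_cong: "(\<And>s. 0 \<le> s \<Longrightarrow> h s = h' s) \<Longrightarrow> first_passage h g = first_passage h' g"
proof -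
  assume *: "\<And>s. 0 \<le> s \<Longrightarrow> h s = h' s"
  then have "{s. 0 \<le> s \<and> g < h s} = {s. 0 \<le> s \<and> g < h' s}" by auto
  moreover have "(\<exists>s\<ge>0. g < h s) \<longleftrightarrow> (\<exists>s\<ge>0. g < h' s)" using * by auto
  ultimately show ?thesis unfolding first_passage_def by (simp only:)
qed

lemma passage_wald:
  assumes bm: "brownian_motion N G B" and g: "0 \<le> g"
  shows "integrable N (\<lambda>\<omega>. passage g (path_of B \<omega>))"
    "(\<integral>\<omega>. passage g (path_of B \<omega>) \<partial>N) = g / (1 + lam_lim)"
    "AE \<omega> in N. crosses g (path_of B \<omega>)"
proof -
  interpret P: brownian_passage N G B f_lim C "1 + lam_lim" nu_lim g
    by unfold_locales (use bm f_lim_mono f_lim_cont f_lim_0 f_lim_growth c_pos nu_lim_nonneg g in auto)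
  have eq: "barrier (1 + lam_lim) nu_lim f_lim (path_of B \<omega>) s = P.h \<omega> s" if "0 \<le> s" for \<omega> s
    using that f_lim_nonneg by (simp add: barrier_def P.h_def)
  have "passage g (path_of B \<omega>) = first_passage (P.h \<omega>) g" for \<omega>
    unfolding passage_def by (rule first_passage_cong) (rule eq)
  then show "integrable N (\<lambda>\<omega>. passage g (path_of B \<omega>))"
    "(\<integral>\<omega>. passage g (path_of B \<omega>) \<partial>N) = g / (1 + lam_lim)"
    using P.wald_identity by simp_all
  show "AE \<omega> in N. crosses g (path_of B \<omega>)"
    using P.passage_exists_AE unfolding crosses_def by eventually_elim (use eq in auto)
qed

lemma passage_nonneg: "0 \<le> passage g w"
  unfolding passage_def by (rule first_passage_ge0)

text \<open>
A crossing of the higher level is needed, as \<open>passage\<close> is \<open>0\<close> without one.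
\<close>

lemma passage_mono: "crosses g' w \<Longrightarrow> g \<le> g' \<Longrightarrow> passage g w \<le> passage g' w"
proof -
  assume c: "crosses g' w" and g: "g \<le> g'"
  let ?h = "barrier (1 + lam_lim) nu_lim f_lim w"
  have c': "\<exists>s\<ge>0. g < ?h s" using c g unfolding crosses_def by force
  show ?thesis unfolding passage_def first_passage_def if_P[OF c'] if_P[OF c[unfolded crosses_def]]
    by (rule cInf_superset_mono) (use c g bdd_below_passage' in \<open>auto simp: crosses_def\<close>)
qed

lemma law_integral:
  fixes F :: "(real \<Rightarrow> real) \<Rightarrow> real"
  assumes "F \<in> borel_measurable path_space"
  shows "(\<integral>\<omega>. F (wpath n \<omega>) \<partial>M n) = (\<integral>\<omega>. F (path_of W_lim \<omega>) \<partial>M_lim)"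
  using integral_distr[OF wpath_measurable assms, of n] integral_distr[OF path_of_measurable[OF bm_lim] assms]
    law_eq[of n] by simp

lemma law_measure:
  assumes "A \<in> sets path_space"
  shows "measure (M n) {\<omega>\<in>space (M n). wpath n \<omega> \<in> A} = measure M_lim {\<omega>\<in>space M_lim. path_of W_lim \<omega> \<in> A}"
  using measure_distr[OF wpath_measurable assms, of n] measure_distr[OF path_of_measurable[OF bm_lim] assms]
    law_eq[of n] by (simp add: vimage_def Int_def conj_commute)

lemma wild_paths_small:
  assumes c: "0 < c" and e: "0 < e"
  shows "\<exists>k. measure M_lim {\<omega>\<in>space M_lim. path_of W_lim \<omega> \<in> wild_paths U c k} < e"
proof -
  let ?A = "\<lambda>k. {\<omega>\<in>space M_lim. path_of W_lim \<omega> \<in> wild_paths U c k}"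
  have "(\<lambda>k. measure M_lim (?A k)) \<longlonglongrightarrow> measure M_lim (\<Inter>k. ?A k)"
  proof (rule lim.finite_Lim_measure_decseq)
    show "range ?A \<subseteq> sets M_lim"
      using measurable_sets[OF path_of_measurable[OF bm_lim] wild_paths_measurable]
      by (auto simp: vimage_def Int_def conj_commute)
    show "decseq ?A" unfolding decseq_def using wild_paths_decreasing by blast
  qed
  moreover have "(\<Inter>k. ?A k) = {}"
    using wild_paths_vanish[OF _ c] measurable_space[OF path_of_measurable[OF bm_lim]]
    unfolding space_path_space by blast
  ultimately have "(\<lambda>k. measure M_lim (?A k)) \<longlonglongrightarrow> 0" by simp
  from order_tendstoD(2)[OF this e] show ?thesis unfolding eventually_sequentially by blast
qed

text \<open>
If the value at \<open>t\<close> were below the passage above \<open>G0(t) - \<eta>\<close>, the path \<open>h\<close> would be at most \<open>G0(t) - \<eta>\<close> on all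
values up to then. For tame Brownian paths the coefficients of the equation may be replaced by their limits
at a cost of \<open>\<eta> / 8\<close> plus a vanishing term, and then \<open>barrier_forces_increase\<close> yields an increase by \<open>\<eta> / 4\<close>
on each of more than \<open>4 R / \<eta>\<close> steps.
\<close>

lemma no_early_value:
  assumes t: "0 < t" "t \<le> T" and \<eta>: "0 < \<eta>" and R: "0 \<le> R"
  defines "c0 \<equiv> \<eta> / 8 / (nu_lim + 1)" and "U \<equiv> C * (1 + R\<^sup>2)"
  shows "\<exists>n0. \<forall>n\<ge>n0. \<forall>\<omega>\<in>space (M n).
    (\<forall>t\<in>{0..T}. X n t \<omega> = G0 n t + (LINT s:{0..t}|lborel. K n (t - s) * (- lam n * X n s \<omega> +
        nu n * sol.Y n s \<omega>))) \<longrightarrow>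
    X n T \<omega> \<le> R \<longrightarrow> wpath n \<omega> \<notin> wild_paths U c0 k \<longrightarrow> passage (G0_lim t - \<eta>) (wpath n \<omega>) \<le> X n t \<omega>"
proof -
  have nu1: "0 < nu_lim + 1" using nu_lim_nonneg by simp
  have c0: "0 < c0" using \<eta> nu1 by (simp add: c0_def)
  have c0_le: "nu_lim * c0 \<le> \<eta> / 8"
  proof -
    have "nu_lim * c0 \<le> (nu_lim + 1) * c0" using c0 by (intro mult_right_mono) auto
    also have "\<dots> = \<eta> / 8" unfolding c0_def using nu1
        by (metis less_irrefl nonzero_mult_div_cancel_left times_divide_eq_right)
    finally show ?thesis .
  qed
  have tT: "t \<in> {0..T}" using t by simp
  have "(G0_lim \<longlongrightarrow> G0_lim t) (at t within {0..T})"
    using G0_lim_cont tT by (simp add: continuous_on_def)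
  then have "(G0_lim \<longlongrightarrow> G0_lim t) (at t within {0..t})"
    by (rule tendsto_within_subset) (use t in auto)
  then have "(G0_lim \<longlongrightarrow> G0_lim t) (at_left t)" using t by (simp add: at_within_Icc_at_left)
  then have "eventually (\<lambda>s. G0_lim t - \<eta> / 4 < G0_lim s) (at_left t)"
    by (rule order_tendstoD(1)) (use \<eta> in simp)
  with eventually_at_left_real[OF t(1)]
  have "eventually (\<lambda>s. s \<in> {0<..<t} \<and> G0_lim t - \<eta> / 4 < G0_lim s) (at_left t)"
    by eventually_elim simp
  then obtain t0 where t0: "t0 \<in> {0<..<t}" "G0_lim t - \<eta> / 4 < G0_lim t0"
    using eventually_happens by force
  (* \<open>N\<close> increments of size \<open>\<eta> / 4\<close> exceed \<open>R\<close>; \<open>d\<close> divides the time from \<open>t0\<close> to \<open>t\<close> into \<open>N\<close> steps *)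
  define N where "N = Suc (nat \<lceil>4 * R / \<eta>\<rceil>)"
  have N0: "0 < real N" by (simp add: N_def)
  have "4 * R / \<eta> < real N" unfolding N_def by linarith
  then have NR: "R < real N * (\<eta> / 4)" using \<eta> by (simp add: field_simps)
  define d where "d = (t - t0) / real N"
  have d: "0 < d" "t0 + real N * d = t" using t0 N0 by (auto simp: d_def)
  have "d \<le> real N * d" using d(1) by (simp add: N_def)
  then have dT: "d \<le> T" using d(2) t0(1) t by auto
  (* \<open>a n\<close> bounds \<open>h\<close> with the coefficients of the \<open>n\<close>-th equation, \<open>- S n\<close> bounds its integrand from below,
     and \<open>b n\<close> is the increment on each step that results; in the limit it is at least \<open>5 \<eta> / 8\<close> *)
  define a where "a n = G0_lim t - \<eta> + (\<bar>lam n - lam_lim\<bar> * R + \<bar>nu n - nu_lim\<bar> * real k + nu_lim * c0)" for n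
  define S where "S n = lam n * R + nu n * real k" for n
  define b where "b n = G0 n t0 - a n * kernel_mass (K n) d - \<bar>1 - kernel_mass (K n) d\<bar> * R
     - S n * (kernel_mass (K n) T - kernel_mass (K n) d)" for n
  have t0T: "t0 \<in> {0..T}" using t0 t by auto
  have "b \<longlonglongrightarrow> G0_lim t0 - (G0_lim t - \<eta> + (\<bar>lam_lim - lam_lim\<bar> * R + \<bar>nu_lim - nu_lim\<bar> * real k +
      nu_lim * c0)) * 1
     - \<bar>1 - 1\<bar> * R - (lam_lim * R + nu_lim * real k) * (1 - 1)"
    unfolding b_def a_def S_def
    by (intro tendsto_intros G0_conv lam_conv nu_conv mass_tendsto t0T d(1) dT T order_refl)
  moreover have "\<eta> / 4 < G0_lim t0 - (G0_lim t - \<eta> + (\<bar>lam_lim - lam_lim\<bar> * R + \<bar>nu_lim - nu_lim\<bar> * real k +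
      nu_lim * c0)) * 1
     - \<bar>1 - 1\<bar> * R - (lam_lim * R + nu_lim * real k) * (1 - 1)"
    using t0(2) c0_le \<eta> by simp
  ultimately have "eventually (\<lambda>n. \<eta> / 4 < b n) sequentially" by (rule order_tendstoD(1))
  then obtain n1 where n1: "\<And>n. n \<ge> n1 \<Longrightarrow> \<eta> / 4 < b n" unfolding eventually_sequentially by blast
  have "0 < 1 / real (Suc k)" by simp
  from locally_uniform_limit_uniform[OF f_conv this, of R]
  obtain n2 where n2: "\<And>n x. n \<ge> n2 \<Longrightarrow> x \<in> {0..R} \<Longrightarrow> \<bar>f n x - f_lim x\<bar> < 1 / real (Suc k)" by blast
  show ?thesis
  proof (intro exI[of _ "max n1 n2"] allI ballI impI, rule ccontr)
    fix n \<omega> assume n: "max n1 n2 \<le> n" and \<omega>: "\<omega> \<in> space (M n)"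
      and eq: "\<forall>t\<in>{0..T}. X n t \<omega> = G0 n t + (LINT s:{0..t}|lborel. K n (t - s) * (- lam n * X n s \<omega> +
          nu n * sol.Y n s \<omega>))"
      and XR: "X n T \<omega> \<le> R" and tame: "wpath n \<omega> \<notin> wild_paths U c0 k"
      and early: "\<not> passage (G0_lim t - \<eta>) (wpath n \<omega>) \<le> X n t \<omega>"
    have wC: "wpath n \<omega> \<in> C_paths" using measurable_space[OF wpath_measurable \<omega>]
        by (simp add: space_path_space)
    have fU: "f n x \<in> {0..U}" "f_lim x \<in> {0..U}" if x: "0 \<le> x" "x \<le> R" for x
    proof -
      have "C * (1 + x\<^sup>2) \<le> U" unfolding U_def using x C(1)
          by (intro mult_left_mono add_left_mono power_mono) auto
      then show "f n x \<in> {0..U}" "f_lim x \<in> {0..U}"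
        using C(2)[OF x(1), of n] f_lim_growth[OF x(1)] sol.f_nonneg[OF x(1), of n] f_lim_nonneg[OF x(1)]
            by auto
    qed
    have Wk: "\<bar>W n u \<omega>\<bar> \<le> real k" if "u \<in> {0..U}" for u
    proof -
      have "\<not> real k < \<bar>wpath n \<omega> u\<bar>" using tame wC that unfolding wild_paths_def by blast
      then show ?thesis using that by simp
    qed
    have Wc: "\<bar>W n u \<omega> - W n v \<omega>\<bar> \<le> c0" if "u \<in> {0..U}" "v \<in> {0..U}" "\<bar>u - v\<bar> < 1 / real (Suc k)" for u v
    proof -
      have "\<not> c0 < \<bar>wpath n \<omega> u - wpath n \<omega> v\<bar>" using tame wC that unfolding wild_paths_def by blast
      then show ?thesis using that by simp
    qed
    have XsR: "0 \<le> X n s \<omega> \<and> X n s \<omega> \<le> R" if "s \<in> {0..T}" for s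
      using sol.X_nonneg[OF \<omega> that] sol.X_mono[OF \<omega>, of s T] that XR by auto
    have "real N * b n \<le> R"
      unfolding b_def
    proof (rule sol.barrier_forces_increase[OF \<omega> eq _ d(1) _ _ XR])
      show "0 \<le> t0" "t0 + real N * d \<le> T" using t0 d t by auto
      show "0 \<le> S n" unfolding S_def using lam_nonneg[of n] nu_nonneg[of n] R
          by (intro add_nonneg_nonneg mult_nonneg_nonneg) auto
      fix s assume s: "s \<in> {0..T}"
      have "lam n * X n s \<omega> \<le> lam n * R" using lam_nonneg[of n] XsR[OF s] by (intro mult_left_mono) auto
      moreover have "\<bar>sol.Y n s \<omega>\<bar> \<le> real k" unfolding sol.Y_def using Wk fU(1) XsR[OF s] by blast
      then have "nu n * (- real k) \<le> nu n * sol.Y n s \<omega>" using nu_nonneg[of n] by (intro mult_left_mono) auto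
      ultimately show "- S n \<le> - lam n * X n s \<omega> + nu n * sol.Y n s \<omega>" unfolding S_def by simp
    next
      fix x assume x: "0 \<le> x" "x \<le> X n (t0 + real N * d) \<omega>"
      then have xt: "x \<le> X n t \<omega>" by (simp only: d(2))
      then have xR: "x \<le> R" using XsR[OF tT] by simp
      have "\<not> G0_lim t - \<eta> < barrier (1 + lam_lim) nu_lim f_lim (wpath n \<omega>) x"
        using first_passage_le[OF x(1), of "G0_lim t - \<eta>" "barrier (1 +
            lam_lim) nu_lim f_lim (wpath n \<omega>)"] early xt
        unfolding passage_def by linarith
      then have h: "(1 + lam_lim) * x - nu_lim * W n (f_lim x) \<omega> \<le> G0_lim t - \<eta>"
        using f_lim_nonneg[OF x(1)] by (simp add: barrier_def)
      have l: "(lam n - lam_lim) * x \<le> \<bar>lam n - lam_lim\<bar> * R"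
        using x(1) xR by (intro mult_mono) auto
      have "\<bar>nu n - nu_lim\<bar> * \<bar>W n (f n x) \<omega>\<bar> \<le> \<bar>nu n - nu_lim\<bar> * real k"
        using Wk[OF fU(1)[OF x(1) xR]] by (intro mult_left_mono) auto
      then have v: "- ((nu n - nu_lim) * W n (f n x) \<omega>) \<le> \<bar>nu n - nu_lim\<bar> * real k"
        unfolding abs_mult[symmetric] by linarith
      have "\<bar>W n (f n x) \<omega> - W n (f_lim x) \<omega>\<bar> \<le> c0"
        using n2[of n x] n x(1) xR by (intro Wc fU) auto
      then have "nu_lim * (- (W n (f n x) \<omega> - W n (f_lim x) \<omega>)) \<le> nu_lim * c0"
        using nu_lim_nonneg by (intro mult_left_mono) auto
      with h l v show "(1 + lam n) * x - nu n * W n (f n x) \<omega> \<le> a n"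
        unfolding a_def by (simp add: algebra_simps)
    qed
    moreover have "R < real N * b n"
      using NR mult_strict_left_mono[OF n1[of n] N0] n by simp
    ultimately show False by simp
  qed
qed

text \<open>
The exceptional events of \<open>no_early_value\<close> have small probability: \<open>X T \<ge> R\<close> by Markov's inequality
and the bound of the mean by \<open>G0(T)\<close>, and wild Brownian paths by the common law.
\<close>

lemma early_probability:
  assumes t: "0 < t" "t \<le> T" and \<eta>: "0 < \<eta>"
  shows "(\<lambda>n. measure (M n) {\<omega>\<in>space (M n). X n t \<omega> < passage (G0_lim t - \<eta>) (wpath n \<omega>)}) \<longlonglongrightarrow> 0"
proof (rule LIMSEQ_I)
  fix e :: real assume e: "0 < e"
  have TT: "T \<in> {0..T}" using T by simp
  obtain B where B: "\<And>n. \<bar>G0 n T\<bar> \<le> B"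
    using convergent_imp_Bseq[of "\<lambda>n. G0 n T"] G0_conv[OF TT] unfolding convergent_def Bseq_def by auto
  define R where "R = 2 * (\<bar>B\<bar> + 1) / e"
  have R: "0 < R" using e by (simp add: R_def)
  have BR: "B / R < e / 2"
  proof -
    have "B < \<bar>B\<bar> + 1" by linarith
    also have "\<dots> = R * (e / 2)" using e by (simp add: R_def)
    finally show ?thesis using R by (simp add: field_simps)
  qed
  define c0 where "c0 = \<eta> / 8 / (nu_lim + 1)"
  have c0: "0 < c0" using \<eta> nu_lim_nonneg by (simp add: c0_def)
  define U where "U = C * (1 + R\<^sup>2)"
  obtain k where k: "measure M_lim {\<omega>\<in>space M_lim. path_of W_lim \<omega> \<in> wild_paths U c0 k} < e / 2"
    using wild_paths_small[OF c0, of "e / 2" U] e by auto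
  have R0: "0 \<le> R" using R by simp
  obtain n0 where n0: "\<forall>n\<ge>n0. \<forall>\<omega>\<in>space (M n).
    (\<forall>t\<in>{0..T}. X n t \<omega> = G0 n t + (LINT s:{0..t}|lborel. K n (t - s) * (- lam n * X n s \<omega> +
        nu n * sol.Y n s \<omega>))) \<longrightarrow>
    X n T \<omega> \<le> R \<longrightarrow> wpath n \<omega> \<notin> wild_paths U c0 k \<longrightarrow> passage (G0_lim t - \<eta>) (wpath n \<omega>) \<le> X n t \<omega>"
    using no_early_value[OF t \<eta> R0] unfolding c0_def U_def by blast
  show "\<exists>no. \<forall>n\<ge>no. norm (measure (M n) {\<omega>\<in>space (M n). X n t \<omega> < passage (G0_lim t - \<eta>) (wpath n \<omega>)} - 0) <
      e"
  proof (intro exI[of _ n0] allI impI)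
    fix n assume n: "n \<ge> n0"
    let ?A = "{\<omega>\<in>space (M n). X n t \<omega> < passage (G0_lim t - \<eta>) (wpath n \<omega>)}"
    let ?B = "{\<omega>\<in>space (M n). R \<le> X n T \<omega>}" and ?D = "{\<omega>\<in>space (M n). wpath n \<omega> \<in> wild_paths U c0 k}"
    have Bm: "?B \<in> sets (M n)" using sol.X_measurable[OF TT, of n] by measurable
    have Dm: "?D \<in> sets (M n)" using measurable_sets[OF wpath_measurable[of n] wild_paths_measurable]
      by (simp add: vimage_def Int_def conj_commute)
    have sub: "AE \<omega> in M n. \<omega> \<in> ?A \<longrightarrow> \<omega> \<in> ?B \<union> ?D"
    proof -
      have "AE \<omega> in M n. \<forall>t\<in>{0..T}. X n t \<omega> = G0 n t + (LINT s:{0..t}|lborel. K n (t -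
          s) * (- lam n * X n s \<omega> + nu n * sol.Y n s \<omega>))"
        using solution[of n] by (auto simp: weak_solution_def sol.Y_def)
      then show ?thesis
      proof eventually_elim
        case (elim \<omega>)
        show ?case
        proof (rule impI, rule ccontr)
          assume A: "\<omega> \<in> ?A" and nB: "\<omega> \<notin> ?B \<union> ?D"
          then have "passage (G0_lim t - \<eta>) (wpath n \<omega>) \<le> X n t \<omega>"
            using n0[rule_format, OF n _ elim[rule_format]] by auto
          then show False using A by simp
        qed
      qed
    qed
    have "measure (M n) ?A \<le> measure (M n) (?B \<union> ?D)"
      by (rule sol.finite_measure_mono_AE[OF sub]) (use Bm Dm in auto)
    moreover have "measure (M n) (?B \<union> ?D) \<le> measure (M n) ?B + measure (M n) ?D"
      by (rule measure_Un_le[OF Bm Dm])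
    moreover have "measure (M n) ?B \<le> (\<integral>\<omega>. X n T \<omega> \<partial>M n) / R"
      by (rule integral_Markov_inequality_measure[where A="{}"])
        (use sol.X_integrable(1)[OF TT] sol.X_nonneg[OF _ TT] R in auto)
    moreover have "(\<integral>\<omega>. X n T \<omega> \<partial>M n) / R \<le> B / R"
      using sol.X_integrable(2)[OF TT, of n] B[of n] R by (intro divide_right_mono) auto
    moreover have "measure (M n) ?D < e / 2"
      using k law_measure[OF wild_paths_measurable, of n U c0 k] by simp
    ultimately have "measure (M n) ?A < e / 2 + e / 2" using BR by linarith
    then show "norm (measure (M n) ?A - 0) < e" by simp
  qed
qed

lemma passage_wpath_integrable: "0 \<le> g \<Longrightarrow> integrable (M n) (\<lambda>\<omega>. passage g (wpath n \<omega>))"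
  and passage_wpath_expectation: "0 \<le> g \<Longrightarrow> (\<integral>\<omega>. passage g (wpath n \<omega>) \<partial>M n) = g / (1 + lam_lim)"
  and passage_wpath_crosses: "0 \<le> g \<Longrightarrow> AE \<omega> in M n. crosses g (wpath n \<omega>)"
  using brownian_n[of n] passage_wald by blast+

text \<open>
Uniform integrability of the passages under the different measures, which holds because their laws coincide.
\<close>

lemma passage_tail_small:
  assumes g: "0 \<le> g" and e: "0 < e"
  shows "\<exists>b::nat. (\<integral>\<omega>. passage g (path_of W_lim \<omega>) * indicator {real b<..} (passage g (path_of W_lim \<omega>))
      \<partial>M_lim) < e"
proof -
  let ?p = "\<lambda>\<omega>. passage g (path_of W_lim \<omega>)"
  have m: "?p \<in> borel_measurable M_lim" by (rule measurable_compose[OF path_of_measurable[OF bm_lim]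
      passage_measurable])
  have "(\<lambda>b. \<integral>\<omega>. ?p \<omega> * indicator {real b<..} (?p \<omega>) \<partial>M_lim) \<longlonglongrightarrow> (\<integral>\<omega>. 0 \<partial>M_lim)"
  proof (rule integral_dominated_convergence[where w="?p"])
    show "(\<lambda>\<omega>. ?p \<omega> * indicator {real b<..} (?p \<omega>)) \<in> borel_measurable M_lim" for b
      by (intro borel_measurable_times m measurable_compose[OF m borel_measurable_indicator]) simp
    show "AE \<omega> in M_lim. (\<lambda>b. ?p \<omega> * indicator {real b<..} (?p \<omega>)) \<longlonglongrightarrow> 0"
    proof (intro AE_I2 tendsto_eventually)
      fix \<omega>
      show "\<forall>\<^sub>F b in sequentially. ?p \<omega> * indicator {real b<..} (?p \<omega>) = 0"
        unfolding eventually_sequentially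
      proof (intro exI[of _ "nat \<lceil>?p \<omega>\<rceil>"] allI impI)
        fix b assume "nat \<lceil>?p \<omega>\<rceil> \<le> b"
        then have "?p \<omega> \<le> real b" by linarith
        then show "?p \<omega> * indicator {real b<..} (?p \<omega>) = 0" by simp
      qed
    qed
    show "AE \<omega> in M_lim. norm (?p \<omega> * indicator {real b<..} (?p \<omega>)) \<le> ?p \<omega>" for b
      by (rule AE_I2) (simp add: indicator_def passage_nonneg)
  qed (use passage_wald(1)[OF bm_lim g] in auto)
  then have "(\<lambda>b. \<integral>\<omega>. ?p \<omega> * indicator {real b<..} (?p \<omega>) \<partial>M_lim) \<longlonglongrightarrow> 0" by simp
  from order_tendstoD(2)[OF this e] show ?thesis unfolding eventually_sequentially by blast
qed

text \<open>
With \<open>p\<close> and \<open>q\<close> the passages above \<open>g\<close> and \<open>g - \<eta>\<close>, and \<open>A\<close> the event \<open>X < q\<close>,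
\<open>\<bar>X - p\<bar> \<le> (X - q) + (p - q) + 2 (q - X)\<^sup>+\<close> and \<open>(q - X)\<^sup>+ \<le> b 1(A) + q 1(q > b)\<close>. The means of \<open>X - q\<close> and
of \<open>p - q\<close> are asymptotically \<open>\<eta> / c\<close>, the probability of \<open>A\<close> vanishes and the tail is small for large \<open>b\<close>.
\<close>

lemma L1_convergence:
  assumes t: "t \<in> {0..T}"
  shows "(\<lambda>n. \<integral>\<omega>. \<bar>X n t \<omega> - passage (G0_lim t) (wpath n \<omega>)\<bar> \<partial>M n) \<longlonglongrightarrow> 0"
proof (cases "G0_lim t = 0")
  case True
  have le: "(\<integral>\<omega>. \<bar>X n t \<omega> - passage (G0_lim t) (wpath n \<omega>)\<bar> \<partial>M n) \<le> sol.mean n t" for n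
  proof -
    have "(\<integral>\<omega>. \<bar>X n t \<omega> - passage (G0_lim t) (wpath n \<omega>)\<bar> \<partial>M n) \<le>
        (\<integral>\<omega>. X n t \<omega> + passage (G0_lim t) (wpath n \<omega>) \<partial>M n)"
    proof (rule integral_mono)
      fix \<omega> assume "\<omega> \<in> space (M n)"
      then show "\<bar>X n t \<omega> - passage (G0_lim t) (wpath n \<omega>)\<bar> \<le> X n t \<omega> + passage (G0_lim t) (wpath n \<omega>)"
        using sol.X_nonneg[OF _ t, of \<omega> n] passage_nonneg[of "G0_lim t" "wpath n \<omega>"] by (simp add: abs_le_iff)
    qed (use sol.X_integrable(1)[OF t] passage_wpath_integrable[OF G0_lim_nonneg[OF t]] in auto)
    also have "\<dots> = sol.mean n t"
      using sol.X_integrable(1)[OF t, of n] passage_wpath_integrable[OF G0_lim_nonneg[OF t], of n]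
        passage_wpath_expectation[OF G0_lim_nonneg[OF t], of n] True by (simp add: sol.mean_def)
    finally show ?thesis .
  qed
  have "(\<lambda>n. sol.mean n t) \<longlonglongrightarrow> 0" using mean_tendsto[OF t] True by simp
  then show ?thesis
    by (rule tendsto_sandwich[OF _ _ tendsto_const, rotated 2]) (use le in auto)
next
  case False
  define g where "g = G0_lim t"
  have g: "0 < g" using False G0_lim_nonneg[OF t] by (simp add: g_def)
  have t': "0 < t" "t \<le> T" using t False G0_lim_0 by (cases "t = 0"; simp)+
  define c where "c = 1 + lam_lim"
  have c: "0 < c" using c_pos by (simp add: c_def)
  show ?thesis
    unfolding g_def[symmetric]
  proof (rule LIMSEQ_I)
    fix e :: real assume e: "0 < e"
    (* the levels must stay nonnegative for the identity of Wald, hence the minimum with \<open>g\<close> *)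
    define \<eta> where "\<eta> = min g (c * e / 8)"
    have \<eta>: "0 < \<eta>" "\<eta> \<le> g" using g c e by (auto simp: \<eta>_def)
    have "\<eta> \<le> c * e / 8" unfolding \<eta>_def by (rule min.cobounded2)
    then have \<eta>c: "\<eta> / c \<le> e / 8" using c by (simp add: field_simps)
    have g1: "0 \<le> g - \<eta>" and g0: "0 \<le> g" using \<eta> g by auto
    let ?p = "\<lambda>n \<omega>. passage g (wpath n \<omega>)" and ?q = "\<lambda>n \<omega>. passage (g - \<eta>) (wpath n \<omega>)"
    obtain b :: nat where b: "(\<integral>\<omega>. passage (g - \<eta>) (path_of W_lim \<omega>) * indicator {real b<..} (passage (g -
        \<eta>) (path_of W_lim \<omega>)) \<partial>M_lim) < e / 8"
      using passage_tail_small[OF g1, of "e / 8"] e by auto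
    have tailm: "(\<lambda>w. passage (g - \<eta>) w * indicator {real b<..} (passage (g -
        \<eta>) w)) \<in> borel_measurable path_space"
      by (intro borel_measurable_times passage_measurable measurable_compose[OF passage_measurable
          borel_measurable_indicator]) simp
    let ?tail = "\<lambda>n \<omega>. ?q n \<omega> * indicator {real b<..} (?q n \<omega>)"
    have tail: "(\<integral>\<omega>. ?tail n \<omega> \<partial>M n) < e / 8" for n
      using law_integral[OF tailm, of n] b by simp
    let ?A = "\<lambda>n. {\<omega>\<in>space (M n). X n t \<omega> < ?q n \<omega>}"
    have "(\<lambda>n. real b * measure (M n) (?A n)) \<longlonglongrightarrow> real b * 0"
      unfolding g_def by (intro tendsto_intros early_probability t' \<eta>)
    then have "eventually (\<lambda>n. real b * measure (M n) (?A n) < e / 8) sequentially"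
      by (rule order_tendstoD(2)) (use e in simp)
    moreover have "eventually (\<lambda>n. sol.mean n t < g / c + e / 8) sequentially"
      unfolding g_def c_def by (rule order_tendstoD(2)[OF mean_tendsto[OF t]]) (use e in simp)
    ultimately have "eventually (\<lambda>n. (\<integral>\<omega>. \<bar>X n t \<omega> - ?p n \<omega>\<bar> \<partial>M n) < e) sequentially"
    proof eventually_elim
      case (elim n)
      have qm: "?q n \<in> borel_measurable (M n)" and pm: "?p n \<in> borel_measurable (M n)"
        by (rule measurable_compose[OF wpath_measurable passage_measurable])+
      have Am: "?A n \<in> sets (M n)" using sol.X_measurable[OF t, of n] qm by measurable
      have Xi: "integrable (M n) (X n t)" by (rule sol.X_integrable(1)[OF t])
      note pi = passage_wpath_integrable[OF g0, of n] and qi = passage_wpath_integrable[OF g1, of n]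
      have ti: "integrable (M n) (?tail n)"
        by (rule Bochner_Integration.integrable_bound[OF qi measurable_compose[OF wpath_measurable tailm]])
          (auto simp: indicator_def)
      have Ai: "integrable (M n) (indicator (?A n) :: 'a \<Rightarrow> real)"
        using Am by (simp add: sol.emeasure_eq_measure less_top[symmetric])
      let ?r = "\<lambda>\<omega>. X n t \<omega> - 2 * ?q n \<omega> + ?p n \<omega> + 2 * (real b * indicator (?A n) \<omega>) + 2 * ?tail n \<omega>"
      have "(\<integral>\<omega>. \<bar>X n t \<omega> - ?p n \<omega>\<bar> \<partial>M n) \<le> (\<integral>\<omega>. ?r \<omega> \<partial>M n)"
      proof (rule integral_mono_AE)
        show "integrable (M n) (\<lambda>\<omega>. \<bar>X n t \<omega> - ?p n \<omega>\<bar>)" using Xi pi by simp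
        show "integrable (M n) ?r"
          by (intro Bochner_Integration.integrable_add Bochner_Integration.integrable_diff
              integrable_mult_right Xi pi qi ti Ai)
        show "AE \<omega> in M n. \<bar>X n t \<omega> - ?p n \<omega>\<bar> \<le> ?r \<omega>"
          using passage_wpath_crosses[OF g0] AE_space
        proof eventually_elim
          case (elim \<omega>)
          have pq: "?q n \<omega> \<le> ?p n \<omega>" using elim(1) by (rule passage_mono) (use \<eta> in simp)
          have q0: "0 \<le> ?q n \<omega>" by (rule passage_nonneg)
          have tb: "0 \<le> ?tail n \<omega>" "0 \<le> real b * indicator (?A n) \<omega>" using q0 by (auto simp: indicator_def)
          show ?case
          proof (cases "X n t \<omega> < ?q n \<omega>")
            case False
            then show ?thesis using pq tb by linarith
          next
            case True
            then have A: "indicator (?A n) \<omega> = (1::real)" using elim(2) by simp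
            have "?q n \<omega> \<le> real b + ?tail n \<omega>" using q0 by (cases "real b < ?q n \<omega>") auto
            then show ?thesis unfolding A using pq True sol.X_nonneg[OF elim(2) t] by linarith
          qed
        qed
      qed
      also have "(\<integral>\<omega>. ?r \<omega> \<partial>M n) = sol.mean n t - 2 * ((g - \<eta>) / c) + g / c +
          2 * (real b * measure (M n) (?A n)) + 2 * (\<integral>\<omega>. ?tail n \<omega> \<partial>M n)"
        using Xi pi qi ti Ai Am passage_wpath_expectation[OF g0, of n] passage_wpath_expectation[OF g1, of n]
        by (simp add: sol.mean_def c_def)
      also have "(g - \<eta>) / c = g / c - \<eta> / c" by (simp add: diff_divide_distrib)
      finally have total: "(\<integral>\<omega>. \<bar>X n t \<omega> - ?p n \<omega>\<bar> \<partial>M n) \<le> sol.mean n t - 2 * (g / c - \<eta> / c) + g / c +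
          2 * (real b * measure (M n) (?A n)) + 2 * (\<integral>\<omega>. ?tail n \<omega> \<partial>M n)" .
      have arith: "x < e" if "x \<le> m - 2 * (u - v) + u + 2 * y + 2 * z" "y < e / 8" "m < u + e / 8" "z <
          e / 8" "v \<le> e / 8"
        for x m u v y z :: real
        using that e by (simp add: field_simps)
      show ?case by (rule arith[OF total elim tail \<eta>c])
    qed
    then show "\<exists>no. \<forall>n\<ge>no. norm ((\<integral>\<omega>. \<bar>X n t \<omega> - ?p n \<omega>\<bar> \<partial>M n) - 0) < e"
      unfolding eventually_sequentially by simp
  qed
qed

text \<open>
Crossing the level \<open>G0(T)\<close> implies crossing all levels \<open>G0(t)\<close>, so that on this event, which has probability
one, the path consists of genuine first passages. On its complement the zero path is used.
\<close>

definition limit_path :: "(real \<Rightarrow> real) \<Rightarrow> real \<Rightarrow> real" where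
  "limit_path w = restrict (\<lambda>t. if crosses (G0_lim T) w then passage (G0_lim t) w else 0) {0..T}"

lemma crosses_mono: "crosses g' w \<Longrightarrow> g \<le> g' \<Longrightarrow> crosses g w"
  unfolding crosses_def by force

text \<open>
The strict inequality in the definition of the passage makes it right continuous in the level.
\<close>

lemma passage_right_continuous:
  assumes c: "crosses (G0_lim T) w" and t: "0 \<le> t" "t < T"
  shows "((\<lambda>t. passage (G0_lim t) w) \<longlongrightarrow> passage (G0_lim t) w) (at_right t)"
proof (rule order_tendstoI)
  let ?h = "barrier (1 + lam_lim) nu_lim f_lim w"
  have cr: "crosses (G0_lim s) w" if "0 \<le> s" "s \<le> T" for s
    by (rule crosses_mono[OF c G0_lim_mono]) (use that in auto)
  have ev: "eventually (\<lambda>s. t < s \<and> s < T) (at_right t)"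
    using eventually_at_right_real[OF t(2)] by simp
  fix a
  { assume a: "a < passage (G0_lim t) w"
    show "\<forall>\<^sub>F s in at_right t. a < passage (G0_lim s) w"
      using ev
    proof eventually_elim
      case (elim s)
      have "passage (G0_lim t) w \<le> passage (G0_lim s) w"
        using elim t by (intro passage_mono cr G0_lim_mono) auto
      then show ?case using a by simp
    qed }
  { assume a: "passage (G0_lim t) w < a"
    have "\<exists>s\<ge>0. G0_lim t < ?h s" using cr[of t] t by (simp add: crosses_def)
    from first_passage_less_iff[OF this, of a] obtain s where s: "0 \<le> s" "s < a" "G0_lim t < ?h s"
      using a unfolding passage_def by blast
    have "(G0_lim \<longlongrightarrow> G0_lim t) (at t within {0..T})"
      using G0_lim_cont t by (simp add: continuous_on_def)
    then have "(G0_lim \<longlongrightarrow> G0_lim t) (at t within {t..T})"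
      by (rule tendsto_within_subset) (use t in auto)
    then have "(G0_lim \<longlongrightarrow> G0_lim t) (at_right t)" using t by (simp add: at_within_Icc_at_right)
    from order_tendstoD(2)[OF this s(3)]
    show "\<forall>\<^sub>F r in at_right t. passage (G0_lim r) w < a"
    proof eventually_elim
      case (elim r)
      have "passage (G0_lim r) w \<le> s" unfolding passage_def
          by (rule first_passage_le[where h="?h", OF s(1) elim])
      then show ?case using s(2) by simp
    qed }
qed

lemma limit_path_D_up: "limit_path w \<in> D_up_paths T"
  unfolding limit_path_def
proof (rule D_up_pathsI)
  fix s t assume st: "0 \<le> s" "s \<le> t" "t \<le> T"
  have g: "G0_lim s \<le> G0_lim t" "G0_lim t \<le> G0_lim T"
    using st by (auto intro!: G0_lim_mono)
  show "(if crosses (G0_lim T) w then passage (G0_lim s) w else 0) \<le>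
      (if crosses (G0_lim T) w then passage (G0_lim t) w else 0)"
    using passage_mono[OF crosses_mono[OF _ g(2)] g(1)] by auto
next
  fix t assume "0 \<le> t" "t < T"
  then show "((\<lambda>t. if crosses (G0_lim T) w then passage (G0_lim t) w else 0) \<longlongrightarrow>
      (if crosses (G0_lim T) w then passage (G0_lim t) w else 0)) (at_right t)"
    using passage_right_continuous by (cases "crosses (G0_lim T) w") auto
qed (simp add: passage_nonneg)

lemma limit_path_measurable:
  assumes t: "t \<in> {0..T}"
  shows "(\<lambda>w. limit_path w t) \<in> borel_measurable path_space"
proof -
  have "{w\<in>space path_space. crosses (G0_lim T) w} \<in> sets path_space"
    unfolding crosses_def
    by (rule passage_exists_measurable[OF barrier_cont barrier_measurable]) (auto simp: space_path_space)
  then have "(\<lambda>w. if crosses (G0_lim T) w then passage (G0_lim t) w else 0) \<in> borel_measurable path_space"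
    by (intro measurable_If passage_measurable borel_measurable_const)
  then show ?thesis unfolding limit_path_def using t by simp
qed

definition X_path :: "nat \<Rightarrow> 'a \<Rightarrow> real \<Rightarrow> real" where
  "X_path n \<omega> = restrict (\<lambda>t. X n t \<omega>) {0..T}"

lemma X_path_D_up: "\<omega> \<in> space (M n) \<Longrightarrow> X_path n \<omega> \<in> D_up_paths T"
  unfolding X_path_def
proof (rule D_up_pathsI)
  assume \<omega>: "\<omega> \<in> space (M n)"
  show "X n s \<omega> \<le> X n t \<omega>" if "0 \<le> s" "s \<le> t" "t \<le> T" for s t by (rule sol.X_mono[OF \<omega> that])
  show "0 \<le> X n t \<omega>" if "t \<in> {0..T}" for t by (rule sol.X_nonneg[OF \<omega> that])
  fix t assume t: "0 \<le> t" "t < T"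
  have "((\<lambda>t. X n t \<omega>) \<longlongrightarrow> X n t \<omega>) (at t within {0..T})"
    using sol.X_path(3)[OF \<omega>] t by (simp add: continuous_on_def)
  then have "((\<lambda>t. X n t \<omega>) \<longlongrightarrow> X n t \<omega>) (at t within {t..T})"
    by (rule tendsto_within_subset) (use t in auto)
  then show "((\<lambda>t. X n t \<omega>) \<longlongrightarrow> X n t \<omega>) (at_right t)" using t by (simp add: at_within_Icc_at_right)
qed

lemma X_path_measurable: "t \<in> {0..T} \<Longrightarrow> (\<lambda>\<omega>. X_path n \<omega> t) \<in> borel_measurable (M n)"
  unfolding X_path_def using sol.X_measurable[of t n] by simp

lemma X_path_close:
  assumes t: "t \<in> {0..T}" and d: "0 < d"
  shows "(\<lambda>n. measure (M n) {\<omega>\<in>space (M n). d < \<bar>X_path n \<omega> t - limit_path (wpath n \<omega>) t\<bar>}) \<longlonglongrightarrow> 0"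
proof -
  let ?D = "\<lambda>n \<omega>. \<bar>X n t \<omega> - passage (G0_lim t) (wpath n \<omega>)\<bar>"
  have le: "measure (M n) {\<omega>\<in>space (M n). d < \<bar>X_path n \<omega> t - limit_path (wpath n \<omega>) t\<bar>} \<le>
      (\<integral>\<omega>. ?D n \<omega> \<partial>M n) / d" for n
  proof -
    have Di: "integrable (M n) (?D n)"
      using sol.X_integrable(1)[OF t, of n] passage_wpath_integrable[OF G0_lim_nonneg[OF t], of n] by simp
    have TT: "T \<in> {0..T}" using T by simp
    have "measure (M n) {\<omega>\<in>space (M n). d < \<bar>X_path n \<omega> t - limit_path (wpath n \<omega>) t\<bar>} \<le>
        measure (M n) {\<omega>\<in>space (M n). d \<le> ?D n \<omega>}"
    proof (rule sol.finite_measure_mono_AE)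
      show "AE \<omega> in M n. \<omega> \<in> {\<omega>\<in>space (M n). d < \<bar>X_path n \<omega> t - limit_path (wpath n \<omega>) t\<bar>} \<longrightarrow>
          \<omega> \<in> {\<omega>\<in>space (M n). d \<le> ?D n \<omega>}"
        using passage_wpath_crosses[OF G0_lim_nonneg[OF TT], of n]
        by eventually_elim (use t in \<open>auto simp: X_path_def limit_path_def\<close>)
      show "{\<omega>\<in>space (M n). d \<le> ?D n \<omega>} \<in> sets (M n)"
        using borel_measurable_integrable[OF Di] by measurable
    qed
    also have "\<dots> \<le> (\<integral>\<omega>. ?D n \<omega> \<partial>M n) / d"
      by (rule integral_Markov_inequality_measure[where A="{}"]) (use Di d in auto)
    finally show ?thesis .
  qed
  have "(\<lambda>n. (\<integral>\<omega>. ?D n \<omega> \<partial>M n) / d) \<longlonglongrightarrow> 0 / d"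
    using d by (intro tendsto_divide L1_convergence[OF t] tendsto_const) simp
  then have "(\<lambda>n. (\<integral>\<omega>. ?D n \<omega> \<partial>M n) / d) \<longlonglongrightarrow> 0" by simp
  then show ?thesis
    by (rule tendsto_sandwich[OF _ _ tendsto_const, rotated 2]) (use le in auto)
qed

definition X_lim :: "real \<Rightarrow> 'b \<Rightarrow> real" where
  "X_lim t \<omega> = limit_path (path_of W_lim \<omega>) t"

lemma path_pair_lim: "path_pair T W_lim X_lim \<omega> = (path_of W_lim \<omega>, limit_path (path_of W_lim \<omega>))"
  by (auto simp: path_pair_def X_lim_def limit_path_def restrict_def)

lemma path_pair_n: "path_pair T (W n) (X n) \<omega> = (wpath n \<omega>, X_path n \<omega>)"
  by (simp add: path_pair_def X_path_def)

lemma X_lim_formula: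
  "AE \<omega> in M_lim. \<forall>t\<in>{0..T}. ereal (X_lim t \<omega>) =
     Inf (ereal ` {s. 0 \<le> s \<and> (1 + lam_lim) * s - nu_lim * W_lim (f_lim s) \<omega> > G0_lim t})"
proof -
  have TT: "T \<in> {0..T}" using T by simp
  show ?thesis
    using passage_wald(3)[OF bm_lim G0_lim_nonneg[OF TT]]
  proof eventually_elim
    case (elim \<omega>)
    show ?case
    proof
      fix t assume t: "t \<in> {0..T}"
      let ?h = "barrier (1 + lam_lim) nu_lim f_lim (path_of W_lim \<omega>)"
      let ?S = "{s. 0 \<le> s \<and> (1 + lam_lim) * s - nu_lim * W_lim (f_lim s) \<omega> > G0_lim t}"
      have S: "?S = {s. 0 \<le> s \<and> G0_lim t < ?h s}"
        using f_lim_nonneg by (auto simp: barrier_def)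
      have c: "crosses (G0_lim t) (path_of W_lim \<omega>)"
        by (rule crosses_mono[OF elim]) (use G0_lim_mono[of t T] t in auto)
      have ne: "?S \<noteq> {}" using c unfolding S crosses_def by blast
      have "X_lim t \<omega> = Inf ?S"
        unfolding X_lim_def limit_path_def S using elim t c
        by (simp add: passage_def first_passage_def crosses_def)
      moreover have "ereal (Inf ?S) = Inf (ereal ` ?S)"
        by (rule ereal_Inf') (use ne in \<open>auto intro: bdd_belowI[of _ 0]\<close>)
      ultimately show "ereal (X_lim t \<omega>) = Inf (ereal ` ?S)" by simp
    qed
  qed
qed

lemma joint_convergence:
  "converges_in_law (D_circ_topology T) M (\<lambda>n. path_pair T (W n) (X n)) M_lim (path_pair T W_lim X_lim)"
proof -
  let ?B = "borel_of (D_circ_topology T)"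
  have mn: "path_pair T (W n) (X n) \<in> M n \<rightarrow>\<^sub>M ?B" for n
    using path_pair_measurable_borel_of[OF T wpath_measurable X_path_measurable X_path_D_up, of n]
    by (simp add: path_pair_n[abs_def])
  have v: "path_of W_lim \<in> measurable M_lim path_space" by (rule path_of_measurable[OF bm_lim])
  have ml: "path_pair T W_lim X_lim \<in> M_lim \<rightarrow>\<^sub>M ?B"
    using path_pair_measurable_borel_of[OF T v measurable_compose[OF v limit_path_measurable] limit_path_D_up]
    by (simp add: path_pair_lim[abs_def])
  have "weak_convergence (D_circ_topology T) (\<lambda>n. distr (M n) ?B (path_pair T (W n) (X n))) (distr M_lim ?B
      (path_pair T W_lim X_lim))"
    unfolding weak_convergence_def
  proof (intro conjI allI impI)
    show "finite_measure (distr (M n) ?B (path_pair T (W n) (X n)))" for n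
      by (rule sol.finite_measure_distr[OF mn])
    show "finite_measure (distr M_lim ?B (path_pair T W_lim X_lim))"
      by (rule lim.finite_measure_distr[OF ml])
    fix F :: "(real \<Rightarrow> real) \<times> (real \<Rightarrow> real) \<Rightarrow> real"
    assume F: "continuous_map (D_circ_topology T) euclideanreal F \<and>
        bounded (F ` topspace (D_circ_topology T))"
    have "(\<lambda>n. \<integral>\<omega>. F (wpath n \<omega>, X_path n \<omega>) \<partial>M n) \<longlonglongrightarrow>
        (\<integral>\<omega>. F (path_of W_lim \<omega>, limit_path (path_of W_lim \<omega>)) \<partial>M_lim)"
      by (rule law_convergence_of_close_paths[where M=M and w=wpath and N=M_lim and v="path_of W_lim"
          and \<Phi>=limit_path
          and Y=X_path and F=F, OF T sol.prob_space_axioms wpath_measurable lim.prob_space_axioms v law_eq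
          limit_path_measurable limit_path_D_up X_path_measurable X_path_D_up X_path_close]) (use F in auto)
    moreover have Fm: "F \<in> borel_measurable ?B" by (rule continuous_map_borel_measurable) (use F in auto)
    ultimately show "(\<lambda>n. \<integral>x. F x \<partial>distr (M n) ?B (path_pair T (W n) (X n))) \<longlonglongrightarrow>
        (\<integral>x. F x \<partial>distr M_lim ?B (path_pair T W_lim X_lim))"
      using integral_distr[OF mn Fm] integral_distr[OF ml Fm] by (simp add: path_pair_n path_pair_lim)
  qed simp_all
  then show ?thesis unfolding converges_in_law_def using mn ml by blast
qed

end

theorem theorem3p9:
  fixes T :: real
    and lam nu :: "nat \<Rightarrow> real" and lam_lim nu_lim :: real
    and f :: "nat \<Rightarrow> real \<Rightarrow> real" and f_lim :: "real \<Rightarrow> real"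
    and K :: "nat \<Rightarrow> real \<Rightarrow> real"
    and G0 :: "nat \<Rightarrow> real \<Rightarrow> real" and G0_lim :: "real \<Rightarrow> real"
    and M :: "nat \<Rightarrow> 'a measure"
    and W X :: "nat \<Rightarrow> real \<Rightarrow> 'a \<Rightarrow> real"
    and M_lim :: "'b measure" and W_lim :: "real \<Rightarrow> 'b \<Rightarrow> real"
  assumes T: "T > 0"
    and lam_nonneg: "\<And>n. lam n \<ge> 0"
    and nu_nonneg: "\<And>n. nu n \<ge> 0"
    and f: "\<And>n. admissible_time_change (f n)"
    and K: "\<And>n. L1_loc_nonneg (K n)"
    and G0: "\<And>n. mono_on {0..} (G0 n) \<and> G0 n 0 = 0 \<and> (\<forall>t\<ge>0. 0 \<le> G0 n t)"
    and solution: "\<And>n. weak_solution T (G0 n) (K n) (f n) (lam n) (nu n) (M n) (W n) (X n)"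
    and K_conv: "weak_convergence (top_of_set {0..T}) (\<lambda>n. kernel_measure T (K n)) (dirac_zero T)"
    and G0_conv: "\<And>t. t \<in> {0..T} \<Longrightarrow> (\<lambda>n. G0 n t) \<longlonglongrightarrow> G0_lim t"
    and G0_lim_cont: "continuous_on {0..T} G0_lim"
    and f_conv: "locally_uniform_limit f f_lim"
    and f_growth: "bdd_above {f n x / (1 + x\<^sup>2) | n x. 0 \<le> x}"
    and lam_conv: "lam \<longlonglongrightarrow> lam_lim"
    and nu_conv: "nu \<longlonglongrightarrow> nu_lim"
    and W_lim: "standard_brownian_motion M_lim W_lim"
  shows "\<exists>X_lim :: real \<Rightarrow> 'b \<Rightarrow> real.
    (AE \<omega> in M_lim. \<forall>t\<in>{0..T}.
       ereal (X_lim t \<omega>) =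
       Inf (ereal ` {s. 0 \<le> s \<and> (1 + lam_lim) * s - nu_lim * W_lim (f_lim s) \<omega> > G0_lim t})) \<and>
    converges_in_law (D_circ_topology T)
      M (\<lambda>n. path_pair T (W n) (X n)) M_lim (path_pair T W_lim X_lim)"
proof -
  interpret volterra_limit T lam nu lam_lim nu_lim f f_lim K G0 G0_lim M W X M_lim W_lim
    by unfold_locales (fact assms)+
  show ?thesis using X_lim_formula joint_convergence by blast
qed

end
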